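(* Let $M$ be a pure abelian T-motive over $\mathbb F_q[T]$ of rank $r$ and dimension $n$, and let $m\ge1$ be an integer with $(T-\theta)^m(M/\tau M)=0$. If $rm-n>0$, then the $m$-dual $M'$ of $M$ exists (as an abelian T-motive), and $M'$ is pure.
   Context: $\mathbb C_\infty$ is the completion of an algebraic closure of $\mathbb F_q((1/\theta))$; $\mathbb C_\infty[T,\tau]$ has relations $Ta=aT$, $T\tau=\tau T$, $\tau a=a^q\tau$. An abelian T-motive is a left $\mathbb C_\infty[T,\tau]$-module free and finitely generated over $\mathbb C_\infty[T]$ (rank $r$) and over $\mathbb C_\infty[\tau]$ (dimension $n$) with $(T-\theta)^m(M/\tau M)=0$ for some $m$. For $\mu\ge1$, the $\mu$-dual of $M$: choosing a $\mathbb C_\infty[T]$-basis $f_*$ of $M$ with $\tau f_*=Qf_*$, an abelian T-motive $M'$ is the $\mu$-dual if it has a $\mathbb C_\infty[T]$-basis $f'_*$ with $\tau f'_*=(T-\theta)^\mu(Q^t)^{-1}f'_*$ (equivalently $M'\otimes\mathbb C_\infty(T)\cong\mathrm{Hom}_{\mathbb C_\infty(T)}(M\otimes\mathbb C_\infty(T),\mathfrak C^{\otimes\mu}\otimes\mathbb C_\infty(T))$ with $\tau\varphi=\tau\circ\varphi\circ\tau^{-1}$, $\mathfrak C$ the Carlitz motive $\tau\mathfrak f=(T-\theta)\mathfrak f$). $M$ is pure if there are a finitely generated $\mathbb C_\infty[[1/T]]$-submodule $W\subset M\otimes_{\mathbb C_\infty[T]}\mathbb C_\infty((1/T))$ spanning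 it and integers $u,v>0$ such that the $\mathbb C_\infty[[1/T]]$-span of $\tau^v(W)$ equals $T^uW$. *)

theory Defs
  imports
    "HOL-Analysis.Analysis"
    "HOL-Library.Poly_Mapping"
    "HOL-Computational_Algebra.Computational_Algebra"
    "HOL-Algebra.Algebraic_Closure_Type"
    "Jordan_Normal_Form.Ring_Hom_Matrix"
begin

section \<open>The field \<open>\<complex>\<^sub>\<infinity>\<close>\<close>

text \<open>
  The finite field is a type \<open>'f\<close> and \<open>q = CARD('f)\<close>. The field of Laurent series in \<open>1/\<theta>\<close> is
  \<open>'f fls\<close>, whose variable \<open>fls_X\<close> stands for \<open>1/\<theta>\<close>.
\<close>

definition laurent_abs :: "'f::{field,finite} fls \<Rightarrow> real" where
  "laurent_abs f = (if f = 0 then 0 else real CARD('f) powi (- fls_subdegree f))"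

text \<open>
  A field \<open>'c\<close> with absolute value \<open>av\<close> and embedding \<open>emb\<close> is a completion of the algebraic
  closure of \<open>'f fls\<close> with respect to the absolute value extending \<open>laurent_abs\<close>.
  The extension is unique because \<open>'f fls\<close> is complete, so these data are unique up to isomorphism.
\<close>

locale C_infinity =
  emb: field_hom emb
  for emb :: "'f::{field,finite} fls alg_closure \<Rightarrow> 'c::field" +
  fixes av :: "'c \<Rightarrow> real"
  assumes av_nonneg: "av x \<ge> 0"
    and av_eq_0_iff: "av x = 0 \<longleftrightarrow> x = 0"
    and av_mult: "av (x * y) = av x * av y"
    and av_ultrametric: "av (x + y) \<le> max (av x) (av y)"
    and av_extends: "av (emb (to_ac f)) = laurent_abs f"
    and complete: "Metric_space.mcomplete UNIV (\<lambda>x y. av (x - y))"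
    and dense: "Metric_space.mtopology UNIV (\<lambda>x y. av (x - y)) closure_of range emb = UNIV"

definition theta :: "('f::{field,finite} fls alg_closure \<Rightarrow> 'c::field) \<Rightarrow> 'c" where
  "theta emb = emb (to_ac fls_X_inv)"


section \<open>The ring \<open>\<complex>\<^sub>\<infinity>[T,\<tau>]\<close> and its left modules\<close>

text \<open>
  An element \<open>\<Sum>\<^sub>i a\<^sub>i \<tau>\<^sup>i\<close> with \<open>a\<^sub>i \<in> \<complex>\<^sub>\<infinity>[T]\<close> is represented by the element of \<open>'c poly poly\<close> with
  coefficients \<open>a\<^sub>i\<close>; the addition is that of \<open>'c poly poly\<close>, the multiplication is \<open>skew_mult\<close>.
\<close>

definition frob_poly :: "nat \<Rightarrow> 'c::field poly \<Rightarrow> 'c poly" where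
  "frob_poly q = map_poly (\<lambda>a. a ^ q)"

definition skew_mult :: "nat \<Rightarrow> 'c::field poly poly \<Rightarrow> 'c poly poly \<Rightarrow> 'c poly poly" where
  "skew_mult q x y =
     (\<Sum>i\<le>Polynomial.degree x. \<Sum>j\<le>Polynomial.degree y.
        Polynomial.monom
          (Polynomial.coeff x i * (frob_poly q ^^ i) (Polynomial.coeff y j)) (i + j))"

definition sk_const :: "'c::field \<Rightarrow> 'c poly poly" where "sk_const a = [:[:a:]:]"
definition sk_T :: "'c::field poly poly" where "sk_T = [:[:0, 1:]:]"
definition sk_tau :: "'c::field poly poly" where "sk_tau = [:0, 1:]"

definition sk_ring_T :: "'c::field poly poly set" where
  "sk_ring_T = range (\<lambda>p. [:p:])"

definition sk_ring_tau :: "'c::field poly poly set" where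
  "sk_ring_tau = range (map_poly (\<lambda>a. [:a:]))"

lemma skew_relations:
  assumes "q > 0"
  shows "skew_mult q sk_T (sk_const a) = skew_mult q (sk_const a) sk_T"
    and "skew_mult q sk_T sk_tau = skew_mult q sk_tau sk_T"
    and "skew_mult q sk_tau (sk_const a) = skew_mult q (sk_const (a ^ q)) sk_tau"
  using assms
  by (simp_all add: skew_mult_def sk_T_def sk_const_def sk_tau_def frob_poly_def map_poly_pCons)

text \<open>The module is the whole type \<open>'m\<close>; only the action of the ring is explicit.\<close>

definition skew_module :: "nat \<Rightarrow> ('c::field poly poly \<Rightarrow> 'm::ab_group_add \<Rightarrow> 'm) \<Rightarrow> bool" where
  "skew_module q act \<longleftrightarrow>
     (\<forall>a x y. act a (x + y) = act a x + act a y) \<and>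
     (\<forall>a b x. act (a + b) x = act a x + act b x) \<and>
     (\<forall>a b x. act (skew_mult q a b) x = act a (act b x)) \<and>
     (\<forall>x. act 1 x = x)"

text \<open>\<open>b 0, \<dots>, b (d - 1)\<close> is a basis of the module over the subring \<open>S\<close>.\<close>

definition is_basis ::
  "('s::zero \<Rightarrow> 'm::ab_group_add \<Rightarrow> 'm) \<Rightarrow> 's set \<Rightarrow> nat \<Rightarrow> (nat \<Rightarrow> 'm) \<Rightarrow> bool" where
  "is_basis act S d b \<longleftrightarrow>
     (\<forall>x. \<exists>c. (\<forall>i<d. c i \<in> S) \<and> x = (\<Sum>i<d. act (c i) (b i))) \<and>
     (\<forall>c. (\<forall>i<d. c i \<in> S) \<and> (\<Sum>i<d. act (c i) (b i)) = 0 \<longrightarrow> (\<forall>i<d. c i = 0))"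


section \<open>Abelian T-motives\<close>

text \<open>
  \<open>(T - \<theta>)\<^sup>m (M/\<tau>M) = 0\<close>, that is, \<open>(T - \<theta>)\<^sup>m M \<subseteq> \<tau>M\<close>.
\<close>

definition kills_coker ::
  "'c::field \<Rightarrow> nat \<Rightarrow> ('c poly poly \<Rightarrow> 'm::ab_group_add \<Rightarrow> 'm) \<Rightarrow> bool" where
  "kills_coker \<theta> m act \<longleftrightarrow> range (act [:[:- \<theta>, 1:] ^ m:]) \<subseteq> range (act sk_tau)"

definition abelian_T_motive ::
  "nat \<Rightarrow> 'c::field \<Rightarrow> nat \<Rightarrow> nat \<Rightarrow> ('c poly poly \<Rightarrow> 'm::ab_group_add \<Rightarrow> 'm) \<Rightarrow> bool" where
  "abelian_T_motive q \<theta> r n act \<longleftrightarrow>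
     skew_module q act \<and>
     (\<exists>f. is_basis act sk_ring_T r f) \<and>
     (\<exists>g. is_basis act sk_ring_tau n g) \<and>
     (\<exists>m. kills_coker \<theta> m act)"

text \<open>\<open>\<tau> f\<^sub>* = Q f\<^sub>*\<close>, where \<open>f\<^sub>*\<close> is a column of length \<open>r\<close>.\<close>

definition tau_matrix ::
  "('c::field poly poly \<Rightarrow> 'm::ab_group_add \<Rightarrow> 'm) \<Rightarrow> nat \<Rightarrow> (nat \<Rightarrow> 'm) \<Rightarrow> 'c poly mat \<Rightarrow> bool" where
  "tau_matrix act r f Q \<longleftrightarrow>
     Q \<in> carrier_mat r r \<and> (\<forall>i<r. act sk_tau (f i) = (\<Sum>j<r. act [:Q $$ (i, j):] (f j)))"

text \<open>
  The matrix of \<open>M'\<close> is \<open>Q' = (T - \<theta>)\<^sup>\<mu> (Q\<^sup>t)\<^sup>-\<^sup>1\<close>, where the inverse \<open>R\<close> is taken over \<open>\<complex>\<^sub>\<infinity>(T)\<close>.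
\<close>

definition is_mu_dual ::
  "nat \<Rightarrow> 'c::field \<Rightarrow> nat \<Rightarrow> ('c poly poly \<Rightarrow> 'm::ab_group_add \<Rightarrow> 'm) \<Rightarrow>
     ('c poly poly \<Rightarrow> 'n::ab_group_add \<Rightarrow> 'n) \<Rightarrow> bool" where
  "is_mu_dual q \<theta> \<mu> M M' \<longleftrightarrow>
     (\<exists>r' n'. abelian_T_motive q \<theta> r' n' M') \<and>
     (\<exists>r f Q f' Q' R.
        is_basis M sk_ring_T r f \<and> tau_matrix M r f Q \<and>
        is_basis M' sk_ring_T r f' \<and> tau_matrix M' r f' Q' \<and>
        R \<in> carrier_mat r r \<and>
        inverts_mat (transpose_mat (map_mat to_fract Q)) R \<and>
        inverts_mat R (transpose_mat (map_mat to_fract Q)) \<and>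
        map_mat to_fract Q' = to_fract ([:- \<theta>, 1:] ^ \<mu>) \<cdot>\<^sub>m R)"


section \<open>Purity\<close>

text \<open>
  The field \<open>\<complex>\<^sub>\<infinity>((1/T))\<close> is \<open>'c fls\<close>, whose variable \<open>fls_X\<close> stands for \<open>1/T\<close>. So
  \<open>\<complex>\<^sub>\<infinity>[[1/T]]\<close> is \<open>range fps_to_fls\<close>, and \<open>\<complex>\<^sub>\<infinity>[T]\<close> is embedded by \<open>T \<mapsto> fls_X_inv\<close>.
\<close>

definition poly_to_fls_inv :: "'c::field poly \<Rightarrow> 'c fls" where
  "poly_to_fls_inv p = poly (map_poly fls_const p) fls_X_inv"

definition frob_fls :: "nat \<Rightarrow> 'c::field fls \<Rightarrow> 'c fls" where
  "frob_fls q k = Abs_fls (\<lambda>i. fls_nth k i ^ q)"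

text \<open>
  \<open>M \<otimes>\<^bsub>\<complex>\<^sub>\<infinity>[T]\<^esub> \<complex>\<^sub>\<infinity>((1/T))\<close> is the free abelian group on \<open>M \<times> \<complex>\<^sub>\<infinity>((1/T))\<close> modulo the subgroup
  generated by the bilinearity relations; its elements are cosets of this subgroup.
\<close>

definition tensor_null ::
  "('c::field poly poly \<Rightarrow> 'm::ab_group_add \<Rightarrow> 'm) \<Rightarrow> ('m \<times> 'c fls \<Rightarrow>\<^sub>0 int) set" where
  "tensor_null act = group_closure
     ({frag_of (x + y, k) - frag_of (x, k) - frag_of (y, k) | x y k. True} \<union>
      {frag_of (x, k + l) - frag_of (x, k) - frag_of (x, l) | x k l. True} \<union>
      {frag_of (act [:p:] x, k) - frag_of (x, poly_to_fls_inv p * k) | p x k. True})"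

definition tensor_class ::
  "('c::field poly poly \<Rightarrow> 'm::ab_group_add \<Rightarrow> 'm) \<Rightarrow>
     ('m \<times> 'c fls \<Rightarrow>\<^sub>0 int) \<Rightarrow> ('m \<times> 'c fls \<Rightarrow>\<^sub>0 int) set" where
  "tensor_class act z = {w. w - z \<in> tensor_null act}"

definition tensor_space ::
  "('c::field poly poly \<Rightarrow> 'm::ab_group_add \<Rightarrow> 'm) \<Rightarrow> ('m \<times> 'c fls \<Rightarrow>\<^sub>0 int) set set" where
  "tensor_space act = range (tensor_class act)"

definition tensor_add ::
  "('m \<times> 'c::field fls \<Rightarrow>\<^sub>0 int) set \<Rightarrow> ('m \<times> 'c fls \<Rightarrow>\<^sub>0 int) set \<Rightarrow>
     ('m \<times> 'c fls \<Rightarrow>\<^sub>0 int) set" where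
  "tensor_add A B = {a + b | a b. a \<in> A \<and> b \<in> B}"

text \<open>
  The map on classes induced by a map \<open>h\<close> of the generators. For the maps \<open>h\<close> used below, which
  preserve the bilinearity relations, all classes in the union are equal.
\<close>

definition tensor_map ::
  "('c::field poly poly \<Rightarrow> 'm::ab_group_add \<Rightarrow> 'm) \<Rightarrow> ('m \<times> 'c fls \<Rightarrow> 'm \<times> 'c fls) \<Rightarrow>
     ('m \<times> 'c fls \<Rightarrow>\<^sub>0 int) set \<Rightarrow> ('m \<times> 'c fls \<Rightarrow>\<^sub>0 int) set" where
  "tensor_map act h A = (\<Union>z\<in>A. tensor_class act (frag_extend (\<lambda>e. frag_of (h e)) z))"

definition tensor_scale ::
  "('c::field poly poly \<Rightarrow> 'm::ab_group_add \<Rightarrow> 'm) \<Rightarrow> 'c fls \<Rightarrow>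
     ('m \<times> 'c fls \<Rightarrow>\<^sub>0 int) set \<Rightarrow> ('m \<times> 'c fls \<Rightarrow>\<^sub>0 int) set" where
  "tensor_scale act c = tensor_map act (\<lambda>(x, k). (x, c * k))"

definition tensor_tau ::
  "nat \<Rightarrow> ('c::field poly poly \<Rightarrow> 'm::ab_group_add \<Rightarrow> 'm) \<Rightarrow>
     ('m \<times> 'c fls \<Rightarrow>\<^sub>0 int) set \<Rightarrow> ('m \<times> 'c fls \<Rightarrow>\<^sub>0 int) set" where
  "tensor_tau q act = tensor_map act (\<lambda>(x, k). (act sk_tau x, frob_fls q k))"

inductive_set tensor_span ::
  "('c::field poly poly \<Rightarrow> 'm::ab_group_add \<Rightarrow> 'm) \<Rightarrow> 'c fls set \<Rightarrow>
     ('m \<times> 'c fls \<Rightarrow>\<^sub>0 int) set set \<Rightarrow> ('m \<times> 'c fls \<Rightarrow>\<^sub>0 int) set set"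
  for act S G where
  zero: "tensor_class act 0 \<in> tensor_span act S G"
| add: "c \<in> S \<Longrightarrow> A \<in> G \<Longrightarrow> B \<in> tensor_span act S G \<Longrightarrow>
         tensor_add (tensor_scale act c A) B \<in> tensor_span act S G"

definition pure_motive ::
  "nat \<Rightarrow> ('c::field poly poly \<Rightarrow> 'm::ab_group_add \<Rightarrow> 'm) \<Rightarrow> bool" where
  "pure_motive q act \<longleftrightarrow>
     (\<exists>W G u v.
        finite G \<and> G \<subseteq> tensor_space act \<and> W = tensor_span act (range fps_to_fls) G \<and>
        tensor_span act UNIV W = tensor_space act \<and>
        u > 0 \<and> v > 0 \<and>
        tensor_span act (range fps_to_fls) ((tensor_tau q act ^^ v) ` W) =
          tensor_scale act (fls_X_inv ^ u) ` W)"

end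

theory Submission
  imports Defs "Jordan_Normal_Form.Char_Poly" "Subresultants.More_Homomorphisms"
begin

text \<open>
  In coordinates \<open>\<tau>\<close> becomes \<open>x \<mapsto> A x\<^sup>\<sigma>\<close>, where \<open>\<sigma>\<close> raises the coefficients to the power \<open>q\<close>.
  Purity means that \<open>\<tau>\<^sup>v\<close> is given by \<open>T\<^sup>u U\<close> with \<open>U\<close> invertible over \<open>\<complex>\<^sub>\<infinity>[[1/T]]\<close> in a suitable
  basis \<open>P\<close> over \<open>\<complex>\<^sub>\<infinity>((1/T))\<close>. The dual matrix \<open>(T - \<theta>)\<^sup>m (A\<^sup>t)\<^sup>-\<^sup>1\<close> then has the same shape in the
  basis \<open>(P\<^sup>t)\<^sup>-\<^sup>1\<close>, with \<open>m v - u\<close> in place of \<open>u\<close>. Comparing determinants yields \<open>r u = v deg det A\<close>.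
  Since \<open>M/\<tau>M\<close> is generated by \<open>n\<close> elements over \<open>\<complex>\<^sub>\<infinity>\<close>, \<open>det A\<close> divides a characteristic polynomial
  of degree \<open>n\<close>, so \<open>r u \<le> v n < v r m\<close> and \<open>m v - u > 0\<close>.

  It remains to see that a pure module with \<open>M/\<tau>M\<close> of finite dimension has a basis over \<open>\<complex>\<^sub>\<infinity>[\<tau>]\<close>.
  The lattice filters \<open>M\<close> by \<open>\<complex>\<^sub>\<infinity>\<close>-subspaces that \<open>\<tau>\<close> shifts by \<open>u > 0\<close>. Generators of \<open>M/\<tau>M\<close> chosen
  as low as possible in this filtration form such a basis, by descent on the filtration.
\<close>

hide_const (open) UnivPoly.coeff UnivPoly.monom Polynomials.degree Module.smult
hide_type (open) Finite_Cartesian_Product.vec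
hide_const (open) Finite_Cartesian_Product.vec Finite_Cartesian_Product.row
unbundle no vec_syntax
unbundle no inner_syntax
no_notation fps_nth (infixl "$" 75)

section \<open>The Frobenius of \<open>\<complex>\<^sub>\<infinity>\<close>\<close>

lemma power_CARD_eq_self:
  fixes x :: "'f::{field,finite}"
  shows "x ^ CARD('f) = x"
proof (cases "x = 0")
  case False
  let ?U = "UNIV - {0::'f}"
  have "bij_betw ((*) x) ?U ?U"
    using False by (intro bij_betwI[of _ _ _ "\<lambda>y. y / x"]) auto
  then have "(\<Prod>y\<in>?U. x * y) = \<Prod>?U"
    by (rule prod.reindex_bij_betw)
  then have "x ^ card ?U * \<Prod>?U = 1 * \<Prod>?U"
    by (simp add: prod.distrib)
  moreover have "\<Prod>?U \<noteq> 0" by simp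
  ultimately have "x ^ card ?U = 1"
    by (metis mult_right_cancel)
  moreover have "CARD('f) = Suc (card ?U)"
    by (simp add: card_Diff_singleton)
  ultimately show ?thesis by (simp only: power_Suc mult_1_right)
qed (simp add: zero_power)

text \<open>
  The polynomial \<open>(X + 1)\<^sup>q - X\<^sup>q - 1\<close> has degree less than \<open>q\<close> and vanishes on the field with
  \<open>q\<close> elements, so its coefficients are zero.
\<close>

lemma of_nat_CARD_choose_eq_0:
  assumes "0 < i" "i < CARD('f::{field,finite})"
  shows "of_nat (CARD('f) choose i) = (0::'f)"
proof -
  let ?q = "CARD('f)"
  define p :: "'f poly" where
    "p = (\<Sum>j\<in>{0<..<?q}. monom (of_nat (?q choose j)) j)"
  have "poly p x = 0" for x
  proof -
    have "{..?q} = {0<..<?q} \<union> {0, ?q}" by auto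
    then have "(x + 1) ^ ?q = (\<Sum>k\<in>{0<..<?q} \<union> {0, ?q}. of_nat (?q choose k) * x ^ k)"
      by (simp add: binomial_ring)
    also have "\<dots> = poly p x + (x ^ ?q + 1)"
      by (subst sum.union_disjoint) (auto simp: p_def poly_sum poly_monom)
    finally have "x + 1 = poly p x + (x + 1)"
      unfolding power_CARD_eq_self .
    then show ?thesis by simp
  qed
  moreover have "degree p < ?q" unfolding p_def
    by (rule degree_sum_less) (auto intro: le_less_trans[OF degree_monom_le])
  ultimately have "p = 0"
    using card_poly_roots_bound[of p] by (cases "p = 0") auto
  then have "coeff p i = 0" by simp
  then show ?thesis
    using assms by (simp add: p_def coeff_sum sum.delta')
qed

locale frobenius_field =
  fixes ty :: "'c::field itself" and q :: nat
  assumes q_pos: "q > 0"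
    and frob_add: "(a + b :: 'c) ^ q = a ^ q + b ^ q"
    and frob_surj: "\<exists>b::'c. b ^ q = a"
begin

lemma frob_zero [simp]: "(0::'c) ^ q = 0"
  using q_pos by simp

lemma frob_sum: "(\<Sum>i\<in>I. f i :: 'c) ^ q = (\<Sum>i\<in>I. f i ^ q)"
  by (induction I rule: infinite_finite_induct) (simp_all add: frob_add)

lemma frobenius_field_power: "frobenius_field TYPE('c) (q ^ v)"
proof (induction v)
  case 0
  show ?case by unfold_locales auto
next
  case (Suc v)
  then interpret v: frobenius_field "TYPE('c)" "q ^ v" .
  show ?case
  proof
    fix a b :: 'c
    show "(a + b) ^ (q ^ Suc v) = a ^ (q ^ Suc v) + b ^ (q ^ Suc v)"
      by (simp add: power_mult frob_add v.frob_add)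
    show "\<exists>b. b ^ (q ^ Suc v) = a"
      by (metis frob_surj v.frob_surj power_mult power_Suc)
  qed (use q_pos in simp)
qed

end

context C_infinity
begin

lemma of_nat_eq_0_transfer:
  assumes "of_nat k = (0::'f)"
  shows "of_nat k = (0::'c)"
proof -
  have "(of_nat k :: 'f fls) = 0"
    using assms by (simp add: fls_of_nat)
  then have "(of_nat k :: 'f fls alg_closure) = 0"
    by (metis to_ac_0 to_ac_of_nat)
  then show ?thesis
    by (metis emb.hom_of_nat emb.hom_zero)
qed

lemma power_CARD_add: "(a + b :: 'c) ^ CARD('f) = a ^ CARD('f) + b ^ CARD('f)"
proof -
  let ?q = "CARD('f)"
  have "of_nat (?q choose k) = (0::'c)" if "k \<in> {0<..<?q}" for k
    using that by (intro of_nat_eq_0_transfer of_nat_CARD_choose_eq_0) auto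
  moreover have "{..?q} = {0<..<?q} \<union> {0, ?q}" by auto
  ultimately show ?thesis
    by (subst binomial_ring) (simp add: sum.union_disjoint)
qed

lemma av_1: "av 1 = 1"
  using av_mult[of 1 1] av_eq_0_iff[of 1] by simp

lemma av_power: "av (x ^ n) = av x ^ n"
  by (induction n) (simp_all add: av_1 av_mult)

lemma av_minus: "av (- x) = av x"
proof -
  have "av (- 1) ^ 2 = 1"
    by (simp add: av_1 flip: av_power)
  then have "av (- 1) = 1"
    using av_nonneg[of "- 1"] by (simp add: power2_eq_1_iff)
  then show ?thesis using av_mult[of "- 1" x] by simp
qed

lemma Metric_space_av: "Metric_space UNIV (\<lambda>x y. av (x - y))"
proof
  show "0 \<le> av (x - y)" for x y by (rule av_nonneg)
  show "av (x - y) = av (y - x)" for x y using av_minus[of "x - y"] by simp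
  show "av (x - y) = 0 \<longleftrightarrow> x = y" for x y by (simp add: av_eq_0_iff)
  show "av (x - z) \<le> av (x - y) + av (y - z)" for x y z
    using av_ultrametric[of "x - y" "y - z"] av_nonneg[of "x - y"] av_nonneg[of "y - z"] by simp
qed

lemma av_diff_power_CARD: "av (x ^ CARD('f) - y ^ CARD('f)) = av (x - y) ^ CARD('f)"
  using power_CARD_add[of "x - y" y] by (simp flip: av_power)

lemma av_diff_less_iff:
  assumes "\<epsilon> > 0"
  shows "av (x ^ CARD('f) - y ^ CARD('f)) < \<epsilon> ^ CARD('f) \<longleftrightarrow> av (x - y) < \<epsilon>"
  using assms by (simp add: av_diff_power_CARD av_nonneg flip: not_le)

sublocale metric: Metric_space UNIV "\<lambda>x y. av (x - y)"
  by (rule Metric_space_av)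

lemma MCauchy_if_MCauchy_power_CARD:
  assumes "metric.MCauchy (\<lambda>n. x n ^ CARD('f))"
  shows "metric.MCauchy x"
  unfolding metric.MCauchy_def
proof safe
  fix \<epsilon> :: real assume "\<epsilon> > 0"
  moreover from this have "\<epsilon> ^ CARD('f) > 0" by simp
  ultimately show "\<exists>N. \<forall>n n'. N \<le> n \<longrightarrow> N \<le> n' \<longrightarrow> av (x n - x n') < \<epsilon>"
    using assms by (simp add: metric.MCauchy_def flip: av_diff_less_iff)
qed auto

lemma limitin_power_CARD:
  assumes "limitin metric.mtopology x c sequentially"
  shows "limitin metric.mtopology (\<lambda>n. x n ^ CARD('f)) (c ^ CARD('f)) sequentially"
  unfolding metric.limitin_metric
proof safe
  fix \<epsilon> :: real assume "\<epsilon> > 0"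
  then have root: "root CARD('f) \<epsilon> > 0" "root CARD('f) \<epsilon> ^ CARD('f) = \<epsilon>" by auto
  have "\<forall>\<^sub>F n in sequentially. av (x n - c) < root CARD('f) \<epsilon>"
    using assms root(1) by (simp add: metric.limitin_metric)
  then show "\<forall>\<^sub>F n in sequentially. x n ^ CARD('f) \<in> UNIV \<and> av (x n ^ CARD('f) - c ^ CARD('f)) < \<epsilon>"
    unfolding av_diff_less_iff[OF root(1), unfolded root(2), symmetric] by simp
qed simp

text \<open>
  By \<open>av_diff_power_CARD\<close> the Frobenius is a homeomorphism onto its image. The image is
  therefore complete; it contains the dense subfield.
\<close>

lemma power_CARD_surj: "\<exists>b::'c. b ^ CARD('f) = a"
proof -
  let ?q = "CARD('f)"
  have "a \<in> metric.mtopology closure_of range emb" using dense by simp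
  then obtain y where y: "range y \<subseteq> range emb" "limitin metric.mtopology y a sequentially"
    unfolding metric.closure_of_sequentially by blast
  have "\<exists>b. emb b ^ ?q = y n" for n
  proof -
    obtain z where "y n = emb z" using y(1) by blast
    moreover obtain b where "b ^ ?q = z" using nth_root_exists[of ?q z] by auto
    ultimately show ?thesis by (metis emb.hom_power)
  qed
  then obtain b where b: "\<And>n. emb (b n) ^ ?q = y n" by metis
  have "metric.MCauchy y" using metric.convergent_imp_MCauchy[OF _ y(2)] by simp
  then have "metric.MCauchy (\<lambda>n. emb (b n))" 
    using MCauchy_if_MCauchy_power_CARD[of "\<lambda>n. emb (b n)"] by (simp add: b)
  then obtain c where "limitin metric.mtopology (\<lambda>n. emb (b n)) c sequentially"
    using complete unfolding metric.mcomplete_def by blast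
  then have "limitin metric.mtopology y (c ^ ?q) sequentially"
    using limitin_power_CARD[of "\<lambda>n. emb (b n)" c] by (simp add: b)
  then have "c ^ ?q = a" using y(2) metric.limitin_metric_unique by fastforce
  then show ?thesis ..
qed

lemma frobenius_field: "frobenius_field TYPE('c) CARD('f)"
  by unfold_locales (auto simp: power_CARD_add power_CARD_surj)

end


section \<open>Semilinear endomorphisms and their skew polynomials\<close>

locale semilinear_endomorphism = Modules.module scale
  for scale :: "'a::comm_ring_1 \<Rightarrow> 'm::ab_group_add \<Rightarrow> 'm" +
  fixes twist :: "'a \<Rightarrow> 'a" and tau :: "'m \<Rightarrow> 'm"
  assumes tau_add: "tau (x + y) = tau x + tau y"
    and tau_scale: "tau (scale a x) = scale (twist a) (tau x)"
begin

lemma tau_0 [simp]: "tau 0 = 0"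
  using tau_add[of 0 0] by simp

lemma tau_minus: "tau (- x) = - tau x"
  using tau_add[of x "- x"] by (simp add: eq_neg_iff_add_eq_0 add.commute)

lemma tau_sum: "tau (\<Sum>i\<in>I. f i) = (\<Sum>i\<in>I. tau (f i))"
  by (induction I rule: infinite_finite_induct) (auto simp: tau_add)

lemma semilinear_endomorphism_funpow:
  "semilinear_endomorphism scale (twist ^^ j) (tau ^^ j)"
proof (induction j)
  case 0
  show ?case by unfold_locales auto
next
  case (Suc j)
  then interpret j: semilinear_endomorphism scale "twist ^^ j" "tau ^^ j" .
  show ?case by unfold_locales (auto simp: tau_add tau_scale j.tau_add j.tau_scale)
qed

definition skew_act :: "'a poly \<Rightarrow> 'm \<Rightarrow> 'm" where
  "skew_act p x = (\<Sum>j\<le>degree p. scale (coeff p j) ((tau ^^ j) x))"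

lemma skew_act_eq_sum:
  assumes "degree p \<le> N"
  shows "skew_act p x = (\<Sum>j\<le>N. scale (coeff p j) ((tau ^^ j) x))"
  unfolding skew_act_def using assms
  by (intro sum.mono_neutral_left) (auto simp: coeff_eq_0)

lemma skew_act_0 [simp]: "skew_act 0 x = 0"
  by (simp add: skew_act_def)

lemma skew_act_add_left: "skew_act (p + p') x = skew_act p x + skew_act p' x"
proof -
  let ?N = "max (degree p) (degree p')"
  have "skew_act (p + p') x = (\<Sum>j\<le>?N. scale (coeff (p + p') j) ((tau ^^ j) x))"
    by (rule skew_act_eq_sum) (rule degree_add_le_max)
  then show ?thesis
    by (simp add: skew_act_eq_sum[of p ?N] skew_act_eq_sum[of p' ?N] scale_left_distrib sum.distrib)
qed

lemma skew_act_sum_left: "skew_act (\<Sum>i\<in>I. p i) x = (\<Sum>i\<in>I. skew_act (p i) x)"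
  by (induction I rule: infinite_finite_induct) (auto simp: skew_act_add_left)

lemma skew_act_add_right: "skew_act p (x + y) = skew_act p x + skew_act p y"
proof -
  have "(tau ^^ j) (x + y) = (tau ^^ j) x + (tau ^^ j) y" for j
    by (rule semilinear_endomorphism.tau_add[OF semilinear_endomorphism_funpow])
  then show ?thesis by (simp add: skew_act_def scale_right_distrib sum.distrib)
qed

lemma skew_act_monom: "skew_act (monom a j) x = scale a ((tau ^^ j) x)"
proof -
  have "skew_act (monom a j) x = (\<Sum>i\<le>j. if j = i then scale a ((tau ^^ j) x) else 0)"
    by (subst skew_act_eq_sum[OF degree_monom_le]) (rule sum.cong, auto)
  then show ?thesis by simp
qed

lemma skew_act_const [simp]: "skew_act [:a:] x = scale a x"
  using skew_act_monom[of a 0] by (simp add: monom_0)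

lemma skew_act_pCons: "skew_act (pCons a p) x = scale a x + skew_act p (tau x)"
  by (subst skew_act_eq_sum[OF degree_pCons_le])
    (simp only: sum.atMost_Suc_shift coeff_pCons_0 coeff_pCons_Suc skew_act_def funpow_0
      funpow_Suc_right comp_apply)

lemma tau_skew_act:
  assumes "twist 0 = 0"
  shows "tau (skew_act p x) = skew_act (map_poly twist p) (tau x)"
  by (induction p arbitrary: x)
    (auto simp: skew_act_pCons tau_add tau_scale map_poly_pCons assms)

end

context frobenius_field
begin

lemma coeff_frob_poly [simp]: "coeff (frob_poly q (p :: 'c poly)) i = coeff p i ^ q"
  by (simp add: frob_poly_def coeff_map_poly)

lemma frob_poly_surj: "\<exists>p'. frob_poly q p' = (p :: 'c poly)"
proof (induction p)
  case 0
  show ?case by (rule exI[of _ 0]) (simp add: frob_poly_def)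
next
  case (pCons a p)
  then obtain p' b where "frob_poly q p' = p" "b ^ q = a" using frob_surj by blast
  then show ?case
    by (intro exI[of _ "pCons b p'"] poly_eqI) (auto simp: coeff_pCons split: nat.splits)
qed

lemma pCons_frob_poly_cases:
  fixes c :: "'i \<Rightarrow> 'c poly"
  obtains a c' where "c = (\<lambda>b. pCons (a b) (frob_poly q (c' b)))"
proof -
  have "\<exists>p. c b = pCons (coeff (c b) 0) (frob_poly q p)" for b
  proof (cases "c b")
    case (pCons a p)
    then show ?thesis using frob_poly_surj[of p] by auto
  qed
  then obtain c' where "\<And>b. c b = pCons (coeff (c b) 0) (frob_poly q (c' b))" by metis
  then have "c = (\<lambda>b. pCons (coeff (c b) 0) (frob_poly q (c' b)))" by (rule ext)
  then show thesis by (rule that)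
qed

end

locale frobenius_space =
  frobenius_field "TYPE('c)" q + vector_space scale + semilinear_endomorphism scale "\<lambda>a. a ^ q" tau
  for q :: nat and scale :: "'c::field \<Rightarrow> 'm::ab_group_add \<Rightarrow> 'm" and tau :: "'m \<Rightarrow> 'm"
begin

lemma subspace_range_tau: "subspace (range tau)"
proof (rule subspaceI)
  show "0 \<in> range tau" by (metis tau_0 rangeI)
  show "x + y \<in> range tau" if "x \<in> range tau" "y \<in> range tau" for x y
    using that by (auto simp flip: tau_add)
  show "scale a x \<in> range tau" if x: "x \<in> range tau" for a x
  proof -
    obtain y where "x = tau y" using x by blast
    moreover obtain b where "b ^ q = a" using frob_surj by blast
    ultimately have "scale a x = tau (scale b y)" by (simp add: tau_scale)
    then show ?thesis by blast
  qed
qed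

lemma skew_act_pCons_frob_poly:
  "skew_act (pCons a (frob_poly q p)) x = scale a x + tau (skew_act p x)"
  by (simp add: skew_act_pCons tau_skew_act frob_poly_def)

definition skew_comb :: "'m set \<Rightarrow> ('m \<Rightarrow> 'c poly) \<Rightarrow> 'm" where
  "skew_comb B c = (\<Sum>b\<in>B. skew_act (c b) b)"

definition skew_basis :: "'m set \<Rightarrow> bool" where
  "skew_basis B \<longleftrightarrow>
     finite B \<and> range (skew_comb B) = UNIV \<and> (\<forall>c. skew_comb B c = 0 \<longrightarrow> (\<forall>b\<in>B. c b = 0))"

lemma skew_comb_pCons_frob_poly:
  "skew_comb B (\<lambda>b. pCons (a b) (frob_poly q (c b))) =
     (\<Sum>b\<in>B. scale (a b) b) + tau (skew_comb B c)"
  by (simp add: skew_comb_def skew_act_pCons_frob_poly sum.distrib tau_sum)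

definition independent_mod_tau :: "'m set \<Rightarrow> bool" where
  "independent_mod_tau B \<longleftrightarrow> (\<forall>a. (\<Sum>b\<in>B. scale (a b) b) \<in> range tau \<longrightarrow> (\<forall>b\<in>B. a b = 0))"

lemma skew_comb_eq_0_imp_coeff_eq_0:
  assumes inj: "\<And>x. tau x = 0 \<Longrightarrow> x = 0" and indep: "independent_mod_tau B" and "b \<in> B"
  shows "skew_comb B c = 0 \<Longrightarrow> coeff (c b) j = 0"
proof (induction j arbitrary: c)
  case (0 c)
  obtain a c' where c: "c = (\<lambda>b. pCons (a b) (frob_poly q (c' b)))" by (rule pCons_frob_poly_cases)
  have "(\<Sum>b\<in>B. scale (a b) b) = tau (- skew_comb B c')"
    using 0 by (simp add: c skew_comb_pCons_frob_poly tau_minus eq_neg_iff_add_eq_0)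
  then have "a b = 0" using indep \<open>b \<in> B\<close> unfolding independent_mod_tau_def by blast
  then show ?case by (simp add: c)
next
  case (Suc j c)
  obtain a c' where c: "c = (\<lambda>b. pCons (a b) (frob_poly q (c' b)))" by (rule pCons_frob_poly_cases)
  have tau: "(\<Sum>b\<in>B. scale (a b) b) = tau (- skew_comb B c')"
    using Suc.prems by (simp add: c skew_comb_pCons_frob_poly tau_minus eq_neg_iff_add_eq_0)
  then have "\<forall>b\<in>B. a b = 0" using indep unfolding independent_mod_tau_def by blast
  then have "skew_comb B c' = 0" using tau inj by (simp add: tau_minus)
  then have "coeff (c' b) j = 0" by (rule Suc.IH)
  then show ?case by (simp add: c)
qed

lemma in_span_if_scale_in_span:
  assumes "scale a x \<in> span S" "a \<noteq> 0"
  shows "x \<in> span S"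
  using span_scale[OF assms(1), of "inverse a"] assms(2) by simp

definition generates_coker :: "'m set \<Rightarrow> bool" where
  "generates_coker B \<longleftrightarrow> finite B \<and> span (B \<union> range tau) = UNIV"

lemma generates_cokerE:
  assumes "generates_coker B"
  obtains a y where "x = (\<Sum>b\<in>B. scale (a b) b) + tau y"
proof -
  have "x \<in> span (B \<union> range tau)" using assms by (simp add: generates_coker_def)
  then obtain z y where "z \<in> span B" "x = z + tau y"
    using span_eq_iff[THEN iffD2, OF subspace_range_tau] by (auto simp: span_Un)
  moreover obtain a where "z = (\<Sum>b\<in>B. scale (a b) b)"
    using \<open>z \<in> span B\<close> assms by (auto simp: generates_coker_def span_finite)
  ultimately show thesis using that by blast
qed

end

locale filtered_frobenius_space = frobenius_space q scale tau
  for q :: nat and scale :: "'c::field \<Rightarrow> 'm::ab_group_add \<Rightarrow> 'm" and tau :: "'m \<Rightarrow> 'm" +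
  fixes F :: "nat \<Rightarrow> 'm set" and u :: nat
  assumes u_pos: "u > 0"
    and F_subspace: "subspace (F k)"
    and F_mono: "k \<le> l \<Longrightarrow> F k \<subseteq> F l"
    and F_exhaust: "\<exists>k. x \<in> F k"
    and F_0: "F 0 = {0}"
    and F_tau: "tau x \<in> F (k + u) \<longleftrightarrow> x \<in> F k"
begin

lemma tau_eq_0_imp: "tau x = 0 \<Longrightarrow> x = 0"
  using F_tau[of x 0] subspace_0[OF F_subspace, of u] by (simp add: F_0)

definition level :: "'m \<Rightarrow> nat" where
  "level x = (LEAST k. x \<in> F k)"

lemma in_F_iff_level_le: "x \<in> F k \<longleftrightarrow> level x \<le> k"
  using LeastI_ex[OF F_exhaust, of x] F_mono[of "level x" k] Least_le[of "\<lambda>k. x \<in> F k" k]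
  unfolding level_def by blast

definition weight :: "'m set \<Rightarrow> nat" where
  "weight B = (\<Sum>b\<in>B. Suc (level b))"

text \<open>
  The summand \<open>Suc\<close> in the weight makes a generating set of minimal weight irredundant.
\<close>

definition minimal_generators :: "'m set \<Rightarrow> bool" where
  "minimal_generators B \<longleftrightarrow>
     generates_coker B \<and> (\<forall>B'. generates_coker B' \<longrightarrow> weight B \<le> weight B')"

lemma minimal_generators_exist:
  assumes "generates_coker B"
  obtains B' where "minimal_generators B'"
  using ex_has_least_nat[of generates_coker B weight, OF assms] that
  unfolding minimal_generators_def by blast

lemma minimal_generatorsD:
  assumes "minimal_generators B"
  shows "finite B" and "generates_coker B" and "generates_coker B' \<Longrightarrow> weight B \<le> weight B'"
  using assms by (auto simp: minimal_generators_def generates_coker_def)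

lemma weight_remove:
  "finite B \<Longrightarrow> b \<in> B \<Longrightarrow> weight B = Suc (level b) + weight (B - {b})"
  by (simp add: weight_def sum.remove)

lemma generates_coker_if_in_span:
  assumes "generates_coker B" "finite B'" "B - {b} \<subseteq> B'" "b \<in> span (B' \<union> range tau)"
  shows "generates_coker B'"
proof -
  have "B \<union> range tau \<subseteq> span (B' \<union> range tau)"
    using assms(3,4) by (auto intro: span_base)
  then have "span (B \<union> range tau) \<subseteq> span (B' \<union> range tau)" by (intro span_minimal) auto
  then show ?thesis using assms(1,2) by (auto simp: generates_coker_def)
qed

lemma minimal_generators_irredundant:
  assumes "minimal_generators B" "b \<in> B"
  shows "b \<notin> span ((B - {b}) \<union> range tau)"
proof
  assume redundant: "b \<in> span ((B - {b}) \<union> range tau)"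
  note B = minimal_generatorsD[OF assms(1)]
  have "generates_coker (B - {b})"
    using B(1) by (intro generates_coker_if_in_span[OF B(2) _ _ redundant]) auto
  then have "weight B \<le> weight (B - {b})" by (rule B(3))
  then show False using weight_remove[OF B(1) assms(2)] by simp
qed

lemma minimal_generators_exchange:
  assumes "minimal_generators B" "b \<in> B" "b \<in> span (insert x (B - {b}) \<union> range tau)"
  shows "level b \<le> level x"
proof -
  note B = minimal_generatorsD[OF assms(1)]
  have "generates_coker (insert x (B - {b}))"
    using B(1) by (intro generates_coker_if_in_span[OF B(2) _ _ assms(3)]) auto
  then have "weight B \<le> weight (insert x (B - {b}))" by (rule B(3))
  also have "\<dots> \<le> Suc (level x) + weight (B - {b})"
    using B(1) by (simp add: weight_def sum.insert_if)
  finally show ?thesis using weight_remove[OF B(1) assms(2)] by simp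
qed

lemma minimal_generators_independent_mod_tau:
  assumes "minimal_generators B"
  shows "independent_mod_tau B"
  unfolding independent_mod_tau_def
proof (intro allI impI ballI, rule ccontr)
  fix a b assume tau: "(\<Sum>b\<in>B. scale (a b) b) \<in> range tau" and b: "b \<in> B" "a b \<noteq> 0"
  let ?S = "(B - {b}) \<union> range tau"
  have "(\<Sum>b'\<in>B - {b}. scale (a b') b') \<in> span ?S"
    by (intro span_sum span_scale span_base) auto
  moreover have "(\<Sum>b\<in>B. scale (a b) b) \<in> span ?S"
    using tau by (intro span_base) auto
  moreover have "scale (a b) b = (\<Sum>b\<in>B. scale (a b) b) - (\<Sum>b'\<in>B - {b}. scale (a b') b')"
    using minimal_generatorsD(1)[OF assms] b by (simp add: sum.remove)
  ultimately have "scale (a b) b \<in> span ?S" by (simp only: span_diff)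
  then have "b \<in> span ?S" using b(2) by (rule in_span_if_scale_in_span)
  then show False using minimal_generators_irredundant[OF assms b(1)] by blast
qed

lemma minimal_generators_level_le:
  assumes "minimal_generators B" "x = (\<Sum>b\<in>B. scale (a b) b) + tau y" "b \<in> B" "a b \<noteq> 0"
  shows "level b \<le> level x"
proof (rule minimal_generators_exchange[OF assms(1,3)])
  let ?S = "insert x (B - {b}) \<union> range tau"
  have "scale (a b) b = x - (\<Sum>b'\<in>B - {b}. scale (a b') b') - tau y"
    using minimal_generatorsD(1)[OF assms(1)] assms(2,3) by (simp add: sum.remove)
  also have "\<dots> \<in> span ?S"
    by (intro span_diff span_sum span_scale) (auto intro: span_base)
  finally show "b \<in> span ?S" using assms(4) by (rule in_span_if_scale_in_span)
qed

lemma minimal_generators_skew_span: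
  assumes "minimal_generators B"
  shows "x \<in> F k \<Longrightarrow> x \<in> range (skew_comb B)"
proof (induction k arbitrary: x rule: less_induct)
  case (less k x)
  obtain a y where x: "x = (\<Sum>b\<in>B. scale (a b) b) + tau y"
    by (rule generates_cokerE[OF minimal_generatorsD(2)[OF assms]])
  have "scale (a b) b \<in> F k" if "b \<in> B" for b
  proof (cases "a b = 0")
    case False
    then have "b \<in> F k"
      using minimal_generators_level_le[OF assms x that] less.prems by (simp add: in_F_iff_level_le)
    then show ?thesis by (rule subspace_scale[OF F_subspace])
  qed (simp add: subspace_0[OF F_subspace])
  then have "(\<Sum>b\<in>B. scale (a b) b) \<in> F k" by (rule subspace_sum[OF F_subspace])
  then have tau_y: "tau y \<in> F k"
    using subspace_diff[OF F_subspace less.prems, of "\<Sum>b\<in>B. scale (a b) b"] by (simp add: x)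
  have "y \<in> range (skew_comb B)"
  proof (cases "k < u")
    case True
    then have "tau y \<in> F (0 + u)" using tau_y F_mono[of k u] by auto
    then have "y = skew_comb B (\<lambda>_. 0)" unfolding F_tau by (simp add: F_0 skew_comb_def)
    then show ?thesis by blast
  next
    case False
    then have "y \<in> F (k - u)" using tau_y F_tau[of y "k - u"] by simp
    then show ?thesis using False u_pos by (intro less.IH) auto
  qed
  then obtain c where "y = skew_comb B c" by blast
  then have "x = skew_comb B (\<lambda>b. pCons (a b) (frob_poly q (c b)))"
    by (simp add: x skew_comb_pCons_frob_poly)
  then show ?case by blast
qed

theorem skew_basis_exists:
  assumes "generates_coker S"
  obtains B where "skew_basis B"
proof -
  obtain B where B: "minimal_generators B" by (rule minimal_generators_exist[OF assms])
  have "c b = 0" if "skew_comb B c = 0" "b \<in> B" for c b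
    using skew_comb_eq_0_imp_coeff_eq_0[OF tau_eq_0_imp
        minimal_generators_independent_mod_tau[OF B] that(2,1)]
    by (simp add: poly_eq_iff)
  moreover have "finite B" by (rule minimal_generatorsD(1)[OF B])
  moreover have "range (skew_comb B) = UNIV"
    using F_exhaust minimal_generators_skew_span[OF B] by blast
  ultimately have "skew_basis B" by (simp add: skew_basis_def)
  then show thesis by (rule that)
qed

end

locale power_filtered_frobenius_space = frobenius_space q scale tau
  for q :: nat and scale :: "'c::field \<Rightarrow> 'm::ab_group_add \<Rightarrow> 'm" and tau :: "'m \<Rightarrow> 'm" +
  fixes F :: "int \<Rightarrow> 'm set" and u v d :: nat
  assumes u_pos: "u > 0" and v_pos: "v > 0"
    and F_subspace: "subspace (F k)"
    and F_mono: "k \<le> l \<Longrightarrow> F k \<subseteq> F l"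
    and F_exhaust: "\<exists>k. x \<in> F k"
    and F_minus: "F (- int d) = {0}"
    and F_tau_funpow: "(tau ^^ v) x \<in> F (k + int u) \<longleftrightarrow> x \<in> F k"
begin

text \<open>
  Averaging over \<open>\<tau>\<^sup>i\<close> for \<open>i < v\<close> turns the shift of \<open>F\<close> by \<open>u\<close> under \<open>\<tau>\<^sup>v\<close> into a shift by \<open>u\<close> under \<open>\<tau>\<close>;
  the levels are rescaled by \<open>v\<close>.
\<close>

definition average :: "int \<Rightarrow> 'm set" where
  "average k = {x. \<forall>i<v. (tau ^^ i) x \<in> F ((k + int i * int u) div int v)}"

lemma average_subspace: "subspace (average k)"
proof -
  have "(tau ^^ i) 0 = 0" "(tau ^^ i) (x + y) = (tau ^^ i) x + (tau ^^ i) y"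
    "(tau ^^ i) (scale a x) = scale (((\<lambda>a. a ^ q) ^^ i) a) ((tau ^^ i) x)" for i x y a
  proof -
    interpret i: semilinear_endomorphism scale "(\<lambda>a. a ^ q) ^^ i" "tau ^^ i"
      by (rule semilinear_endomorphism_funpow)
    show "(tau ^^ i) 0 = 0" by (rule i.tau_0)
    show "(tau ^^ i) (x + y) = (tau ^^ i) x + (tau ^^ i) y" by (rule i.tau_add)
    show "(tau ^^ i) (scale a x) = scale (((\<lambda>a. a ^ q) ^^ i) a) ((tau ^^ i) x)" by (rule i.tau_scale)
  qed
  then show ?thesis
    using subspace_0[OF F_subspace] subspace_add[OF F_subspace] subspace_scale[OF F_subspace]
    by (intro subspaceI) (auto simp: average_def)
qed

lemma average_mono:
  assumes "k \<le> l"
  shows "average k \<subseteq> average l"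
proof -
  have "F ((k + int i * int u) div int v) \<subseteq> F ((l + int i * int u) div int v)" for i
    using assms v_pos by (intro F_mono zdiv_mono1) auto
  then show ?thesis by (auto simp: average_def)
qed

lemma average_minus: "average (- int (v * d)) = {0}"
proof
  have "x \<in> F (- int d)" if "x \<in> average (- int (v * d))" for x
  proof -
    have "x \<in> F (- int (v * d) div int v)" using that v_pos by (auto simp: average_def dest: spec[of _ 0])
    moreover have "- int (v * d) div int v = - int d"
      using v_pos nonzero_mult_div_cancel_left[of "int v" "- int d"] by simp
    ultimately show ?thesis by simp
  qed
  then show "average (- int (v * d)) \<subseteq> {0}" by (auto simp: F_minus)
qed (simp add: subspace_0[OF average_subspace])

lemma average_exhaust: "\<exists>k. x \<in> average (int k)"
proof -
  have "\<forall>i. \<exists>k. (tau ^^ i) x \<in> F k" using F_exhaust by blast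
  from choice[OF this] obtain k where k: "\<And>i. (tau ^^ i) x \<in> F (k i)" by blast
  define K where "K = Max (insert 0 (k ` {..<v}))"
  have "0 \<le> K" by (simp add: K_def)
  have "(tau ^^ i) x \<in> F ((int v * K + int i * int u) div int v)" if "i < v" for i
  proof -
    have "k i \<le> K" using that by (simp add: K_def)
    also have "K = (int v * K) div int v" using v_pos by simp
    also have "\<dots> \<le> (int v * K + int i * int u) div int v"
      using v_pos by (intro zdiv_mono1) auto
    finally show ?thesis by (rule subsetD[OF F_mono k])
  qed
  then have "x \<in> average (int (v * nat K))" using \<open>0 \<le> K\<close> by (simp add: average_def)
  then show ?thesis ..
qed

lemma average_tau: "tau x \<in> average (k + int u) \<longleftrightarrow> x \<in> average k"
proof -
  define p where "p i \<longleftrightarrow> (tau ^^ i) x \<in> F ((k + int i * int u) div int v)" for i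
  have "(k + int v * int u) div int v = k div int v + int u" using v_pos by simp
  then have cycle: "p v \<longleftrightarrow> p 0" by (simp add: p_def F_tau_funpow)
  obtain w where w: "v = Suc w" using v_pos by (cases v) auto
  have "tau x \<in> average (k + int u) \<longleftrightarrow> (\<forall>i<v. p (Suc i))"
    unfolding average_def p_def by (simp add: funpow_swap1 algebra_simps)
  also have "\<dots> \<longleftrightarrow> (\<forall>i<w. p (Suc i)) \<and> p v" unfolding w by (auto simp: less_Suc_eq)
  also have "\<dots> \<longleftrightarrow> (\<forall>i<v. p i)" unfolding cycle unfolding w by (auto simp: less_Suc_eq_0_disj)
  also have "\<dots> \<longleftrightarrow> x \<in> average k" by (simp add: average_def p_def)
  finally show ?thesis .
qed

theorem filtered_frobenius_space_average:
  "filtered_frobenius_space q scale tau (\<lambda>k. average (int k - int (v * d))) u"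
proof
  fix x
  obtain k where "x \<in> average (int k)" using average_exhaust by blast
  then have "x \<in> average (int (k + v * d) - int (v * d))" by simp
  then show "\<exists>k. x \<in> average (int k - int (v * d))" ..
next
  fix x k
  show "tau x \<in> average (int (k + u) - int (v * d)) \<longleftrightarrow> x \<in> average (int k - int (v * d))"
    using average_tau[of x "int k - int (v * d)"] by (simp add: algebra_simps)
next
  show "average (int 0 - int (v * d)) = {0}" using average_minus by simp
qed (simp_all add: u_pos average_subspace average_mono)

end


section \<open>Laurent series in \<open>1/T\<close>\<close>

text \<open>\<open>fls_deg_le k h\<close> means \<open>h \<in> T\<^sup>k \<complex>\<^sub>\<infinity>[[1/T]]\<close>.\<close>

definition fls_deg_le :: "int \<Rightarrow> 'c::field fls \<Rightarrow> bool" where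
  "fls_deg_le k h \<longleftrightarrow> (\<forall>i. i < - k \<longrightarrow> fls_nth h i = 0)"

lemma fls_deg_le_0 [simp]: "fls_deg_le k 0"
  by (simp add: fls_deg_le_def)

lemma fls_deg_le_const [simp]: "fls_deg_le 0 (fls_const a)"
  by (simp add: fls_deg_le_def)

lemma fls_deg_le_iff: "fls_deg_le k h \<longleftrightarrow> h = 0 \<or> - fls_subdegree h \<le> k"
proof (cases "h = 0")
  case False
  then have "fls_nth h (fls_subdegree h) \<noteq> 0" by simp
  then show ?thesis
    unfolding fls_deg_le_def using False by (smt (verit) fls_eq0_below_subdegree)
qed simp

lemma fls_deg_le_1 [simp]: "fls_deg_le 0 1"
  by (simp add: fls_deg_le_iff)

lemma fls_deg_le_mono: "fls_deg_le k h \<Longrightarrow> k \<le> l \<Longrightarrow> fls_deg_le l h"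
  by (auto simp: fls_deg_le_def)

lemma fls_deg_le_add: "fls_deg_le k g \<Longrightarrow> fls_deg_le k h \<Longrightarrow> fls_deg_le k (g + h)"
  by (simp add: fls_deg_le_def)

lemma fls_deg_le_sum: "(\<And>i. i \<in> I \<Longrightarrow> fls_deg_le k (h i)) \<Longrightarrow> fls_deg_le k (\<Sum>i\<in>I. h i)"
  by (induction I rule: infinite_finite_induct) (auto intro: fls_deg_le_add)

lemma fls_deg_le_mult: "fls_deg_le k g \<Longrightarrow> fls_deg_le l h \<Longrightarrow> fls_deg_le (k + l) (g * h)"
  by (cases "g = 0 \<or> h = 0") (auto simp: fls_deg_le_iff)

lemma fls_deg_le_prod: "(\<And>i. i \<in> I \<Longrightarrow> fls_deg_le 0 (h i)) \<Longrightarrow> fls_deg_le 0 (\<Prod>i\<in>I. h i)"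
  by (induction I rule: infinite_finite_induct) (auto intro: fls_deg_le_mult[of 0 _ 0, simplified])

lemma fls_deg_le_X_inv_power_mult:
  "fls_deg_le (k + int n) (fls_X_inv ^ n * h) \<longleftrightarrow> fls_deg_le k h"
  by (cases "h = 0") (auto simp: fls_deg_le_iff fls_subdegree_mult_fls_X_inv_power)

lemma fls_X_inv_power_factor:
  fixes d :: "'c::field fls"
  assumes d: "d \<noteq> 0" "fls_subdegree d = - int k" and less: "u < k"
  obtains w where "w \<noteq> 0" "fls_subdegree w = 0"
    "d * inverse (fls_X_inv ^ u) = fls_X_inv ^ (k - u) * w"
proof
  let ?T = "fls_X_inv :: 'c fls"
  have "?T ^ k = ?T ^ (k - u) * ?T ^ u" using less by (simp flip: power_add)
  moreover have "d * inverse a = b * (d * inverse (b * a))" if "b \<noteq> 0" for a b :: "'c fls"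
    using that by (simp add: inverse_mult_distrib)
  from this[OF fls_X_inv_pow_nonzero]
  have "d * inverse (?T ^ u) = ?T ^ (k - u) * (d * inverse (?T ^ (k - u) * ?T ^ u))" .
  ultimately show "d * inverse (?T ^ u) = ?T ^ (k - u) * (d * inverse (?T ^ k))" by (simp only:)
  show "d * inverse (?T ^ k) \<noteq> 0" "fls_subdegree (d * inverse (?T ^ k)) = 0"
    using d by (auto simp: fls_inverse_subdegree)
qed

lemma fls_deg_le_ex: "\<exists>k::nat. fls_deg_le (int k) h"
  by (rule exI[of _ "nat (- fls_subdegree h)"]) (auto simp: fls_deg_le_iff)

lemma range_fps_to_fls: "(range fps_to_fls :: 'c::field fls set) = {h. fls_deg_le 0 h}"
proof safe
  fix h :: "'c fls" assume "fls_deg_le 0 h"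
  then have "fls_subdegree h \<ge> 0" by (auto simp: fls_deg_le_iff)
  then have "fps_to_fls (fls_regpart h) = h" by simp
  then show "h \<in> range fps_to_fls" by (metis rangeI)
qed (auto simp: fls_deg_le_def)

lemma poly_to_fls_inv_0 [simp]: "poly_to_fls_inv 0 = 0"
  by (simp add: poly_to_fls_inv_def)

lemma poly_to_fls_inv_pCons:
  "poly_to_fls_inv (pCons a p) = fls_const a + fls_X_inv * poly_to_fls_inv p"
  by (simp add: poly_to_fls_inv_def Polynomial.map_poly_pCons)

lemma poly_to_fls_inv_const: "poly_to_fls_inv [:a:] = fls_const a"
  by (simp add: poly_to_fls_inv_pCons)

lemma fls_nth_poly_to_fls_inv:
  "fls_nth (poly_to_fls_inv p) i = (if i \<le> 0 then coeff p (nat (- i)) else 0)"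
proof (induction p arbitrary: i)
  case (pCons a p)
  have "i < 0 \<Longrightarrow> nat (- i) = Suc (nat (- i - 1))" by linarith
  then show ?case
    by (auto simp: poly_to_fls_inv_pCons fls_X_inv_times_conv_shift pCons.IH)
qed simp

lemma poly_to_fls_inv_add: "poly_to_fls_inv (p + p') = poly_to_fls_inv p + poly_to_fls_inv p'"
  by (rule fls_eqI) (simp add: fls_nth_poly_to_fls_inv)

lemma poly_to_fls_inv_mult: "poly_to_fls_inv (p * p') = poly_to_fls_inv p * poly_to_fls_inv p'"
proof (induction p)
  case (pCons a p)
  have "poly_to_fls_inv (smult a p') = fls_const a * poly_to_fls_inv p'"
    by (rule fls_eqI) (simp add: fls_nth_poly_to_fls_inv)
  then show ?case
    by (simp add: mult_pCons_left poly_to_fls_inv_add poly_to_fls_inv_pCons pCons.IH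
        distrib_right mult.assoc)
qed simp

lemma fls_subdegree_poly_to_fls_inv:
  "fls_subdegree (poly_to_fls_inv p) = - int (degree p)"
proof (cases "p = 0")
  case False
  show ?thesis
  proof (rule fls_subdegree_eqI)
    show "fls_nth (poly_to_fls_inv p) (- int (degree p)) \<noteq> 0"
      using False by (simp add: fls_nth_poly_to_fls_inv)
    show "fls_nth (poly_to_fls_inv p) i = 0" if "i < - int (degree p)" for i
      using that by (simp add: fls_nth_poly_to_fls_inv coeff_eq_0)
  qed
qed simp

lemma inj_comm_ring_hom_poly_to_fls_inv:
  "inj_comm_ring_hom (poly_to_fls_inv :: 'c::field poly \<Rightarrow> _)"
proof
  show "poly_to_fls_inv 1 = (1 :: 'c fls)"
    using poly_to_fls_inv_const[of "1 :: 'c"] by simp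
  show "p = 0" if "poly_to_fls_inv p = 0" for p :: "'c poly"
  proof (rule poly_eqI)
    show "coeff p n = coeff 0 n" for n
      using fls_nth_poly_to_fls_inv[of p "- int n"] that by simp
  qed
qed (simp_all add: poly_to_fls_inv_add poly_to_fls_inv_mult)

interpretation poly_to_fls_inv_hom: inj_comm_ring_hom "poly_to_fls_inv :: 'c::field poly \<Rightarrow> _"
  by (rule inj_comm_ring_hom_poly_to_fls_inv)

lemma fls_deg_le_poly_to_fls_inv_neg:
  assumes "fls_deg_le k (poly_to_fls_inv p)" "k < 0"
  shows "p = 0"
  using assms by (auto simp: fls_deg_le_iff fls_subdegree_poly_to_fls_inv)

context frobenius_field
begin

lemma fls_nth_frob [simp]: "fls_nth (frob_fls q (k :: 'c fls)) i = fls_nth k i ^ q"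
  unfolding frob_fls_def
proof (rule nth_Abs_fls_lower_bound, intro allI impI)
  show "fls_nth k i ^ q = 0" if "i < fls_subdegree k" for i
    using that by simp
qed

lemma fls_deg_le_frob [simp]: "fls_deg_le k (frob_fls q (h :: 'c fls)) \<longleftrightarrow> fls_deg_le k h"
  using q_pos by (simp add: fls_deg_le_def)

lemma frob_fls_0 [simp]: "frob_fls q (0 :: 'c fls) = 0"
  by (rule fls_eqI) simp

lemma fls_subdegree_frob [simp]: "fls_subdegree (frob_fls q (h :: 'c fls)) = fls_subdegree h"
proof (cases "h = 0")
  case False
  then have "fls_nth h (fls_subdegree h) \<noteq> 0" by simp
  then show ?thesis by (intro fls_subdegree_eqI) auto
qed simp

lemma inj_comm_ring_hom_frob_fls: "inj_comm_ring_hom (frob_fls q :: 'c fls \<Rightarrow> 'c fls)"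
proof
  fix g h :: "'c fls"
  show "frob_fls q (g * h) = frob_fls q g * frob_fls q h"
    by (rule fls_eqI) (simp add: fls_times_nth(2) frob_sum power_mult_distrib)
  show "frob_fls q (g + h) = frob_fls q g + frob_fls q h"
    by (rule fls_eqI) (simp add: frob_add)
  show "frob_fls q 0 = (0 :: 'c fls)" by simp
  show "frob_fls q 1 = (1 :: 'c fls)" by (rule fls_eqI) simp
  show "h = 0" if "frob_fls q h = 0"
    using that q_pos by (simp add: fls_eq_iff)
qed

sublocale frob_fls_hom: inj_comm_ring_hom "frob_fls q :: 'c fls \<Rightarrow> 'c fls"
  by (rule inj_comm_ring_hom_frob_fls)

lemma frob_fls_iterate: "frob_fls q (frob_fls (q ^ v) (h :: 'c fls)) = frob_fls (q ^ Suc v) h"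
proof -
  interpret v: frobenius_field "TYPE('c)" "q ^ v" by (rule frobenius_field_power)
  interpret v': frobenius_field "TYPE('c)" "q ^ Suc v" by (rule frobenius_field_power)
  show ?thesis
    by (rule fls_eqI) (metis fls_nth_frob v.fls_nth_frob v'.fls_nth_frob power_mult power_Suc2)
qed

lemma poly_to_fls_inv_frob: "poly_to_fls_inv (frob_poly q (p :: 'c poly)) = frob_fls q (poly_to_fls_inv p)"
  by (rule fls_eqI) (simp add: fls_nth_poly_to_fls_inv)

lemma comm_ring_hom_frob_poly: "comm_ring_hom (frob_poly q :: 'c poly \<Rightarrow> 'c poly)"
  by unfold_locales
    (simp_all only: poly_to_fls_inv_hom.eq_iff[symmetric] poly_to_fls_inv_frob
      poly_to_fls_inv_hom.hom_add poly_to_fls_inv_hom.hom_mult poly_to_fls_inv_hom.hom_one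
      poly_to_fls_inv_hom.hom_zero frob_fls_hom.hom_add frob_fls_hom.hom_mult
      frob_fls_hom.hom_one frob_fls_hom.hom_zero)

sublocale frob_poly_hom: comm_ring_hom "frob_poly q :: 'c poly \<Rightarrow> 'c poly"
  by (rule comm_ring_hom_frob_poly)

end


section \<open>Inverse matrices\<close>

lemma smult_smult_mat: "a \<cdot>\<^sub>m (b \<cdot>\<^sub>m A) = (a * b :: 'a::semigroup_mult) \<cdot>\<^sub>m A"
  by (rule eq_matI) (auto simp: mult.assoc)

lemma one_smult_mat [simp]: "1 \<cdot>\<^sub>m A = (A :: 'a::monoid_mult mat)"
  by (rule eq_matI) auto

lemma transpose_smult: "(c \<cdot>\<^sub>m A)\<^sup>T = c \<cdot>\<^sub>m A\<^sup>T"
  by (rule eq_matI) auto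

lemma smult_mult_mat_vec:
  "A \<in> carrier_mat n m \<Longrightarrow> x \<in> carrier_vec m \<Longrightarrow> (c \<cdot>\<^sub>m A) *\<^sub>v x = c \<cdot>\<^sub>v (A *\<^sub>v x)"
  by (rule eq_vecI) (auto simp: scalar_prod_def sum_distrib_left mult.assoc)

lemma mult_mat_unit_vec:
  fixes A :: "'a::semiring_1 mat"
  shows "A \<in> carrier_mat n m \<Longrightarrow> j < m \<Longrightarrow> A *\<^sub>v unit_vec m j = col A j"
  by (rule eq_vecI) auto

lemma mult_mat_zero_vec: "A \<in> carrier_mat n m \<Longrightarrow> A *\<^sub>v 0\<^sub>v m = 0\<^sub>v n"
  by (rule eq_vecI) auto

lemma (in comm_ring_hom) mat_hom_smult: "mat\<^sub>h (c \<cdot>\<^sub>m A) = hom c \<cdot>\<^sub>m mat\<^sub>h A"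
  by (rule eq_matI) (auto simp: hom_mult)

definition inverse_mats :: "nat \<Rightarrow> 'a::semiring_1 mat \<Rightarrow> 'a mat \<Rightarrow> bool" where
  "inverse_mats r A B \<longleftrightarrow>
     A \<in> carrier_mat r r \<and> B \<in> carrier_mat r r \<and> A * B = 1\<^sub>m r \<and> B * A = 1\<^sub>m r"

lemma inverse_matsD:
  assumes "inverse_mats r A B"
  shows "A \<in> carrier_mat r r" "B \<in> carrier_mat r r" "A * B = 1\<^sub>m r" "B * A = 1\<^sub>m r"
  using assms by (auto simp: inverse_mats_def)

lemma inverse_mats_sym: "inverse_mats r A B \<Longrightarrow> inverse_mats r B A"
  by (auto simp: inverse_mats_def)

lemma inverse_mats_transpose:
  fixes A B :: "'a::comm_semiring_1 mat"
  assumes "inverse_mats r A B"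
  shows "inverse_mats r A\<^sup>T B\<^sup>T"
proof -
  note AB = inverse_matsD[OF assms]
  show ?thesis
    using AB by (simp add: inverse_mats_def flip: transpose_mult[OF AB(1,2)] transpose_mult[OF AB(2,1)])
qed

lemma inverse_mats_smult:
  fixes A B :: "'a::comm_semiring_1 mat"
  assumes "inverse_mats r A B" "a * b = 1"
  shows "inverse_mats r (a \<cdot>\<^sub>m A) (b \<cdot>\<^sub>m B)"
  using assms
  by (simp add: inverse_mats_def mult_smult_assoc_mat[of _ r r _ r] mult_smult_distrib[of _ r r _ r]
      smult_smult_mat mult.commute)

lemma inverse_mats_mult:
  assumes A: "inverse_mats r A A'" and B: "inverse_mats r B B'"
  shows "inverse_mats r (A * B) (B' * A')"
proof -
  note A = inverse_matsD[OF A] and B = inverse_matsD[OF B]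
  note assoc = assoc_mult_mat[of _ r r _ r _ r] and carrier = mult_carrier_mat[of _ r r _ r]
  have "A * B * (B' * A') = A * (B * B' * A')" "B' * A' * (A * B) = B' * (A' * A * B)"
    using A(1,2) B(1,2) by (simp_all add: assoc carrier)
  then show ?thesis
    using A B by (simp add: inverse_mats_def carrier left_mult_one_mat[of _ r r])
qed

lemma inverse_mats_if_det_nonzero:
  fixes A :: "'a::field mat"
  assumes A: "A \<in> carrier_mat r r" and "det A \<noteq> 0"
  obtains B where "inverse_mats r A B"
  using det_non_zero_imp_unit[OF assms, of "()"] A
  by (auto simp: Units_def ring_mat_def inverse_mats_def)

lemma det_nonzero_if_inverse_mats:
  fixes A B :: "'a::{comm_ring_1} mat"
  assumes "inverse_mats r A B"
  shows "det A * det B = 1"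
  using det_mult[of A r B] assms by (simp add: inverse_mats_def)

lemma inverse_mats_mult_vec [simp]:
  assumes "inverse_mats r A B" "x \<in> carrier_vec r"
  shows "A *\<^sub>v (B *\<^sub>v x) = x"
  using assms assoc_mult_mat_vec[of A r r B r x] by (simp add: inverse_mats_def)

lemma eq_smult_inverse_mat:
  fixes N Y Z :: "'a::comm_ring_1 mat"
  assumes inv: "inverse_mats r Y Z" and N: "N \<in> carrier_mat r r" and mult_eq: "N * Y = d \<cdot>\<^sub>m 1\<^sub>m r"
  shows "N = d \<cdot>\<^sub>m Z"
proof -
  note YZ = inverse_matsD[OF inv]
  have "N = N * (Y * Z)" using N by (simp add: YZ(3))
  also have "\<dots> = N * Y * Z" using N YZ(1,2) by (simp add: assoc_mult_mat[of _ r r _ r _ r])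
  also have "\<dots> = d \<cdot>\<^sub>m Z"
    unfolding mult_eq using YZ(2) by (simp add: mult_smult_assoc_mat[of _ r r _ r] left_mult_one_mat[of _ r r])
  finally show ?thesis .
qed

lemma transpose_mult_mult_smult_one:
  fixes A B P P' :: "'a::comm_ring_1 mat"
  assumes carrier: "A \<in> carrier_mat r r" "B \<in> carrier_mat r r" "P \<in> carrier_mat r r" "P' \<in> carrier_mat r r"
    and dual: "B\<^sup>T * A = c \<cdot>\<^sub>m 1\<^sub>m r"
  shows "(B * P)\<^sup>T * (A * P') = c \<cdot>\<^sub>m (P\<^sup>T * P')"
proof -
  have "(B * P)\<^sup>T * (A * P') = P\<^sup>T * (B\<^sup>T * A * P')"
    using carrier by (simp add: transpose_mult[of _ r r _ r] assoc_mult_mat[of _ r r _ r _ r]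
        mult_carrier_mat[of _ r r _ r])
  also have "\<dots> = c \<cdot>\<^sub>m (P\<^sup>T * P')"
    unfolding dual using carrier
    by (simp add: mult_smult_assoc_mat[of _ r r _ r] mult_smult_distrib[of _ r r _ r]
        left_mult_one_mat[of _ r r])
  finally show ?thesis .
qed


section \<open>Lattices\<close>

definition fls_vec_le :: "int \<Rightarrow> 'c::field fls vec \<Rightarrow> bool" where
  "fls_vec_le k x \<longleftrightarrow> (\<forall>i<dim_vec x. fls_deg_le k (x $ i))"

definition fls_mat_le :: "int \<Rightarrow> 'c::field fls mat \<Rightarrow> bool" where
  "fls_mat_le k A \<longleftrightarrow> (\<forall>i<dim_row A. \<forall>j<dim_col A. fls_deg_le k (A $$ (i, j)))"

lemma fls_vec_le_0 [simp]: "fls_vec_le k (0\<^sub>v r)"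
  by (simp add: fls_vec_le_def)

lemma fls_vec_le_unit [simp]: "fls_vec_le 0 (unit_vec r i)"
  by (simp add: fls_vec_le_def unit_vec_def)

lemma fls_vec_le_mono: "fls_vec_le k x \<Longrightarrow> k \<le> l \<Longrightarrow> fls_vec_le l x"
  by (auto simp: fls_vec_le_def intro: fls_deg_le_mono)

lemma fls_vec_le_add:
  "fls_vec_le k x \<Longrightarrow> fls_vec_le k y \<Longrightarrow> dim_vec x = dim_vec y \<Longrightarrow> fls_vec_le k (x + y)"
  by (auto simp: fls_vec_le_def intro: fls_deg_le_add)

lemma fls_vec_le_smult: "fls_deg_le l c \<Longrightarrow> fls_vec_le k x \<Longrightarrow> fls_vec_le (l + k) (c \<cdot>\<^sub>v x)"
  by (auto simp: fls_vec_le_def intro: fls_deg_le_mult)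

lemma fls_vec_le_X_inv_power_smult:
  "fls_vec_le (k + int n) (fls_X_inv ^ n \<cdot>\<^sub>v x) \<longleftrightarrow> fls_vec_le k x"
  by (simp add: fls_vec_le_def fls_deg_le_X_inv_power_mult)

lemma fls_vec_le_mult_mat_vec:
  assumes "fls_mat_le k A" "fls_vec_le l x" "dim_vec x = dim_col A"
  shows "fls_vec_le (k + l) (A *\<^sub>v x)"
  using assms
  by (auto simp: fls_vec_le_def fls_mat_le_def scalar_prod_def intro!: fls_deg_le_sum fls_deg_le_mult)

lemma fls_mat_le_smult: "fls_deg_le l c \<Longrightarrow> fls_mat_le k A \<Longrightarrow> fls_mat_le (l + k) (c \<cdot>\<^sub>m A)"
  by (auto simp: fls_mat_le_def intro: fls_deg_le_mult)

lemma fls_mat_le_transpose [simp]: "fls_mat_le k A\<^sup>T \<longleftrightarrow> fls_mat_le k A"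
  by (auto simp: fls_mat_le_def)

lemma fls_deg_le_common_bound:
  assumes "finite S"
  obtains k :: nat where "\<And>h. h \<in> S \<Longrightarrow> fls_deg_le (int k) h"
proof -
  have "\<exists>k::nat. \<forall>h\<in>S. fls_deg_le (int k) h"
    using assms
  proof induction
    case (insert h S)
    obtain k l :: nat where "\<forall>h\<in>S. fls_deg_le (int k) h" "fls_deg_le (int l) h"
      using insert.IH fls_deg_le_ex by blast
    then have "\<forall>h\<in>insert h S. fls_deg_le (int (max k l)) h"
      by (auto intro: fls_deg_le_mono)
    then show ?case by blast
  qed simp
  then show thesis using that by blast
qed

lemma fls_vec_le_ex: "\<exists>k::nat. fls_vec_le (int k) x"
proof -
  obtain k :: nat where "\<And>h. h \<in> (\<lambda>i. x $ i) ` {..<dim_vec x} \<Longrightarrow> fls_deg_le (int k) h"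
    by (rule fls_deg_le_common_bound[of "(\<lambda>i. x $ i) ` {..<dim_vec x}"]) auto
  then have "fls_vec_le (int k) x" by (simp add: fls_vec_le_def)
  then show ?thesis ..
qed

lemma fls_mat_le_ex: "\<exists>k::nat. fls_mat_le (int k) A"
proof -
  let ?S = "(\<lambda>ij. A $$ ij) ` ({..<dim_row A} \<times> {..<dim_col A})"
  obtain k :: nat where "\<And>h. h \<in> ?S \<Longrightarrow> fls_deg_le (int k) h"
    by (rule fls_deg_le_common_bound[of ?S]) auto
  then have "fls_mat_le (int k) A" by (auto simp: fls_mat_le_def)
  then show ?thesis ..
qed

inductive_set vec_span :: "nat \<Rightarrow> 'a::comm_ring_1 set \<Rightarrow> 'a vec set \<Rightarrow> 'a vec set"
  for r S G where
  zero: "0\<^sub>v r \<in> vec_span r S G"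
| add: "c \<in> S \<Longrightarrow> x \<in> G \<Longrightarrow> y \<in> vec_span r S G \<Longrightarrow> c \<cdot>\<^sub>v x + y \<in> vec_span r S G"

lemma vec_span_carrier:
  assumes "G \<subseteq> carrier_vec r"
  shows "vec_span r S G \<subseteq> carrier_vec r"
proof
  fix x assume "x \<in> vec_span r S G"
  then show "x \<in> carrier_vec r" by induction (use assms in auto)
qed

lemma scalar_prod_vec_span_eq_0:
  fixes w :: "'a::comm_ring_1 vec"
  assumes "x \<in> vec_span r S G" "w \<in> carrier_vec r" "G \<subseteq> carrier_vec r" "\<And>g. g \<in> G \<Longrightarrow> w \<bullet> g = 0"
  shows "w \<bullet> x = 0"
  using assms(1)
proof induction
  case (add c x y)
  then have "x \<in> carrier_vec r" "y \<in> carrier_vec r"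
    using assms(3) vec_span_carrier[OF assms(3)] by auto
  then show ?case using add assms(2,4) by (simp add: scalar_prod_add_distrib[of _ r])
qed (use assms(2) in simp)

lemma mult_mat_vec_in_vec_span:
  fixes P :: "'a::comm_ring_1 mat"
  assumes P: "P \<in> carrier_mat r n" and a: "a \<in> carrier_vec n"
    and mem: "\<And>i. i < n \<Longrightarrow> a $ i \<in> S" "\<And>i. i < n \<Longrightarrow> col P i \<in> G"
  shows "P *\<^sub>v a \<in> vec_span r S G"
proof -
  let ?partial = "\<lambda>k. vec r (\<lambda>j. \<Sum>i<k. P $$ (j, i) * a $ i)"
  have "?partial k \<in> vec_span r S G" if "k \<le> n" for k
    using that
  proof (induction k)
    case 0
    have "?partial 0 = 0\<^sub>v r" by (rule eq_vecI) auto
    then show ?case by (simp only: vec_span.zero)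
  next
    case (Suc k)
    have "?partial (Suc k) = a $ k \<cdot>\<^sub>v col P k + ?partial k"
      using P Suc.prems by (intro eq_vecI) auto
    then show ?case using Suc mem[of k] by (auto intro: vec_span.add)
  qed
  moreover have "?partial n = P *\<^sub>v a"
    using P a by (intro eq_vecI) (auto simp: scalar_prod_def atLeast0LessThan)
  ultimately show ?thesis by force
qed

definition column_lattice :: "nat \<Rightarrow> 'c::field fls mat \<Rightarrow> 'c fls vec set" where
  "column_lattice r P = (\<lambda>a. P *\<^sub>v a) ` {a \<in> carrier_vec r. fls_vec_le 0 a}"

lemma column_latticeI: "a \<in> carrier_vec r \<Longrightarrow> fls_vec_le 0 a \<Longrightarrow> P *\<^sub>v a \<in> column_lattice r P"
  by (auto simp: column_lattice_def)

lemma col_in_lattice: "P \<in> carrier_mat r r \<Longrightarrow> i < r \<Longrightarrow> col P i \<in> column_lattice r P"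
  using column_latticeI[of "unit_vec r i" r P] by (simp add: mult_mat_unit_vec)

lemma column_lattice_carrier: "P \<in> carrier_mat r r \<Longrightarrow> column_lattice r P \<subseteq> carrier_vec r"
  by (auto simp: column_lattice_def)

lemma vec_span_subset_lattice:
  assumes P: "P \<in> carrier_mat r r" and G: "G \<subseteq> column_lattice r P"
  shows "vec_span r (range fps_to_fls) G \<subseteq> column_lattice r P"
proof
  fix x assume "x \<in> vec_span r (range fps_to_fls) G"
  then show "x \<in> column_lattice r P"
  proof induction
    case zero
    show ?case using column_latticeI[of "0\<^sub>v r" r P] by (simp add: mult_mat_zero_vec[OF P])
  next
    case (add c x y)
    then have "x \<in> column_lattice r P" using G by blast
    then obtain a b where ab: "x = P *\<^sub>v a" "a \<in> carrier_vec r" "fls_vec_le 0 a"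
        "y = P *\<^sub>v b" "b \<in> carrier_vec r" "fls_vec_le 0 b"
      using add.IH by (auto simp: column_lattice_def)
    then have "c \<cdot>\<^sub>v x + y = P *\<^sub>v (c \<cdot>\<^sub>v a + b)"
      using P by (simp add: mult_add_distrib_mat_vec[of _ r r] mult_mat_vec[of _ r r])
    moreover have "fls_vec_le 0 (c \<cdot>\<^sub>v a + b)"
      using ab fls_vec_le_smult[of 0 c 0 a] add.hyps(1)
      by (intro fls_vec_le_add) (auto simp: range_fps_to_fls)
    ultimately show ?case using ab column_latticeI[of "c \<cdot>\<^sub>v a + b" r P] by simp
  qed
qed

lemma vec_span_eq_lattice:
  assumes P: "P \<in> carrier_mat r r" and "\<And>i. i < r \<Longrightarrow> col P i \<in> G" and "G \<subseteq> column_lattice r P"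
  shows "vec_span r (range fps_to_fls) G = column_lattice r P"
proof
  show "column_lattice r P \<subseteq> vec_span r (range fps_to_fls) G"
  proof
    fix x assume "x \<in> column_lattice r P"
    then obtain a where "x = P *\<^sub>v a" "a \<in> carrier_vec r" "fls_vec_le 0 a"
      by (auto simp: column_lattice_def)
    then show "x \<in> vec_span r (range fps_to_fls) G"
      using assms(2) by (auto intro!: mult_mat_vec_in_vec_span[OF P] simp: range_fps_to_fls fls_vec_le_def)
  qed
qed (rule vec_span_subset_lattice[OF assms(1,3)])

lemma column_lattice_smult:
  assumes "P \<in> carrier_mat r r"
  shows "column_lattice r (c \<cdot>\<^sub>m P) = (\<lambda>x. c \<cdot>\<^sub>v x) ` column_lattice r P"
  unfolding column_lattice_def image_image
  by (intro image_cong) (auto simp: smult_mult_mat_vec[OF assms])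

lemma column_lattice_subset_imp_factor:
  assumes A: "A \<in> carrier_mat r r" and P: "P \<in> carrier_mat r r" and "column_lattice r A \<subseteq> column_lattice r P"
  obtains U where "U \<in> carrier_mat r r" "fls_mat_le 0 U" "A = P * U"
proof -
  have "\<exists>a. a \<in> carrier_vec r \<and> fls_vec_le 0 a \<and> col A i = P *\<^sub>v a" if "i < r" for i
    using col_in_lattice[OF A that] assms(3) by (auto simp: column_lattice_def)
  then obtain a where a: "\<And>i. i < r \<Longrightarrow> a i \<in> carrier_vec r \<and> fls_vec_le 0 (a i) \<and> col A i = P *\<^sub>v a i"
    by metis
  define U where "U = mat_of_cols r (map a [0..<r])"
  have U: "U \<in> carrier_mat r r" by (auto simp: U_def)
  have col_U: "col U i = a i" if "i < r" for i
    using that a[OF that] by (simp add: U_def)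
  have "A = P * U"
  proof (rule mat_col_eqI)
    show "col A i = col (P * U) i" if "i < dim_col (P * U)" for i
      using that U P a[of i] col_U[of i] by (auto simp: col_mult2[of _ r r _ r])
  qed (use A P U in auto)
  moreover have "fls_mat_le 0 U"
    unfolding fls_mat_le_def
  proof (intro allI impI)
    fix i j assume "i < dim_row U" "j < dim_col U"
    then have "U $$ (i, j) = a j $ i" "j < r" "i < r"
      using U col_U[of j] index_col[of i U j] by auto
    then show "fls_deg_le 0 (U $$ (i, j))" using a[of j] by (auto simp: fls_vec_le_def)
  qed
  ultimately show thesis using U that by blast
qed

lemma column_lattice_mult_subset:
  assumes "P \<in> carrier_mat r r" "U \<in> carrier_mat r r" "fls_mat_le 0 U"
  shows "column_lattice r (P * U) \<subseteq> column_lattice r P"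
proof
  fix x assume "x \<in> column_lattice r (P * U)"
  then obtain a where a: "x = (P * U) *\<^sub>v a" "a \<in> carrier_vec r" "fls_vec_le 0 a"
    by (auto simp: column_lattice_def)
  then have "x = P *\<^sub>v (U *\<^sub>v a)" using assms by (simp add: assoc_mult_mat_vec[of _ r r _ r])
  moreover have "fls_vec_le 0 (U *\<^sub>v a)"
    using fls_vec_le_mult_mat_vec[OF assms(3) a(3)] a(2) assms(2) by auto
  ultimately show "x \<in> column_lattice r P" using assms(2) a(2) by (auto intro!: column_latticeI)
qed

definition integral_units :: "nat \<Rightarrow> 'c::field fls mat set" where
  "integral_units r = {U. \<exists>V. inverse_mats r U V \<and> fls_mat_le 0 U \<and> fls_mat_le 0 V}"

lemma integral_units_carrier: "U \<in> integral_units r \<Longrightarrow> U \<in> carrier_mat r r"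
  by (auto simp: integral_units_def inverse_mats_def)

lemma fls_vec_le_integral_unit:
  assumes U: "U \<in> integral_units r" and x: "x \<in> carrier_vec r"
  shows "fls_vec_le k (U *\<^sub>v x) \<longleftrightarrow> fls_vec_le k x"
proof -
  obtain V where inv: "inverse_mats r U V" and integral: "fls_mat_le 0 U" "fls_mat_le 0 V"
    using U by (auto simp: integral_units_def)
  note UV = inverse_matsD[OF inv]
  have "fls_vec_le k (U *\<^sub>v x)" if "fls_vec_le k x"
    using fls_vec_le_mult_mat_vec[OF integral(1) that] UV(1) x by simp
  moreover have "fls_vec_le k (V *\<^sub>v (U *\<^sub>v x))" if "fls_vec_le k (U *\<^sub>v x)"
    using fls_vec_le_mult_mat_vec[OF integral(2) that] UV(1,2) x by simp
  ultimately show ?thesis using inverse_mats_mult_vec[OF inverse_mats_sym[OF inv] x] by auto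
qed

lemma fls_deg_le_det:
  assumes A: "A \<in> carrier_mat r r" and "fls_mat_le 0 A"
  shows "fls_deg_le 0 (det A)"
proof -
  have "fls_deg_le 0 (signof p * (\<Prod>i = 0..<r. A $$ (i, p i)))" if p: "p permutes {0..<r}" for p
  proof -
    have "p i < r" if "i < r" for i using permutes_in_image[OF p, of i] that by simp
    then have "fls_deg_le 0 (\<Prod>i = 0..<r. A $$ (i, p i))"
      using assms by (intro fls_deg_le_prod) (auto simp: fls_mat_le_def)
    then show ?thesis by (simp add: sign_def fls_deg_le_def)
  qed
  then show ?thesis unfolding det_def'[OF A] by (intro fls_deg_le_sum) simp
qed

lemma det_integral_unit:
  assumes "U \<in> integral_units r"
  shows "det U \<noteq> 0" "fls_subdegree (det U) = 0"
proof -
  obtain V where inv: "inverse_mats r U V" and "fls_mat_le 0 U" "fls_mat_le 0 V"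
    using assms by (auto simp: integral_units_def)
  then have det_le: "fls_deg_le 0 (det U)" "fls_deg_le 0 (det V)"
    using inverse_matsD[OF inv] by (auto intro: fls_deg_le_det)
  have det_mult_eq: "det U * det V = 1" by (rule det_nonzero_if_inverse_mats[OF inv])
  then have det_nonzero: "det U \<noteq> 0" "det V \<noteq> 0" by auto
  then have "fls_subdegree (det U) + fls_subdegree (det V) = 0"
    using arg_cong[OF det_mult_eq, of fls_subdegree] by simp
  then show "det U \<noteq> 0" "fls_subdegree (det U) = 0" using det_le det_nonzero by (auto simp: fls_deg_le_iff)
qed

lemma smult_transpose_integral_unit:
  assumes inv: "inverse_mats r U V" and integral: "fls_mat_le 0 U" "fls_mat_le 0 V"
    and w: "w \<noteq> 0" "fls_subdegree w = 0"
  shows "w \<cdot>\<^sub>m V\<^sup>T \<in> integral_units r"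
proof -
  have "inverse_mats r (w \<cdot>\<^sub>m V\<^sup>T) (inverse w \<cdot>\<^sub>m U\<^sup>T)"
    using w(1) by (intro inverse_mats_smult inverse_mats_transpose inverse_mats_sym[OF inv]) simp
  moreover have "fls_mat_le 0 (w \<cdot>\<^sub>m V\<^sup>T)" "fls_mat_le 0 (inverse w \<cdot>\<^sub>m U\<^sup>T)"
    using integral w fls_mat_le_smult[of 0 w 0 "V\<^sup>T"] fls_mat_le_smult[of 0 "inverse w" 0 "U\<^sup>T"]
    by (auto simp: fls_deg_le_iff fls_inverse_subdegree)
  ultimately show ?thesis by (auto simp: integral_units_def)
qed

lemma column_lattice_eq_iff:
  assumes A: "A \<in> carrier_mat r r" and P: "inverse_mats r P P'"
  shows "column_lattice r A = column_lattice r P \<longleftrightarrow> (\<exists>U\<in>integral_units r. A = P * U)"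
proof
  assume lattice_eq: "column_lattice r A = column_lattice r P"
  note P = inverse_matsD[OF P]
  obtain U where U: "U \<in> carrier_mat r r" "fls_mat_le 0 U" "A = P * U"
    using column_lattice_subset_imp_factor[OF A P(1)] lattice_eq by blast
  obtain V where V: "V \<in> carrier_mat r r" "fls_mat_le 0 V" "P = A * V"
    using column_lattice_subset_imp_factor[OF P(1) A] lattice_eq by blast
  have "P = P * (U * V)"
    using V(3) P(1) U V(1) by (simp add: assoc_mult_mat[of _ r r _ r _ r])
  then have "P' * P = P' * (P * (U * V))" by simp
  also have "\<dots> = P' * P * (U * V)"
    using P(1,2) mult_carrier_mat[OF U(1) V(1)] by (intro assoc_mult_mat[symmetric])
  finally have "U * V = 1\<^sub>m r"
    unfolding P(4) left_mult_one_mat[OF mult_carrier_mat[OF U(1) V(1)]] by (rule sym)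
  then have "inverse_mats r U V"
    using mat_mult_left_right_inverse[OF U(1) V(1)] U V by (simp add: inverse_mats_def)
  then show "\<exists>U\<in>integral_units r. A = P * U" using U V by (auto simp: integral_units_def)
next
  assume "\<exists>U\<in>integral_units r. A = P * U"
  then obtain U V where "inverse_mats r U V" "fls_mat_le 0 U" "fls_mat_le 0 V" and factor: "A = P * U"
    by (auto simp: integral_units_def)
  note UV = inverse_matsD[OF this(1)] this(2,3)
  have "A * V = P"
    using UV inverse_matsD(1)[OF P] factor by (simp add: assoc_mult_mat[of _ r r _ r _ r])
  then have "column_lattice r P \<subseteq> column_lattice r A"
    using column_lattice_mult_subset[OF A UV(2,6)] by simp
  moreover have "column_lattice r A \<subseteq> column_lattice r P"
    unfolding factor by (rule column_lattice_mult_subset[OF inverse_matsD(1)[OF P] UV(1,5)])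
  ultimately show "column_lattice r A = column_lattice r P" by (intro equalityI)
qed

lemma col_replace_col:
  "P \<in> carrier_mat r r \<Longrightarrow> g \<in> carrier_vec r \<Longrightarrow> k < r \<Longrightarrow> i < r \<Longrightarrow>
    col (replace_col P g k) i = (if i = k then g else col P i)"
  by (rule eq_vecI) (auto simp: replace_col_def)

lemma replace_col_carrier [simp]: "P \<in> carrier_mat r r \<Longrightarrow> replace_col P g k \<in> carrier_mat r r"
  by (auto simp: replace_col_def)

lemma det_replace_col:
  fixes P :: "'a::comm_ring_1 mat"
  assumes "inverse_mats r P P'" "g \<in> carrier_vec r" "k < r"
  shows "det (replace_col P g k) = (P' *\<^sub>v g) $ k * det P"
  using cramer_lemma_mat[of P r "P' *\<^sub>v g" k] assms inverse_matsD[OF assms(1)] by simp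

lemma exists_col_replacement:
  fixes P :: "'a::field mat"
  assumes P: "P \<in> carrier_mat r r" "det P \<noteq> 0" and k: "k < r" and G: "G \<subseteq> carrier_vec r"
    and span: "vec_span r UNIV (vec_span r S G) = carrier_vec r"
  shows "\<exists>g\<in>G. det (replace_col P g k) \<noteq> 0"
proof (rule ccontr)
  assume singular: "\<not> ?thesis"
  obtain P' where inv: "inverse_mats r P P'" using inverse_mats_if_det_nonzero[OF P] by blast
  note P' = inverse_matsD[OF inv]
  have row: "row P' k \<in> carrier_vec r" using P'(2) k by simp
  have "row P' k \<bullet> g = 0" if "g \<in> G" for g
    using singular that det_replace_col[OF inv _ k, of g] P(2) G P'(2) k by auto
  then have "row P' k \<bullet> x = 0" if "x \<in> vec_span r S G" for x
    using scalar_prod_vec_span_eq_0[OF that row G] by blast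
  then have "row P' k \<bullet> x = 0" if "x \<in> vec_span r UNIV (vec_span r S G)" for x
    using scalar_prod_vec_span_eq_0[OF that row vec_span_carrier[OF G]] by blast
  then have "row P' k \<bullet> col P k = 0" using P k by (simp add: span)
  moreover have "(P' * P) $$ (k, k) = row P' k \<bullet> col P k" using P'(1,2) k by simp
  ultimately show False using P'(4) k by simp
qed

lemma det_nonzero_in_spanning_set:
  fixes G :: "'a::field vec set"
  assumes G: "G \<subseteq> carrier_vec r"
    and span: "vec_span r UNIV (vec_span r S G) = carrier_vec r"
  obtains P where "P \<in> carrier_mat r r" "det P \<noteq> 0" "\<And>i. i < r \<Longrightarrow> col P i \<in> G"
proof -
  have "\<exists>P\<in>carrier_mat r r. det P \<noteq> 0 \<and> (\<forall>i<k. col P i \<in> G)" if "k \<le> r" for k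
    using that
  proof (induction k)
    case 0
    show ?case by (intro bexI[of _ "1\<^sub>m r"]) auto
  next
    case (Suc k)
    then obtain P where P: "P \<in> carrier_mat r r" "det P \<noteq> 0" "\<forall>i<k. col P i \<in> G" by auto
    obtain g where g: "g \<in> G" "det (replace_col P g k) \<noteq> 0"
      using exists_col_replacement[OF P(1,2) _ G span, of k] Suc.prems by auto
    have "\<forall>i<Suc k. col (replace_col P g k) i \<in> G"
      using P g G Suc.prems by (auto simp: col_replace_col[of _ r] less_Suc_eq)
    then show ?case using P(1) g(2) by (intro bexI[of _ "replace_col P g k"]) auto
  qed
  then show thesis using that by blast
qed

lemma finite_mats_with_cols_in:
  assumes "finite G"
  shows "finite {P \<in> carrier_mat r r. \<forall>i<r. col P i \<in> G}" (is "finite ?M")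
proof (rule finite_subset)
  show "?M \<subseteq> mat_of_cols r ` {xs. set xs \<subseteq> G \<and> length xs = r}"
  proof
    fix P assume P: "P \<in> ?M"
    then have "set (cols P) \<subseteq> G" by (auto simp: cols_def)
    moreover have "P = mat_of_cols r (cols P)" using P by auto
    ultimately show "P \<in> mat_of_cols r ` {xs. set xs \<subseteq> G \<and> length xs = r}" using P by auto
  qed
  show "finite (mat_of_cols r ` {xs. set xs \<subseteq> G \<and> length xs = r})"
    using finite_lists_length_eq[OF assms] by simp
qed

text \<open>
  Among the generators choose \<open>r\<close> vectors whose determinant has maximal degree; by Cramer's rule
  every other generator is an integral combination of them.
\<close>

lemma lattice_basis:
  fixes G :: "'c::field fls vec set"
  assumes "finite G" and G: "G \<subseteq> carrier_vec r"
    and span: "vec_span r UNIV (vec_span r (range fps_to_fls) G) = carrier_vec r"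
  obtains P P' where "inverse_mats r P P'" "vec_span r (range fps_to_fls) G = column_lattice r P"
proof -
  define H where "H = {P \<in> carrier_mat r r. (\<forall>i<r. col P i \<in> G) \<and> det P \<noteq> 0}"
  have "finite H"
    unfolding H_def by (rule finite_subset[OF _ finite_mats_with_cols_in[OF assms(1), of r]]) auto
  moreover have "H \<noteq> {}"
    using det_nonzero_in_spanning_set[OF G span] unfolding H_def by blast
  ultimately obtain P where "is_arg_min (\<lambda>P. fls_subdegree (det P)) (\<lambda>P. P \<in> H) P"
    using ex_is_arg_min_if_finite by blast
  then have "P \<in> H" and min: "\<And>N. N \<in> H \<Longrightarrow> fls_subdegree (det P) \<le> fls_subdegree (det N)"
    by (auto simp: is_arg_min_linorder)
  then have P: "P \<in> carrier_mat r r" "det P \<noteq> 0" "\<And>i. i < r \<Longrightarrow> col P i \<in> G"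
    by (auto simp: H_def)
  obtain P' where inv: "inverse_mats r P P'" using inverse_mats_if_det_nonzero[OF P(1,2)] by blast
  have "g \<in> column_lattice r P" if g: "g \<in> G" for g
  proof -
    have g_carrier: "g \<in> carrier_vec r" using g G by blast
    have "fls_deg_le 0 ((P' *\<^sub>v g) $ k)" if k: "k < r" for k
    proof (cases "(P' *\<^sub>v g) $ k = 0")
      case False
      note det = det_replace_col[OF inv g_carrier k]
      have "replace_col P g k \<in> H"
        using P g False g_carrier k det by (auto simp: H_def col_replace_col[of _ r])
      then show ?thesis using min[of "replace_col P g k"] False P(2) by (simp add: det fls_deg_le_iff)
    qed simp
    then have "fls_vec_le 0 (P' *\<^sub>v g)" using inverse_matsD(2)[OF inv] by (auto simp: fls_vec_le_def)
    then have "P *\<^sub>v (P' *\<^sub>v g) \<in> column_lattice r P"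
      using inverse_matsD(2)[OF inv] g_carrier by (intro column_latticeI) auto
    then show ?thesis using inv g_carrier by simp
  qed
  then have "vec_span r (range fps_to_fls) G = column_lattice r P"
    using P by (intro vec_span_eq_lattice) auto
  then show thesis using inv that by blast
qed

lemma vec_span_cols:
  assumes "P \<in> carrier_mat r r"
  shows "vec_span r (range fps_to_fls) (col P ` {..<r}) = column_lattice r P"
  using assms by (intro vec_span_eq_lattice) (auto simp: col_in_lattice)

lemma vec_span_lattice:
  assumes "inverse_mats r P P'"
  shows "vec_span r UNIV (column_lattice r P) = carrier_vec r"
proof
  note P = inverse_matsD[OF assms]
  show "vec_span r UNIV (column_lattice r P) \<subseteq> carrier_vec r"
    by (rule vec_span_carrier[OF column_lattice_carrier[OF P(1)]])
  show "carrier_vec r \<subseteq> vec_span r UNIV (column_lattice r P)"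
  proof
    fix x :: "'a fls vec" assume x: "x \<in> carrier_vec r"
    then have "P *\<^sub>v (P' *\<^sub>v x) \<in> vec_span r UNIV (column_lattice r P)"
      using P by (intro mult_mat_vec_in_vec_span) (auto simp: col_in_lattice)
    then show "x \<in> vec_span r UNIV (column_lattice r P)" using assms x by simp
  qed
qed


section \<open>Purity of a Frobenius matrix\<close>

definition frob_map :: "nat \<Rightarrow> 'c::field fls mat \<Rightarrow> 'c fls vec \<Rightarrow> 'c fls vec" where
  "frob_map q A x = A *\<^sub>v map_vec (frob_fls q) x"

fun frob_pow :: "nat \<Rightarrow> 'c::field fls mat \<Rightarrow> nat \<Rightarrow> 'c fls mat" where
  "frob_pow q A 0 = 1\<^sub>m (dim_row A)"
| "frob_pow q A (Suc v) = A * map_mat (frob_fls q) (frob_pow q A v)"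

lemma frob_pow_carrier [simp]: "A \<in> carrier_mat r r \<Longrightarrow> frob_pow q A v \<in> carrier_mat r r"
  by (induction v) auto

lemma frob_map_carrier: "A \<in> carrier_mat r r \<Longrightarrow> frob_map q A x \<in> carrier_vec r"
  unfolding frob_map_def by (rule carrier_vecI) simp

lemma frob_map_funpow_carrier:
  "A \<in> carrier_mat r r \<Longrightarrow> x \<in> carrier_vec r \<Longrightarrow> (frob_map q A ^^ v) x \<in> carrier_vec r"
  by (induction v) (auto simp: frob_map_carrier)

text \<open>
  \<open>A\<close> is the matrix of \<open>\<tau>\<close> acting on columns, the transpose of the matrix \<open>Q\<close> of \<open>\<tau> f\<^sub>* = Q f\<^sub>*\<close>.
\<close>

definition pure_frob_map :: "nat \<Rightarrow> nat \<Rightarrow> 'c::field fls mat \<Rightarrow> bool" where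
  "pure_frob_map q r A \<longleftrightarrow>
     (\<exists>W G u v. finite G \<and> G \<subseteq> carrier_vec r \<and> W = vec_span r (range fps_to_fls) G \<and>
        vec_span r UNIV W = carrier_vec r \<and> u > 0 \<and> v > 0 \<and>
        vec_span r (range fps_to_fls) ((frob_map q A ^^ v) ` W) = (\<lambda>x. fls_X_inv ^ u \<cdot>\<^sub>v x) ` W)"

text \<open>
  The columns of \<open>P\<close> form a basis of a lattice \<open>W\<close> with \<open>\<tau>\<^sup>v W = T\<^sup>u W\<close>.
\<close>

definition pure_lattice_basis ::
  "nat \<Rightarrow> nat \<Rightarrow> 'c::field fls mat \<Rightarrow> nat \<Rightarrow> nat \<Rightarrow> 'c fls mat \<Rightarrow> bool" where
  "pure_lattice_basis q r A u v P \<longleftrightarrow> (\<exists>P'. inverse_mats r P P') \<and>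
     (\<exists>U\<in>integral_units r.
        frob_pow q A v * map_mat (frob_fls (q ^ v)) P = fls_X_inv ^ u \<cdot>\<^sub>m (P * U))"

context frobenius_field
begin

lemma fls_vec_le_frob [simp]:
  "fls_vec_le k (map_vec (frob_fls q) (x :: 'c fls vec)) \<longleftrightarrow> fls_vec_le k x"
  by (simp add: fls_vec_le_def)

lemma map_vec_frob_iterate:
  "map_vec (frob_fls q) (map_vec (frob_fls (q ^ v)) (x :: 'c fls vec)) = map_vec (frob_fls (q ^ Suc v)) x"
  by (rule eq_vecI) (auto simp: frob_fls_iterate simp del: power_Suc)

lemma frob_map_funpow:
  assumes A: "A \<in> carrier_mat r r" and x: "(x :: 'c fls vec) \<in> carrier_vec r"
  shows "(frob_map q A ^^ v) x = frob_pow q A v *\<^sub>v map_vec (frob_fls (q ^ v)) x"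
proof (induction v)
  case 0
  have "map_vec (frob_fls 1) x = x"
    by (rule eq_vecI) (auto simp: frob_fls_def fls_nth_inverse)
  then show ?case using A x by simp
next
  case (Suc v)
  let ?s = "map_mat (frob_fls q)" and ?y = "map_vec (frob_fls (q ^ Suc v)) x"
  have "(frob_map q A ^^ Suc v) x =
      A *\<^sub>v map_vec (frob_fls q) (frob_pow q A v *\<^sub>v map_vec (frob_fls (q ^ v)) x)"
    unfolding funpow.simps comp_apply Suc by (rule frob_map_def)
  also have "\<dots> = A *\<^sub>v (?s (frob_pow q A v) *\<^sub>v ?y)"
    using A x by (subst frob_fls_hom.mult_mat_vec_hom[of _ r r])
      (auto simp: map_vec_frob_iterate simp del: power_Suc)
  also have "\<dots> = frob_pow q A (Suc v) *\<^sub>v ?y"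
    using A x by (simp add: assoc_mult_mat_vec[of _ r r _ r] del: power_Suc)
  finally show ?case .
qed

lemma vec_span_frob_map_image:
  assumes A: "A \<in> carrier_mat r r" and P: "(P :: 'c fls mat) \<in> carrier_mat r r"
  shows "vec_span r (range fps_to_fls) ((frob_map q A ^^ v) ` column_lattice r P) =
    column_lattice r (frob_pow q A v * map_mat (frob_fls (q ^ v)) P)"
proof (rule vec_span_eq_lattice)
  interpret v: frobenius_field "TYPE('c)" "q ^ v" by (rule frobenius_field_power)
  let ?s = "map_mat (frob_fls (q ^ v))"
  show carrier: "frob_pow q A v * ?s P \<in> carrier_mat r r"
    using A P by (intro mult_carrier_mat[of _ r r]) auto
  have frob_map_mult: "(frob_map q A ^^ v) (P *\<^sub>v a) =
      (frob_pow q A v * ?s P) *\<^sub>v map_vec (frob_fls (q ^ v)) a" if "a \<in> carrier_vec r" for a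
    using A P that by (simp add: frob_map_funpow[of _ r] v.frob_fls_hom.mult_mat_vec_hom[of _ r r]
        assoc_mult_mat_vec[of _ r r _ r])
  show "(frob_map q A ^^ v) ` column_lattice r P \<subseteq> column_lattice r (frob_pow q A v * ?s P)"
  proof safe
    fix x assume "x \<in> column_lattice r P"
    then obtain a where "x = P *\<^sub>v a" "a \<in> carrier_vec r" "fls_vec_le 0 a"
      by (auto simp: column_lattice_def)
    then show "(frob_map q A ^^ v) x \<in> column_lattice r (frob_pow q A v * ?s P)"
      unfolding \<open>x = P *\<^sub>v a\<close> frob_map_mult[OF \<open>a \<in> carrier_vec r\<close>] by (intro column_latticeI) auto
  qed
  show "col (frob_pow q A v * ?s P) i \<in> (frob_map q A ^^ v) ` column_lattice r P" if i: "i < r" for i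
  proof -
    have "map_vec (frob_fls (q ^ v)) (unit_vec r i) = (unit_vec r i :: 'c fls vec)"
      by (rule eq_vecI) (auto simp: unit_vec_def)
    then have "(frob_map q A ^^ v) (col P i) = col (frob_pow q A v * ?s P) i"
      using frob_map_mult[of "unit_vec r i"] P carrier i by (simp only: unit_vec_carrier mult_mat_unit_vec)
    then show ?thesis using col_in_lattice[OF P i] by (metis imageI)
  qed
qed

lemma pure_lattice_basis_iff:
  fixes A :: "'c fls mat"
  assumes A: "A \<in> carrier_mat r r" and inv: "inverse_mats r P P'"
  shows "pure_lattice_basis q r A u v P \<longleftrightarrow>
    vec_span r (range fps_to_fls) ((frob_map q A ^^ v) ` column_lattice r P) =
      (\<lambda>x. fls_X_inv ^ u \<cdot>\<^sub>v x) ` column_lattice r P"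
proof -
  note P = inverse_matsD(1)[OF inv]
  let ?B = "frob_pow q A v * map_mat (frob_fls (q ^ v)) P"
  have B: "?B \<in> carrier_mat r r" using A P by (intro mult_carrier_mat[of _ r r]) auto
  have "inverse_mats r (fls_X_inv ^ u \<cdot>\<^sub>m P) (inverse (fls_X_inv ^ u) \<cdot>\<^sub>m P')"
    using inv by (rule inverse_mats_smult) (rule right_inverse, simp)
  from column_lattice_eq_iff[OF B this]
  have "column_lattice r ?B = column_lattice r (fls_X_inv ^ u \<cdot>\<^sub>m P) \<longleftrightarrow>
      (\<exists>U\<in>integral_units r. ?B = fls_X_inv ^ u \<cdot>\<^sub>m P * U)" .
  moreover have "fls_X_inv ^ u \<cdot>\<^sub>m P * U = fls_X_inv ^ u \<cdot>\<^sub>m (P * U)" if "U \<in> integral_units r" for U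
    by (rule mult_smult_assoc_mat[OF P integral_units_carrier[OF that]])
  ultimately show ?thesis
    using inv unfolding pure_lattice_basis_def vec_span_frob_map_image[OF A P] column_lattice_smult[OF P]
    by metis
qed

theorem pure_frob_map_iff:
  assumes A: "(A :: 'c fls mat) \<in> carrier_mat r r"
  shows "pure_frob_map q r A \<longleftrightarrow> (\<exists>u>0. \<exists>v>0. \<exists>P. pure_lattice_basis q r A u v P)"
proof
  assume "pure_frob_map q r A"
  then obtain G u v where G: "finite G" "G \<subseteq> carrier_vec r"
      "vec_span r UNIV (vec_span r (range fps_to_fls) G) = carrier_vec r" and uv: "u > 0" "v > 0"
    and shift: "vec_span r (range fps_to_fls) ((frob_map q A ^^ v) ` vec_span r (range fps_to_fls) G) =
      (\<lambda>x. fls_X_inv ^ u \<cdot>\<^sub>v x) ` vec_span r (range fps_to_fls) G"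
    unfolding pure_frob_map_def by blast
  obtain P P' where P: "inverse_mats r P P'" "vec_span r (range fps_to_fls) G = column_lattice r P"
    by (rule lattice_basis[OF G])
  show "\<exists>u>0. \<exists>v>0. \<exists>P. pure_lattice_basis q r A u v P"
    using uv shift unfolding P(2) pure_lattice_basis_iff[OF A P(1), symmetric] by blast
next
  assume "\<exists>u>0. \<exists>v>0. \<exists>P. pure_lattice_basis q r A u v P"
  then obtain u v P where uv: "u > 0" "v > 0" and pure: "pure_lattice_basis q r A u v P" by blast
  then obtain P' where inv: "inverse_mats r P P'" by (auto simp: pure_lattice_basis_def)
  note P = inverse_matsD(1)[OF inv]
  show "pure_frob_map q r A"
    unfolding pure_frob_map_def
  proof (intro exI conjI)
    show "finite (col P ` {..<r})" "col P ` {..<r} \<subseteq> carrier_vec r" using P by auto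
    show "column_lattice r P = vec_span r (range fps_to_fls) (col P ` {..<r})"
      by (rule vec_span_cols[OF P, symmetric])
    show "vec_span r UNIV (column_lattice r P) = carrier_vec r" by (rule vec_span_lattice[OF inv])
    show "vec_span r (range fps_to_fls) ((frob_map q A ^^ v) ` column_lattice r P) =
        (\<lambda>x. fls_X_inv ^ u \<cdot>\<^sub>v x) ` column_lattice r P"
      using pure unfolding pure_lattice_basis_iff[OF A inv] .
  qed fact+
qed

lemma det_frob_pow:
  assumes A: "A \<in> carrier_mat r r" and nz: "det (A :: 'c fls mat) \<noteq> 0"
  shows "det (frob_pow q A v) \<noteq> 0 \<and> fls_subdegree (det (frob_pow q A v)) = int v * fls_subdegree (det A)"
proof (induction v)
  case (Suc v)
  have "det (frob_pow q A (Suc v)) = det A * frob_fls q (det (frob_pow q A v))"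
    using A by (simp add: det_mult[of _ r])
  then show ?case using nz Suc by (simp add: algebra_simps)
qed (use A in simp)

theorem pure_lattice_basis_slope:
  assumes A: "(A :: 'c fls mat) \<in> carrier_mat r r" "det A \<noteq> 0"
    and pure: "pure_lattice_basis q r A u v P"
  shows "int (r * u) = - int v * fls_subdegree (det A)"
proof -
  interpret v: frobenius_field "TYPE('c)" "q ^ v" by (rule frobenius_field_power)
  obtain P' U where inv: "inverse_mats r P P'" and U: "U \<in> integral_units r"
    and purity: "frob_pow q A v * map_mat (frob_fls (q ^ v)) P = fls_X_inv ^ u \<cdot>\<^sub>m (P * U)"
    using pure by (auto simp: pure_lattice_basis_def)
  note P = inverse_matsD(1)[OF inv] and U_carrier = integral_units_carrier[OF U]
  have det_P_nonzero: "det P \<noteq> 0" using det_nonzero_if_inverse_mats[OF inv] by auto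
  have "det (frob_pow q A v) * frob_fls (q ^ v) (det P) = det (frob_pow q A v * map_mat (frob_fls (q ^ v)) P)"
    using A(1) P by (simp add: det_mult[of _ r])
  also have "\<dots> = fls_X_inv ^ (u * r) * (det P * det U)"
    using P U_carrier by (simp add: purity det_mult[of _ r] power_mult)
  finally have "fls_subdegree (det (frob_pow q A v) * frob_fls (q ^ v) (det P)) =
      fls_subdegree (fls_X_inv ^ (u * r) * (det P * det U))" by simp
  then have "int v * fls_subdegree (det A) = - int (u * r)"
    using det_frob_pow[OF A, of v] det_P_nonzero det_integral_unit[OF U]
    by (simp add: fls_subdegree_mult_fls_X_inv_power)
  then show ?thesis by (simp add: mult.commute)
qed

lemma frob_pow_dual:
  assumes A: "(A :: 'c fls mat) \<in> carrier_mat r r" and B: "B \<in> carrier_mat r r"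
    and dual: "B\<^sup>T * A = c \<cdot>\<^sub>m 1\<^sub>m r" and c: "c \<noteq> 0"
  shows "\<exists>d. d \<noteq> 0 \<and> fls_subdegree d = int v * fls_subdegree c \<and>
    (frob_pow q B v)\<^sup>T * frob_pow q A v = d \<cdot>\<^sub>m 1\<^sub>m r"
proof (induction v)
  case 0
  show ?case using A B by (intro exI[of _ 1]) auto
next
  case (Suc v)
  let ?s = "map_mat (frob_fls q) :: 'c fls mat \<Rightarrow> _"
  obtain d where d: "d \<noteq> 0" "fls_subdegree d = int v * fls_subdegree c"
      "(frob_pow q B v)\<^sup>T * frob_pow q A v = d \<cdot>\<^sub>m 1\<^sub>m r"
    using Suc by blast
  have "(frob_pow q B (Suc v))\<^sup>T * frob_pow q A (Suc v) =
      c \<cdot>\<^sub>m ((?s (frob_pow q B v))\<^sup>T * ?s (frob_pow q A v))"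
    unfolding frob_pow.simps using A B dual by (intro transpose_mult_mult_smult_one) auto
  also have "(?s (frob_pow q B v))\<^sup>T * ?s (frob_pow q A v) =
      ?s ((frob_pow q B v)\<^sup>T * frob_pow q A v)"
    using A B by (simp add: frob_fls_hom.mat_hom_mult[of _ r r _ r] map_mat_transpose)
  also have "c \<cdot>\<^sub>m \<dots> = (c * frob_fls q d) \<cdot>\<^sub>m 1\<^sub>m r"
    unfolding d(3) by (simp add: frob_fls_hom.mat_hom_smult frob_fls_hom.mat_hom_one smult_smult_mat)
  finally show ?case
    using c d by (intro exI[of _ "c * frob_fls q d"]) (simp add: algebra_simps)
qed

theorem pure_lattice_basis_dual:
  assumes A: "(A :: 'c fls mat) \<in> carrier_mat r r" and B: "B \<in> carrier_mat r r"
    and dual: "B\<^sup>T * A = c \<cdot>\<^sub>m 1\<^sub>m r" and c: "c \<noteq> 0" "fls_subdegree c = - int m"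
    and pure: "pure_lattice_basis q r A u v P" and inv: "inverse_mats r P P'" and less: "u < m * v"
  shows "pure_lattice_basis q r B (m * v - u) v P'\<^sup>T"
proof -
  interpret v: frobenius_field "TYPE('c)" "q ^ v" by (rule frobenius_field_power)
  let ?s = "map_mat (frob_fls (q ^ v)) :: 'c fls mat \<Rightarrow> _" and ?T = "fls_X_inv :: 'c fls"
  note P = inverse_matsD[OF inv]
  obtain U V where UV: "inverse_mats r U V" "fls_mat_le 0 U" "fls_mat_le 0 V"
    and purity: "frob_pow q A v * ?s P = ?T ^ u \<cdot>\<^sub>m (P * U)"
    using pure by (auto simp: pure_lattice_basis_def integral_units_def)
  note V = inverse_matsD(2)[OF UV(1)]
  obtain d where d: "d \<noteq> 0" "fls_subdegree d = - int (m * v)"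
      "(frob_pow q B v)\<^sup>T * frob_pow q A v = d \<cdot>\<^sub>m 1\<^sub>m r"
    using frob_pow_dual[OF A B dual c(1), of v] c(2) by auto
  obtain w where w: "w \<noteq> 0" "fls_subdegree w = 0" "d * inverse (?T ^ u) = ?T ^ (m * v - u) * w"
    using fls_X_inv_power_factor[OF d(1,2) less] .
  define N where "N = frob_pow q B v * ?s P'\<^sup>T"
  have N: "N \<in> carrier_mat r r" using B P(2) by (simp add: N_def mult_carrier_mat[of _ r r _ r])
  have "N\<^sup>T * (frob_pow q A v * ?s P) = d \<cdot>\<^sub>m ((?s P'\<^sup>T)\<^sup>T * ?s P)"
    unfolding N_def using A B P(1,2) d(3) by (intro transpose_mult_mult_smult_one) auto
  also have "(?s P'\<^sup>T)\<^sup>T * ?s P = ?s (P' * P)"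
    using P(1,2) by (simp add: v.frob_fls_hom.mat_hom_mult[of _ r r _ r] map_mat_transpose)
  finally have N_mult: "N\<^sup>T * (?T ^ u \<cdot>\<^sub>m (P * U)) = d \<cdot>\<^sub>m 1\<^sub>m r"
    unfolding purity by (simp add: P(4) v.frob_fls_hom.mat_hom_one)
  have "inverse_mats r (?T ^ u \<cdot>\<^sub>m (P * U)) (inverse (?T ^ u) \<cdot>\<^sub>m (V * P'))"
    by (intro inverse_mats_smult inverse_mats_mult inv UV(1) right_inverse) simp
  then have "N\<^sup>T = d \<cdot>\<^sub>m (inverse (?T ^ u) \<cdot>\<^sub>m (V * P'))"
    by (rule eq_smult_inverse_mat[OF _ _ N_mult]) (simp add: N)
  from arg_cong[OF this, of transpose_mat]
  have "N = (d * inverse (?T ^ u)) \<cdot>\<^sub>m (P'\<^sup>T * V\<^sup>T)"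
    using V P(2) by (simp add: transpose_smult smult_smult_mat transpose_mult[of _ r r _ r])
  also note w(3)
  also have "(?T ^ (m * v - u) * w) \<cdot>\<^sub>m (P'\<^sup>T * V\<^sup>T) = ?T ^ (m * v - u) \<cdot>\<^sub>m (P'\<^sup>T * (w \<cdot>\<^sub>m V\<^sup>T))"
    using P(2) V by (simp add: mult_smult_distrib[of _ r r _ r] smult_smult_mat)
  finally have "N = ?T ^ (m * v - u) \<cdot>\<^sub>m (P'\<^sup>T * (w \<cdot>\<^sub>m V\<^sup>T))" .
  then show ?thesis
    using inverse_mats_transpose[OF inverse_mats_sym[OF inv]] smult_transpose_integral_unit[OF UV w(1,2)]
    unfolding pure_lattice_basis_def N_def by blast
qed

end


section \<open>Matrices over polynomial rings\<close>

lemma map_mat_to_fract_smult_one: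
  "map_mat to_fract (c \<cdot>\<^sub>m 1\<^sub>m r) = to_fract (c :: 'a::idom) \<cdot>\<^sub>m 1\<^sub>m r"
  by (simp only: to_fract_hom.mat_hom_smult to_fract_hom.mat_hom_one)

lemma mult_eq_smult_one_iff:
  fixes A B :: "'a::idom mat"
  assumes A: "A \<in> carrier_mat r r" and B: "B \<in> carrier_mat r r" and c: "c \<noteq> 0"
  shows "A * B = c \<cdot>\<^sub>m 1\<^sub>m r \<longleftrightarrow>
    (\<exists>R. inverse_mats r (map_mat to_fract A) R \<and> map_mat to_fract B = to_fract c \<cdot>\<^sub>m R)"
    (is "_ \<longleftrightarrow> (\<exists>R. ?P R)")
proof
  let ?h = "map_mat to_fract :: 'a mat \<Rightarrow> 'a fract mat"
  assume mult_eq: "A * B = c \<cdot>\<^sub>m 1\<^sub>m r"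
  define R where "R = inverse (to_fract c) \<cdot>\<^sub>m ?h B"
  have R: "R \<in> carrier_mat r r" "?h A \<in> carrier_mat r r" using A B by (auto simp: R_def)
  have "?h A * R = inverse (to_fract c) \<cdot>\<^sub>m ?h (A * B)"
    unfolding R_def to_fract_hom.mat_hom_mult[OF A B] using A B
    by (simp add: mult_smult_distrib[of _ r r _ r])
  also have "\<dots> = 1\<^sub>m r"
    unfolding mult_eq map_mat_to_fract_smult_one using c by (simp add: smult_smult_mat)
  finally have "inverse_mats r (?h A) R"
    using R mat_mult_left_right_inverse[OF R(2,1)] by (simp add: inverse_mats_def)
  moreover have "?h B = to_fract c \<cdot>\<^sub>m R" using c by (simp add: R_def smult_smult_mat)
  ultimately show "\<exists>R. ?P R" by blast
next
  let ?h = "map_mat to_fract :: 'a mat \<Rightarrow> 'a fract mat"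
  assume "\<exists>R. ?P R"
  then obtain R where R: "inverse_mats r (?h A) R" "?h B = to_fract c \<cdot>\<^sub>m R" by blast
  have "?h (A * B) = to_fract c \<cdot>\<^sub>m (?h A * R)"
    unfolding to_fract_hom.mat_hom_mult[OF A B] R(2)
    by (rule mult_smult_distrib[OF inverse_matsD(1,2)[OF R(1)]])
  then have "?h (A * B) = ?h (c \<cdot>\<^sub>m 1\<^sub>m r)"
    unfolding map_mat_to_fract_smult_one inverse_matsD(3)[OF R(1)] .
  then show "A * B = c \<cdot>\<^sub>m 1\<^sub>m r" by (rule to_fract_hom.mat_hom_inj)
qed

lemma mult_eq_smult_one_commute:
  fixes A B :: "'a::idom mat"
  assumes A: "A \<in> carrier_mat r r" and B: "B \<in> carrier_mat r r" and c: "c \<noteq> 0"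
    and "A * B = c \<cdot>\<^sub>m 1\<^sub>m r"
  shows "B * A = c \<cdot>\<^sub>m 1\<^sub>m r"
proof -
  let ?h = "map_mat to_fract :: 'a mat \<Rightarrow> 'a fract mat"
  obtain R where R: "inverse_mats r (?h A) R" "?h B = to_fract c \<cdot>\<^sub>m R"
    using mult_eq_smult_one_iff[OF A B c] assms(4) by blast
  have "?h (B * A) = to_fract c \<cdot>\<^sub>m (R * ?h A)"
    using R mult_smult_assoc_mat[OF inverse_matsD(2,1)[OF R(1)]]
    by (simp add: to_fract_hom.mat_hom_mult[OF B A])
  also have "\<dots> = ?h (c \<cdot>\<^sub>m 1\<^sub>m r)"
    by (simp only: inverse_matsD(4)[OF R(1)] map_mat_to_fract_smult_one)
  finally show ?thesis by (rule to_fract_hom.mat_hom_inj)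
qed

lemma right_inverse_mat_dim_le:
  fixes A B :: "'a::idom mat"
  assumes A: "A \<in> carrier_mat r s" and B: "B \<in> carrier_mat s r" and AB: "A * B = 1\<^sub>m r"
  shows "r \<le> s"
proof (rule ccontr)
  assume "\<not> r \<le> s"
  then have s: "s < r" by simp
  define A' where "A' = mat r r (\<lambda>(i, j). if j < s then A $$ (i, j) else 0)"
  define B' where "B' = mat r r (\<lambda>(i, j). if i < s then B $$ (i, j) else 0)"
  have A': "A' \<in> carrier_mat r r" and B': "B' \<in> carrier_mat r r" by (auto simp: A'_def B'_def)
  have "A' * B' = A * B"
  proof (rule eq_matI)
    fix i j assume "i < dim_row (A * B)" "j < dim_col (A * B)"
    then have ij: "i < r" "j < r" using A B by auto
    have "(A' * B') $$ (i, j) = (\<Sum>k<r. if k < s then A $$ (i, k) * B $$ (k, j) else 0)"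
      using ij by (auto simp: A'_def B'_def scalar_prod_def atLeast0LessThan intro!: sum.cong)
    also have "\<dots> = (\<Sum>k<s. A $$ (i, k) * B $$ (k, j))"
      using s by (intro sum.mono_neutral_cong_right) auto
    also have "\<dots> = (A * B) $$ (i, j)"
      using ij A B by (simp add: scalar_prod_def atLeast0LessThan)
    finally show "(A' * B') $$ (i, j) = (A * B) $$ (i, j)" .
  qed (use A B A' B' in auto)
  then have "det A' * det B' = 1" using AB det_mult[OF A' B'] by simp
  moreover have "det B' = 0"
    unfolding laplace_expansion_row[OF B' s] using s by (intro sum.neutral) (auto simp: B'_def)
  ultimately show False by simp
qed

text \<open>
  Over \<open>K[T]\<close> let the columns of \<open>G\<close> span the cokernel of \<open>Q\<close> over \<open>K\<close>, with \<open>T\<close> acting on them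
  through \<open>C\<close>. Then \<open>(Q G; 0 1)(Z -Y; D T-C) = (1 0; D T-C)\<close>.
\<close>

lemma det_dvd_char_poly:
  fixes C :: "'a::idom mat"
  assumes Q: "Q \<in> carrier_mat r r" and G: "G \<in> carrier_mat r n" and C: "C \<in> carrier_mat n n"
    and Y: "Y \<in> carrier_mat r n" and D: "D \<in> carrier_mat n r" and Z: "Z \<in> carrier_mat r r"
    and T_action: "G * char_poly_matrix C = Q * Y" and span: "Q * Z + G * D = 1\<^sub>m r"
  shows "det Q dvd char_poly C"
proof -
  let ?C = "char_poly_matrix C"
  let ?X = "four_block_mat Q G (0\<^sub>m n r) (1\<^sub>m n)" and ?Y = "four_block_mat Z (- Y) D ?C"
  have C': "?C \<in> carrier_mat n n" using C by simp
  have X: "?X \<in> carrier_mat (r + n) (r + n)" and Y_carrier: "?Y \<in> carrier_mat (r + n) (r + n)"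
    using Q Z C' by auto
  have "Q * (- Y) + G * ?C = 0\<^sub>m r n"
    unfolding T_action using Q Y by (intro eq_matI) auto
  then have "?X * ?Y = four_block_mat (1\<^sub>m r) (0\<^sub>m r n) D ?C"
    using Q G Y D Z C' span by (subst mult_four_block_mat[of _ r r _ n _ n _ _ r _ n]) auto
  then have "det ?X * det ?Y = det (four_block_mat (1\<^sub>m r) (0\<^sub>m r n) D ?C)"
    using det_mult[OF X Y_carrier] by simp
  moreover have "det ?X = det Q"
    using det_four_block_mat_lower_left_zero[OF Q G refl one_carrier_mat] by simp
  moreover have "det (four_block_mat (1\<^sub>m r) (0\<^sub>m r n) D ?C) = char_poly C"
    using det_four_block_mat_upper_right_zero[OF one_carrier_mat refl D C'] by (simp add: char_poly_def)
  ultimately show ?thesis by (metis dvd_triv_left)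
qed


section \<open>Modules over \<open>\<complex>\<^sub>\<infinity>[T,\<tau>]\<close> and their coordinates\<close>

lemma is_basis_range_iff:
  fixes h :: "'p::zero \<Rightarrow> 's::zero"
  assumes "\<And>c. h c = 0 \<longleftrightarrow> c = 0"
  shows "is_basis act (range h) d b \<longleftrightarrow>
    (\<forall>x. \<exists>c. x = (\<Sum>i<d. act (h (c i)) (b i))) \<and>
    (\<forall>c. (\<Sum>i<d. act (h (c i)) (b i)) = 0 \<longrightarrow> (\<forall>i<d. c i = 0))"
proof -
  have lift: "\<exists>c. \<forall>i<d. s i = h (c i)" if "\<forall>i<d. s i \<in> range h" for s
  proof -
    have "\<forall>i. \<exists>c. i < d \<longrightarrow> s i = h c" using that by auto
    from choice[OF this] show ?thesis by blast
  qed
  have sum_lift: "(\<Sum>i<d. act (s i) (b i)) = (\<Sum>i<d. act (h (c i)) (b i))"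
    if "\<forall>i<d. s i = h (c i)" for s c
    using that by (intro sum.cong) auto
  have "(\<exists>s. (\<forall>i<d. s i \<in> range h) \<and> x = (\<Sum>i<d. act (s i) (b i))) \<longleftrightarrow>
      (\<exists>c. x = (\<Sum>i<d. act (h (c i)) (b i)))" for x
    using lift sum_lift by (metis rangeI)
  moreover have "(\<forall>s. (\<forall>i<d. s i \<in> range h) \<and> (\<Sum>i<d. act (s i) (b i)) = 0 \<longrightarrow> (\<forall>i<d. s i = 0)) \<longleftrightarrow>
      (\<forall>c. (\<Sum>i<d. act (h (c i)) (b i)) = 0 \<longrightarrow> (\<forall>i<d. c i = 0))" (is "?L \<longleftrightarrow> ?R")
  proof
    assume ?L
    show ?R
    proof (intro allI impI)
      fix c i assume "(\<Sum>i<d. act (h (c i)) (b i)) = 0" "i < d"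
      then have "h (c i) = 0" using \<open>?L\<close>[rule_format, of "\<lambda>i. h (c i)" i] by blast
      then show "c i = 0" using assms by simp
    qed
  next
    assume ?R
    show ?L
    proof (intro allI impI, elim conjE)
      fix s i assume s: "\<forall>i<d. s i \<in> range h" "(\<Sum>i<d. act (s i) (b i)) = 0" and i: "i < d"
      obtain c where c: "\<forall>i<d. s i = h (c i)" using lift[OF s(1)] by blast
      then have "c i = 0" using \<open>?R\<close> s(2) i sum_lift[OF c] by simp
      then show "s i = 0" using c i assms by simp
    qed
  qed
  ultimately show ?thesis unfolding is_basis_def by simp
qed

lemma skew_mult_tau_right:
  fixes s :: "'c::field poly poly"
  assumes "q > 0"
  shows "skew_mult q s sk_tau = pCons 0 s"
proof -
  have "(frob_poly q ^^ i) (0 :: 'c poly) = 0" "(frob_poly q ^^ i) (1 :: 'c poly) = 1" for i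
    using assms by (induction i) (auto simp: frob_poly_def map_poly_1)
  then have "skew_mult q s sk_tau = (\<Sum>i\<le>degree s. monom (coeff s i) (Suc i))"
    by (simp add: skew_mult_def sk_tau_def)
  also have "\<dots> = [:0, 1:] * (\<Sum>i\<le>degree s. monom (coeff s i) i)"
    unfolding sum_distrib_left by (simp add: monom_Suc)
  finally show ?thesis by (simp add: poly_as_sum_of_monoms)
qed

lemma skew_module_skew_act:
  fixes scale :: "'c::field poly \<Rightarrow> 'm::ab_group_add \<Rightarrow> 'm"
  assumes "semilinear_endomorphism scale (frob_poly q) t"
  shows "skew_module q (semilinear_endomorphism.skew_act scale t)"
proof -
  interpret semilinear_endomorphism scale "frob_poly q" t by fact
  have "skew_act (skew_mult q p p') x = skew_act p (skew_act p' x)" for p p' x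
  proof -
    have "(t ^^ i) (skew_act p' x) =
        (\<Sum>j\<le>degree p'. scale ((frob_poly q ^^ i) (coeff p' j)) ((t ^^ (i + j)) x))" for i
    proof -
      interpret i: semilinear_endomorphism scale "frob_poly q ^^ i" "t ^^ i"
        by (rule semilinear_endomorphism_funpow)
      show ?thesis
        by (simp add: skew_act_def i.tau_sum i.tau_scale funpow_add)
    qed
    then have "skew_act p (skew_act p' x) = (\<Sum>i\<le>degree p. \<Sum>j\<le>degree p'.
        scale (coeff p i * (frob_poly q ^^ i) (coeff p' j)) ((t ^^ (i + j)) x))"
      by (simp add: skew_act_def[of p] scale_sum_right)
    then show ?thesis by (simp only: skew_mult_def skew_act_sum_left skew_act_monom)
  qed
  moreover have "skew_act 1 x = x" for x
    using skew_act_const[of 1 x] by simp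
  ultimately show ?thesis
    by (simp add: skew_module_def skew_act_add_left skew_act_add_right)
qed

locale skew_ring_module = frobenius_field "TYPE('c)" q
  for q :: nat and act :: "'c::field poly poly \<Rightarrow> 'm::ab_group_add \<Rightarrow> 'm" +
  assumes skew_module: "skew_module q act"
begin

abbreviation tau :: "'m \<Rightarrow> 'm" where "tau \<equiv> act sk_tau"
abbreviation pscale :: "'c poly \<Rightarrow> 'm \<Rightarrow> 'm" where "pscale p \<equiv> act [:p:]"
abbreviation cscale :: "'c \<Rightarrow> 'm \<Rightarrow> 'm" where "cscale a \<equiv> act [:[:a:]:]"

lemma act_add_right: "act s (x + y) = act s x + act s y"
  and act_add_left: "act (s + t) x = act s x + act t x"
  and act_skew_mult: "act (skew_mult q s t) x = act s (act t x)"
  and act_1 [simp]: "act 1 x = x"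
  using skew_module by (auto simp: skew_module_def)

lemma act_0_left [simp]: "act 0 x = 0"
  using act_add_left[of 0 0 x] by simp

lemma tau_pscale: "tau (pscale p x) = pscale (frob_poly q p) (tau x)"
proof -
  have "skew_mult q sk_tau [:p:] = skew_mult q [:frob_poly q p:] sk_tau"
    by (simp add: skew_mult_def sk_tau_def)
  then show ?thesis by (metis act_skew_mult)
qed

sublocale poly: semilinear_endomorphism pscale "frob_poly q" tau
proof
  fix p p' x y
  show "pscale p (x + y) = pscale p x + pscale p y" "tau (x + y) = tau x + tau y"
    by (rule act_add_right)+
  show "pscale (p + p') x = pscale p x + pscale p' x"
    using act_add_left[of "[:p:]" "[:p':]"] by simp
  show "pscale p (pscale p' x) = pscale (p * p') x"
    by (simp add: skew_mult_def monom_0 flip: act_skew_mult)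
  show "pscale 1 x = x" by simp
  show "tau (pscale p x) = pscale (frob_poly q p) (tau x)" by (rule tau_pscale)
qed

sublocale frobenius_space q cscale tau
proof
  fix a b x y
  show "cscale a (x + y) = cscale a x + cscale a y" by (rule act_add_right)
  show "cscale (a + b) x = cscale a x + cscale b x"
    using poly.scale_left_distrib[of "[:a:]" "[:b:]"] by simp
  show "cscale a (cscale b x) = cscale (a * b) x"
    using poly.scale_scale[of "[:a:]" "[:b:]"] by (simp add: mult.commute)
  show "cscale 1 x = x" by simp
  show "tau (x + y) = tau x + tau y" by (rule act_add_right)
  show "tau (cscale a x) = cscale (a ^ q) (tau x)"
    by (simp add: tau_pscale frob_poly_def Polynomial.map_poly_pCons)
qed

lemma act_eq_skew_act: "act s x = poly.skew_act s x"
proof (induction s arbitrary: x)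
  case (pCons p s)
  have "act (pCons p s) x = pscale p x + act (pCons 0 s) x"
    using act_add_left[of "[:p:]" "pCons 0 s" x] by simp
  also have "act (pCons 0 s) x = act s (tau x)"
    by (simp add: act_skew_mult flip: skew_mult_tau_right[OF q_pos])
  finally show ?case by (simp add: pCons.IH poly.skew_act_pCons)
qed simp

lemma act_map_poly_const: "act (map_poly (\<lambda>a. [:a:]) p) x = skew_act p x"
proof -
  have "degree (map_poly (\<lambda>a. [:a:]) p) = degree p"
    by (rule degree_map_poly) simp
  then show ?thesis
    unfolding act_eq_skew_act[of "map_poly _ p"] poly.skew_act_def skew_act_def
    by (simp add: coeff_map_poly)
qed

lemma is_basis_T_iff:
  "is_basis act sk_ring_T r f \<longleftrightarrow>
     (\<forall>x. \<exists>c. x = (\<Sum>i<r. pscale (c i) (f i))) \<and>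
     (\<forall>c. (\<Sum>i<r. pscale (c i) (f i)) = 0 \<longrightarrow> (\<forall>i<r. c i = 0))"
  unfolding sk_ring_T_def by (rule is_basis_range_iff) simp

lemma is_basis_tau_iff:
  "is_basis act sk_ring_tau n g \<longleftrightarrow>
     (\<forall>x. \<exists>c. x = (\<Sum>i<n. skew_act (c i) (g i))) \<and>
     (\<forall>c. (\<Sum>i<n. skew_act (c i) (g i)) = 0 \<longrightarrow> (\<forall>i<n. c i = 0))"
proof -
  have "map_poly (\<lambda>a. [:a:]) c = 0 \<longleftrightarrow> c = 0" for c :: "'c poly"
    by (rule map_poly_eq_0_iff) auto
  from is_basis_range_iff[OF this, of act n g] show ?thesis
    unfolding sk_ring_tau_def act_map_poly_const .
qed

lemma is_basis_tau_if_skew_basis: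
  assumes "skew_basis B"
  obtains g where "is_basis act sk_ring_tau (card B) g"
proof -
  have B: "finite B" "range (skew_comb B) = UNIV" "\<And>c. skew_comb B c = 0 \<Longrightarrow> \<forall>b\<in>B. c b = 0"
    using assms by (auto simp: skew_basis_def)
  obtain g where g: "bij_betw g {..<card B} B"
    using ex_bij_betw_nat_finite[OF B(1)] by (auto simp: atLeast0LessThan)
  have comb: "(\<Sum>i<card B. skew_act (c (g i)) (g i)) = skew_comb B c" for c
    unfolding skew_comb_def by (rule sum.reindex_bij_betw[OF g])
  have "is_basis act sk_ring_tau (card B) g"
    unfolding is_basis_tau_iff
  proof (intro conjI allI impI)
    fix x
    obtain c where "x = skew_comb B c" using B(2) by (metis UNIV_I imageE)
    then show "\<exists>c. x = (\<Sum>i<card B. skew_act (c i) (g i))"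
      using comb[of c] by (intro exI[of _ "\<lambda>i. c (g i)"]) simp
  next
    fix c i assume c: "(\<Sum>i<card B. skew_act (c i) (g i)) = 0" and i: "i < card B"
    define c' where "c' = c \<circ> the_inv_into {..<card B} g"
    have c': "c' (g j) = c j" if "j < card B" for j
      using that the_inv_into_f_f[OF bij_betw_imp_inj_on[OF g]] by (simp add: c'_def)
    then have "skew_comb B c' = 0" using c by (simp flip: comb)
    then have "c' (g i) = 0" using B(3) bij_betwE[OF g] i by blast
    then show "c i = 0" using c' i by simp
  qed
  then show thesis by (rule that)
qed

end

locale motive_basis = skew_ring_module q act
  for q :: nat and act :: "'c::field poly poly \<Rightarrow> 'm::ab_group_add \<Rightarrow> 'm" +
  fixes r :: nat and f :: "nat \<Rightarrow> 'm" and Q :: "'c poly mat"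
  assumes basis: "is_basis act sk_ring_T r f"
    and tau_matrix: "tau_matrix act r f Q"
begin

lemma Q_carrier [simp]: "Q \<in> carrier_mat r r"
  using tau_matrix by (simp add: tau_matrix_def)

lemma dim_Q [simp]: "dim_row Q = r" "dim_col Q = r"
  using Q_carrier by blast+

definition comb :: "'c poly vec \<Rightarrow> 'm" where
  "comb y = (\<Sum>i<r. pscale (y $ i) (f i))"

definition coord :: "'m \<Rightarrow> 'c poly vec" where
  "coord x = (SOME y. y \<in> carrier_vec r \<and> comb y = x)"

lemma coord_carrier [simp]: "coord x \<in> carrier_vec r"
  and comb_coord [simp]: "comb (coord x) = x"
proof -
  obtain c where "x = (\<Sum>i<r. pscale (c i) (f i))" using basis unfolding is_basis_T_iff by blast
  then have "vec r c \<in> carrier_vec r \<and> comb (vec r c) = x" by (simp add: comb_def)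
  then have "coord x \<in> carrier_vec r \<and> comb (coord x) = x" unfolding coord_def by (rule someI)
  then show "coord x \<in> carrier_vec r" "comb (coord x) = x" by auto
qed

lemma dim_coord [simp]: "dim_vec (coord x) = r"
  by (rule carrier_vecD[OF coord_carrier])

lemma coord_comb [simp]:
  assumes "y \<in> carrier_vec r"
  shows "coord (comb y) = y"
proof (rule eq_vecI)
  have "comb (coord (comb y)) = comb y" by (rule comb_coord)
  then have "(\<Sum>i<r. pscale (coord (comb y) $ i - y $ i) (f i)) = 0"
    by (simp add: comb_def poly.scale_left_diff_distrib sum_subtractf)
  from conjunct2[OF basis[unfolded is_basis_T_iff], rule_format, OF this]
  show "coord (comb y) $ i = y $ i" if "i < dim_vec y" for i using that assms by simp
qed (use assms in simp)

lemma coord_eqI: "comb y = x \<Longrightarrow> y \<in> carrier_vec r \<Longrightarrow> coord x = y"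
  using coord_comb by blast

lemma coord_inject: "coord x = coord y \<longleftrightarrow> x = y"
  by (metis comb_coord)

lemma comb_add: "y \<in> carrier_vec r \<Longrightarrow> z \<in> carrier_vec r \<Longrightarrow> comb (y + z) = comb y + comb z"
  by (simp add: comb_def poly.scale_left_distrib sum.distrib)

lemma comb_smult: "y \<in> carrier_vec r \<Longrightarrow> comb (p \<cdot>\<^sub>v y) = pscale p (comb y)"
  by (simp add: comb_def poly.scale_sum_right)

lemma coord_add: "coord (x + y) = coord x + coord y"
  by (rule coord_eqI) (simp_all add: comb_add)

lemma coord_pscale: "coord (pscale p x) = p \<cdot>\<^sub>v coord x"
  by (rule coord_eqI) (simp_all add: comb_smult)

lemma coord_0: "coord 0 = 0\<^sub>v r"
  by (rule coord_eqI) (simp_all add: comb_def)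

lemma coord_sum_index: "i < r \<Longrightarrow> coord (\<Sum>j\<in>J. x j) $ i = (\<Sum>j\<in>J. coord (x j) $ i)"
  by (induction J rule: infinite_finite_induct) (auto simp: coord_0 coord_add)

lemma coord_basis: "j < r \<Longrightarrow> coord (f j) = unit_vec r j"
  by (rule coord_eqI) (simp_all add: comb_def unit_vec_def if_distrib[of "\<lambda>p. pscale p _"] cong: if_cong)

lemma coord_tau: "coord (tau x) = Q\<^sup>T *\<^sub>v map_vec (frob_poly q) (coord x)"
proof (rule coord_eqI)
  let ?y = "coord x"
  have "tau x = (\<Sum>i<r. pscale (frob_poly q (?y $ i)) (tau (f i)))"
    by (subst comb_coord[of x, symmetric]) (simp only: comb_def poly.tau_sum tau_pscale)
  also have "\<dots> = (\<Sum>i<r. \<Sum>j<r. pscale (frob_poly q (?y $ i) * Q $$ (i, j)) (f j))"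
    using tau_matrix by (simp add: tau_matrix_def poly.scale_sum_right)
  also have "\<dots> = (\<Sum>j<r. pscale (\<Sum>i<r. frob_poly q (?y $ i) * Q $$ (i, j)) (f j))"
    by (subst sum.swap) (simp only: poly.scale_sum_left)
  also have "\<dots> = comb (Q\<^sup>T *\<^sub>v map_vec (frob_poly q) ?y)"
    by (simp add: comb_def scalar_prod_def atLeast0LessThan mult.commute)
  finally show "comb (Q\<^sup>T *\<^sub>v map_vec (frob_poly q) ?y) = tau x" ..
qed (simp add: mult_mat_vec_carrier[of _ r r])

definition tau_fls :: "'c fls mat" where
  "tau_fls = map_mat poly_to_fls_inv Q\<^sup>T"

definition fls_coord :: "'m \<Rightarrow> 'c fls vec" where
  "fls_coord x = map_vec poly_to_fls_inv (coord x)"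

lemma tau_fls_carrier [simp]: "tau_fls \<in> carrier_mat r r"
  by (simp add: tau_fls_def)

lemma fls_coord_carrier [simp]: "fls_coord x \<in> carrier_vec r"
  by (simp add: fls_coord_def)

lemma dim_fls_coord [simp]: "dim_vec (fls_coord x) = r"
  by (simp add: fls_coord_def)

lemma fls_coord_add: "fls_coord (x + y) = fls_coord x + fls_coord y"
  by (rule eq_vecI) (auto simp: fls_coord_def coord_add poly_to_fls_inv_hom.hom_add)

lemma fls_coord_pscale: "fls_coord (pscale p x) = poly_to_fls_inv p \<cdot>\<^sub>v fls_coord x"
  by (simp add: fls_coord_def coord_pscale poly_to_fls_inv_hom.vec_hom_smult)

lemma fls_coord_0: "fls_coord 0 = 0\<^sub>v r"
  by (simp add: fls_coord_def coord_0 poly_to_fls_inv_hom.vec_hom_zero)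

lemma fls_coord_basis: "j < r \<Longrightarrow> fls_coord (f j) = unit_vec r j"
  by (rule eq_vecI) (auto simp: fls_coord_def coord_basis unit_vec_def)

lemma fls_coord_tau: "fls_coord (tau x) = frob_map q tau_fls (fls_coord x)"
proof -
  have "map_vec poly_to_fls_inv (map_vec (frob_poly q) (coord x)) = map_vec (frob_fls q) (fls_coord x)"
    by (rule eq_vecI) (auto simp: fls_coord_def poly_to_fls_inv_frob)
  then show ?thesis
    by (simp add: fls_coord_def[of "tau x"] coord_tau frob_map_def tau_fls_def
        poly_to_fls_inv_hom.mult_mat_vec_hom[of _ r r])
qed

lemma fls_coord_tau_funpow: "fls_coord ((tau ^^ v) x) = (frob_map q tau_fls ^^ v) (fls_coord x)"
  by (induction v) (auto simp: fls_coord_tau)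

end


section \<open>The tensor product in coordinates\<close>

definition frag_eval :: "('e \<Rightarrow> 'c::comm_ring_1) \<Rightarrow> ('e \<Rightarrow>\<^sub>0 int) \<Rightarrow> 'c" where
  "frag_eval h z = (\<Sum>e\<in>Poly_Mapping.keys z. of_int (Poly_Mapping.lookup z e) * h e)"

lemma frag_eval_superset:
  assumes "finite S" "Poly_Mapping.keys z \<subseteq> S"
  shows "frag_eval h z = (\<Sum>e\<in>S. of_int (Poly_Mapping.lookup z e) * h e)"
  unfolding frag_eval_def using assms
  by (intro sum.mono_neutral_left) (auto simp: in_keys_iff)

lemma frag_eval_0 [simp]: "frag_eval h 0 = 0"
  by (simp add: frag_eval_def)

lemma frag_eval_of [simp]: "frag_eval h (frag_of e) = h e"
  by (simp add: frag_eval_def)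

lemma frag_eval_diff: "frag_eval h (z - w) = frag_eval h z - frag_eval h w"
proof -
  let ?S = "Poly_Mapping.keys z \<union> Poly_Mapping.keys w"
  have "Poly_Mapping.keys (z - w) \<subseteq> ?S" by (rule keys_diff)
  then show ?thesis
    by (simp add: frag_eval_superset[of ?S] lookup_minus left_diff_distrib sum_subtractf)
qed

lemma frag_eval_add: "frag_eval h (z + w) = frag_eval h z + frag_eval h w"
  using frag_eval_diff[of h "z + w" w] by simp

lemma frag_eval_sum: "frag_eval h (\<Sum>i\<in>I. z i) = (\<Sum>i\<in>I. frag_eval h (z i))"
  by (induction I rule: infinite_finite_induct) (auto simp: frag_eval_add)

context motive_basis
begin

definition tensor_coord :: "('m \<times> 'c fls \<Rightarrow>\<^sub>0 int) \<Rightarrow> 'c fls vec" where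
  "tensor_coord z = vec r (\<lambda>j. frag_eval (\<lambda>(x, k). k * fls_coord x $ j) z)"

lemma tensor_coord_carrier [simp]: "tensor_coord z \<in> carrier_vec r"
  by (simp add: tensor_coord_def)

lemma tensor_coord_0 [simp]: "tensor_coord 0 = 0\<^sub>v r"
  by (rule eq_vecI) (auto simp: tensor_coord_def)

lemma tensor_coord_of: "tensor_coord (frag_of (x, k)) = k \<cdot>\<^sub>v fls_coord x"
  by (rule eq_vecI) (auto simp: tensor_coord_def)

lemma tensor_coord_diff: "tensor_coord (z - w) = tensor_coord z - tensor_coord w"
  by (rule eq_vecI) (auto simp: tensor_coord_def frag_eval_diff)

lemma tensor_coord_add: "tensor_coord (z + w) = tensor_coord z + tensor_coord w"
  by (rule eq_vecI) (auto simp: tensor_coord_def frag_eval_add)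

definition tensor_comb :: "'c fls vec \<Rightarrow> ('m \<times> 'c fls \<Rightarrow>\<^sub>0 int)" where
  "tensor_comb y = (\<Sum>j<r. frag_of (f j, y $ j))"

lemma tensor_coord_comb [simp]: "y \<in> carrier_vec r \<Longrightarrow> tensor_coord (tensor_comb y) = y"
  by (rule eq_vecI)
    (auto simp: tensor_coord_def tensor_comb_def frag_eval_sum fls_coord_basis unit_vec_def
      if_distrib[of "\<lambda>h. _ * h"] cong: if_cong)

lemma tensor_null_gens:
  "frag_of (x + y, k) - frag_of (x, k) - frag_of (y, k) \<in> tensor_null act"
  "frag_of (x, k + l) - frag_of (x, k) - frag_of (x, l) \<in> tensor_null act"
  "frag_of (pscale p x, k) - frag_of (x, poly_to_fls_inv p * k) \<in> tensor_null act"
  unfolding tensor_null_def by (rule group_closure.base, blast)+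

lemma tensor_null_diff:
  "z \<in> tensor_null act \<Longrightarrow> w \<in> tensor_null act \<Longrightarrow> z - w \<in> tensor_null act"
  unfolding tensor_null_def by (rule group_closure.diff)

lemma tensor_null_add:
  "z \<in> tensor_null act \<Longrightarrow> w \<in> tensor_null act \<Longrightarrow> z + w \<in> tensor_null act"
  unfolding tensor_null_def by (rule group_closure_add)

lemma tensor_null_0 [simp]: "0 \<in> tensor_null act"
  unfolding tensor_null_def by simp

lemma tensor_null_sum:
  "(\<And>i. i \<in> I \<Longrightarrow> z i \<in> tensor_null act) \<Longrightarrow> (\<Sum>i\<in>I. z i) \<in> tensor_null act"
  by (induction I rule: infinite_finite_induct) (auto intro: tensor_null_add)

lemma tensor_null_zero_left: "frag_of (0, k) \<in> tensor_null act"
  using tensor_null_diff[OF tensor_null_0 tensor_null_gens(1)[of 0 0 k]] by simp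

lemma tensor_null_zero_right: "frag_of (x, 0) \<in> tensor_null act"
  using tensor_null_diff[OF tensor_null_0 tensor_null_gens(2)[of x 0 0]] by simp

lemma tensor_null_sum_left:
  assumes "finite I"
  shows "frag_of (\<Sum>i\<in>I. x i, k) - (\<Sum>i\<in>I. frag_of (x i, k)) \<in> tensor_null act"
  using assms
proof (induction I)
  case (insert i I)
  have "frag_of (\<Sum>j\<in>insert i I. x j, k) - (\<Sum>j\<in>insert i I. frag_of (x j, k)) =
      (frag_of (x i + (\<Sum>j\<in>I. x j), k) - frag_of (x i, k) - frag_of (\<Sum>j\<in>I. x j, k)) +
      (frag_of (\<Sum>j\<in>I. x j, k) - (\<Sum>j\<in>I. frag_of (x j, k)))"
    using insert by simp
  also have "\<dots> \<in> tensor_null act"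
    by (intro tensor_null_add tensor_null_gens insert.IH)
  finally show ?case .
qed (simp add: tensor_null_zero_left)

lemma tensor_coord_null: "z \<in> tensor_null act \<Longrightarrow> tensor_coord z = 0\<^sub>v r"
  unfolding tensor_null_def
proof (induction rule: group_closure.induct)
  case (base s)
  then show ?case
    by (auto simp: tensor_coord_diff tensor_coord_of fls_coord_add fls_coord_pscale)
      (auto intro!: eq_vecI simp: algebra_simps)
next
  case (diff s t)
  then show ?case by (simp add: tensor_coord_diff)
qed

lemma frag_of_minus_tensor_comb_null:
  "frag_of (x, k) - tensor_comb (k \<cdot>\<^sub>v fls_coord x) \<in> tensor_null act"
proof -
  let ?y = "\<lambda>i. pscale (coord x $ i) (f i)"
  have "x = (\<Sum>i<r. ?y i)" using comb_coord[of x] by (simp add: comb_def del: comb_coord)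
  then have "frag_of (x, k) - tensor_comb (k \<cdot>\<^sub>v fls_coord x) =
      (frag_of (\<Sum>i<r. ?y i, k) - (\<Sum>i<r. frag_of (?y i, k))) +
      (\<Sum>i<r. frag_of (?y i, k) - frag_of (f i, poly_to_fls_inv (coord x $ i) * k))"
    by (simp add: tensor_comb_def fls_coord_def sum_subtractf mult.commute)
  also have "\<dots> \<in> tensor_null act"
    by (intro tensor_null_add tensor_null_sum_left tensor_null_sum tensor_null_gens) auto
  finally show ?thesis .
qed

lemma minus_tensor_comb_null: "z - tensor_comb (tensor_coord z) \<in> tensor_null act"
proof (rule frag_induction[of z UNIV])
  have "(\<Sum>j<r. frag_of (f j, 0)) \<in> tensor_null act"
    by (rule tensor_null_sum) (rule tensor_null_zero_right)
  from tensor_null_diff[OF tensor_null_0 this]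
  show "0 - tensor_comb (tensor_coord 0) \<in> tensor_null act"
    by (simp add: tensor_comb_def)
next
  fix e :: "'m \<times> 'c fls"
  show "frag_of e - tensor_comb (tensor_coord (frag_of e)) \<in> tensor_null act"
    by (cases e) (simp only: tensor_coord_of frag_of_minus_tensor_comb_null)
next
  fix a b
  assume ab: "a - tensor_comb (tensor_coord a) \<in> tensor_null act"
    "b - tensor_comb (tensor_coord b) \<in> tensor_null act"
  define y z where "y = tensor_coord a" and "z = tensor_coord b"
  have carrier: "y \<in> carrier_vec r" "z \<in> carrier_vec r" by (auto simp: y_def z_def)
  have "a - b - tensor_comb (y - z) = (a - tensor_comb y) - (b - tensor_comb z) +
      (\<Sum>j<r. frag_of (f j, (y $ j - z $ j) + z $ j) - frag_of (f j, y $ j - z $ j) - frag_of (f j, z $ j))"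
    using carrier by (simp add: tensor_comb_def sum_subtractf)
  also have "\<dots> \<in> tensor_null act"
    using tensor_null_diff[OF ab]
    by (intro tensor_null_add tensor_null_sum tensor_null_gens) (simp add: y_def z_def)
  finally show "a - b - tensor_comb (tensor_coord (a - b)) \<in> tensor_null act"
    by (simp add: tensor_coord_diff y_def z_def)
qed auto

lemma tensor_null_iff: "z \<in> tensor_null act \<longleftrightarrow> tensor_coord z = 0\<^sub>v r"
proof
  assume "tensor_coord z = 0\<^sub>v r"
  moreover have "tensor_comb (0\<^sub>v r) \<in> tensor_null act"
    using tensor_null_diff[OF tensor_null_0 minus_tensor_comb_null[of 0]] by simp
  ultimately show "z \<in> tensor_null act"
    using tensor_null_add[OF minus_tensor_comb_null[of z]] by fastforce
qed (rule tensor_coord_null)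

definition tensor_point :: "'c fls vec \<Rightarrow> ('m \<times> 'c fls \<Rightarrow>\<^sub>0 int) set" where
  "tensor_point y = {w. tensor_coord w = y}"

lemma tensor_class_eq: "tensor_class act z = tensor_point (tensor_coord z)"
proof -
  have "y - z = 0\<^sub>v r \<longleftrightarrow> y = z" if "y \<in> carrier_vec r" "z \<in> carrier_vec r" for y z :: "'c fls vec"
    using that by (auto simp: vec_eq_iff)
  then show ?thesis
    by (auto simp: tensor_class_def tensor_point_def tensor_null_iff tensor_coord_diff)
qed

lemma tensor_comb_in_point: "y \<in> carrier_vec r \<Longrightarrow> tensor_comb y \<in> tensor_point y"
  by (simp add: tensor_point_def)

lemma tensor_space_eq: "tensor_space act = tensor_point ` carrier_vec r"
proof (intro equalityI subsetI)
  fix A assume "A \<in> tensor_point ` carrier_vec r"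
  then obtain y where "A = tensor_point y" "y \<in> carrier_vec r" by blast
  then have "A = tensor_class act (tensor_comb y)" by (simp add: tensor_class_eq)
  then show "A \<in> tensor_space act" by (simp add: tensor_space_def)
qed (auto simp: tensor_space_def tensor_class_eq)

lemma inj_on_tensor_point: "inj_on tensor_point (carrier_vec r)"
proof (rule inj_onI)
  fix y z assume yz: "y \<in> carrier_vec r" "z \<in> carrier_vec r" "tensor_point y = tensor_point z"
  then have "tensor_comb y \<in> tensor_point z" using tensor_comb_in_point by blast
  then show "y = z" using yz(1) by (simp add: tensor_point_def)
qed

lemma tensor_add_point:
  assumes "y \<in> carrier_vec r" "z \<in> carrier_vec r"
  shows "tensor_add (tensor_point y) (tensor_point z) = tensor_point (y + z)"
proof (intro equalityI subsetI)
  fix w assume w: "w \<in> tensor_point (y + z)"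
  have "tensor_coord (w - tensor_comb y) = z"
    using w assms by (auto simp: tensor_coord_diff tensor_point_def vec_eq_iff)
  then have "w - tensor_comb y \<in> tensor_point z" by (simp add: tensor_point_def)
  moreover have "w = tensor_comb y + (w - tensor_comb y)" by simp
  ultimately show "w \<in> tensor_add (tensor_point y) (tensor_point z)"
    using tensor_comb_in_point[OF assms(1)] unfolding tensor_add_def by blast
qed (auto simp: tensor_add_def tensor_point_def tensor_coord_add)

lemma tensor_map_point:
  assumes y: "y \<in> carrier_vec r"
    and g_0: "g (0\<^sub>v r) = 0\<^sub>v r"
    and g_diff: "\<And>y z. y \<in> carrier_vec r \<Longrightarrow> z \<in> carrier_vec r \<Longrightarrow> g (y - z) = g y - g z"
    and g_of: "\<And>e. tensor_coord (frag_of (h e)) = g (tensor_coord (frag_of e))"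
  shows "tensor_map act h (tensor_point y) = tensor_point (g y)"
proof -
  have "tensor_coord (frag_extend (\<lambda>e. frag_of (h e)) z) = g (tensor_coord z)" for z
    by (rule frag_induction[of z UNIV])
      (auto simp: g_0 g_of g_diff frag_extend_diff tensor_coord_diff)
  then show ?thesis
    using tensor_comb_in_point[OF y]
    unfolding tensor_map_def tensor_class_eq by (auto simp: tensor_point_def)
qed

lemma tensor_scale_point:
  "y \<in> carrier_vec r \<Longrightarrow> tensor_scale act c (tensor_point y) = tensor_point (c \<cdot>\<^sub>v y)"
  unfolding tensor_scale_def
proof (rule tensor_map_point)
  fix e :: "'m \<times> 'c fls"
  show "tensor_coord (frag_of (case e of (x, k) \<Rightarrow> (x, c * k))) = c \<cdot>\<^sub>v tensor_coord (frag_of e)"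
    by (cases e) (simp add: tensor_coord_of smult_smult_assoc)
qed (auto intro!: eq_vecI simp: algebra_simps)

lemma tensor_tau_point:
  "y \<in> carrier_vec r \<Longrightarrow> tensor_tau q act (tensor_point y) = tensor_point (frob_map q tau_fls y)"
  unfolding tensor_tau_def
proof (rule tensor_map_point)
  show "frob_map q tau_fls (0\<^sub>v r) = 0\<^sub>v r"
    by (simp add: frob_map_def frob_fls_hom.vec_hom_zero mult_mat_zero_vec)
  show "frob_map q tau_fls (y - z) = frob_map q tau_fls y - frob_map q tau_fls z"
    if "y \<in> carrier_vec r" "z \<in> carrier_vec r" for y z
  proof -
    have "map_vec (frob_fls q) (y - z) = map_vec (frob_fls q) y - map_vec (frob_fls q) z"
      using that by (intro eq_vecI) (auto simp: frob_fls_hom.hom_minus)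
    then show ?thesis
      using that by (simp add: frob_map_def mult_minus_distrib_mat_vec[of _ r r])
  qed
  fix e :: "'m \<times> 'c fls"
  have "frob_map q tau_fls (k \<cdot>\<^sub>v y) = frob_fls q k \<cdot>\<^sub>v frob_map q tau_fls y" if "y \<in> carrier_vec r" for k y
    using that by (simp add: frob_map_def frob_fls_hom.vec_hom_smult mult_mat_vec[of _ r r])
  then show "tensor_coord (frag_of (case e of (x, k) \<Rightarrow> (tau x, frob_fls q k))) =
      frob_map q tau_fls (tensor_coord (frag_of e))"
    by (cases e) (simp add: tensor_coord_of fls_coord_tau)
qed

lemma tensor_tau_funpow_point:
  "y \<in> carrier_vec r \<Longrightarrow>
    (tensor_tau q act ^^ v) (tensor_point y) = tensor_point ((frob_map q tau_fls ^^ v) y)"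
  by (induction v) (auto simp: tensor_tau_point frob_map_funpow_carrier)

lemma tensor_span_point:
  assumes G: "G \<subseteq> carrier_vec r"
  shows "tensor_span act S (tensor_point ` G) = tensor_point ` vec_span r S G"
proof (intro equalityI subsetI)
  fix A assume "A \<in> tensor_span act S (tensor_point ` G)"
  then show "A \<in> tensor_point ` vec_span r S G"
  proof induction
    case zero
    show ?case by (auto simp: tensor_class_eq intro: vec_span.zero)
  next
    case (add c A B)
    then obtain y z where yz: "A = tensor_point y" "y \<in> G" "B = tensor_point z" "z \<in> vec_span r S G"
      by blast
    then have "y \<in> carrier_vec r" "z \<in> carrier_vec r" using G vec_span_carrier[OF G] by auto
    then have "tensor_add (tensor_scale act c A) B = tensor_point (c \<cdot>\<^sub>v y + z)"
      by (simp add: yz tensor_scale_point tensor_add_point)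
    then show ?case using yz add by (auto intro: vec_span.add)
  qed
next
  fix A assume "A \<in> tensor_point ` vec_span r S G"
  then obtain z where A: "A = tensor_point z" and "z \<in> vec_span r S G" by blast
  from this(2) show "A \<in> tensor_span act S (tensor_point ` G)"
    unfolding A
  proof induction
    case zero
    show ?case using tensor_span.zero[of act S "tensor_point ` G"] by (simp add: tensor_class_eq)
  next
    case (add c y z)
    have "y \<in> carrier_vec r" "z \<in> carrier_vec r" using add G vec_span_carrier[OF G] by auto
    then have "tensor_add (tensor_scale act c (tensor_point y)) (tensor_point z) = tensor_point (c \<cdot>\<^sub>v y + z)"
      by (simp add: tensor_scale_point tensor_add_point)
    then show ?case using tensor_span.add[OF add(1) imageI[OF add(2)] add.IH] by simp
  qed
qed

lemma tensor_tau_span_eq_scale_iff: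
  assumes W: "W \<subseteq> carrier_vec r"
  shows "tensor_span act S ((tensor_tau q act ^^ v) ` tensor_point ` W) =
      tensor_scale act c ` tensor_point ` W \<longleftrightarrow>
    vec_span r S ((frob_map q tau_fls ^^ v) ` W) = (\<lambda>y. c \<cdot>\<^sub>v y) ` W"
proof -
  have tau: "(tensor_tau q act ^^ v) ` tensor_point ` W = tensor_point ` (frob_map q tau_fls ^^ v) ` W"
    unfolding image_image using W by (intro image_cong) (auto simp: tensor_tau_funpow_point)
  have scale: "tensor_scale act c ` tensor_point ` W = tensor_point ` (\<lambda>y. c \<cdot>\<^sub>v y) ` W"
    unfolding image_image using W by (intro image_cong) (auto simp: tensor_scale_point)
  have carrier: "(frob_map q tau_fls ^^ v) ` W \<subseteq> carrier_vec r" "(\<lambda>y. c \<cdot>\<^sub>v y) ` W \<subseteq> carrier_vec r"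
    using W frob_map_funpow_carrier[OF tau_fls_carrier] by auto
  show ?thesis
    unfolding tau scale tensor_span_point[OF carrier(1)]
    by (rule inj_on_image_eq_iff[OF inj_on_tensor_point vec_span_carrier[OF carrier(1)] carrier(2)])
qed

lemma tensor_span_eq_space_iff:
  assumes W: "W \<subseteq> carrier_vec r"
  shows "tensor_span act S (tensor_point ` W) = tensor_space act \<longleftrightarrow> vec_span r S W = carrier_vec r"
  unfolding tensor_span_point[OF W] tensor_space_eq
  by (rule inj_on_image_eq_iff[OF inj_on_tensor_point vec_span_carrier[OF W] order_refl])

theorem pure_motive_iff: "pure_motive q act \<longleftrightarrow> pure_frob_map q r tau_fls"
proof -
  let ?O = "range fps_to_fls :: 'c fls set"
  define P where "P W \<longleftrightarrow> tensor_span act UNIV W = tensor_space act \<and>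
    (\<exists>u>0. \<exists>v>0. tensor_span act ?O ((tensor_tau q act ^^ v) ` W) = tensor_scale act (fls_X_inv ^ u) ` W)"
    for W
  define R where "R W \<longleftrightarrow> vec_span r UNIV W = carrier_vec r \<and>
    (\<exists>u>0. \<exists>v>0. vec_span r ?O ((frob_map q tau_fls ^^ v) ` W) = (\<lambda>y. fls_X_inv ^ u \<cdot>\<^sub>v y) ` W)"
    for W
  have P_iff_R: "P (tensor_span act ?O (tensor_point ` G)) \<longleftrightarrow> R (vec_span r ?O G)"
    if "G \<subseteq> carrier_vec r" for G
    using vec_span_carrier[OF that, of ?O]
    by (simp only: P_def R_def tensor_span_point[OF that] tensor_span_eq_space_iff
        tensor_tau_span_eq_scale_iff)
  have "pure_motive q act \<longleftrightarrow> (\<exists>G'. finite G' \<and> G' \<subseteq> tensor_point ` carrier_vec r \<and> P (tensor_span act ?O G'))"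
    unfolding pure_motive_def P_def tensor_space_eq by iprover
  also have "\<dots> \<longleftrightarrow> (\<exists>G. finite G \<and> G \<subseteq> carrier_vec r \<and> P (tensor_span act ?O (tensor_point ` G)))"
    by (rule ex_finite_subset_image)
  also have "\<dots> \<longleftrightarrow> (\<exists>G. finite G \<and> G \<subseteq> carrier_vec r \<and> R (vec_span r ?O G))"
    using P_iff_R by blast
  also have "\<dots> \<longleftrightarrow> pure_frob_map q r tau_fls"
    unfolding pure_frob_map_def R_def by iprover
  finally show ?thesis .
qed

end


section \<open>The filtration of a pure motive\<close>

context motive_basis
begin

definition lattice_filtration :: "'c fls mat \<Rightarrow> int \<Rightarrow> 'm set" where
  "lattice_filtration P' k = {x. fls_vec_le k (P' *\<^sub>v fls_coord x)}"

lemma lattice_filtration_subspace: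
  assumes P': "P' \<in> carrier_mat r r"
  shows "subspace (lattice_filtration P' k)"
proof (rule subspaceI)
  show "0 \<in> lattice_filtration P' k"
    using P' by (simp add: lattice_filtration_def fls_coord_0 mult_mat_zero_vec)
  fix x y assume "x \<in> lattice_filtration P' k" "y \<in> lattice_filtration P' k"
  then show "x + y \<in> lattice_filtration P' k"
    using P' by (simp add: lattice_filtration_def fls_coord_add mult_add_distrib_mat_vec[of _ r r] fls_vec_le_add)
next
  fix a x assume "x \<in> lattice_filtration P' k"
  then show "cscale a x \<in> lattice_filtration P' k"
    using P' fls_vec_le_smult[of 0 "fls_const a" k "P' *\<^sub>v fls_coord x"]
    by (simp add: lattice_filtration_def fls_coord_pscale poly_to_fls_inv_const mult_mat_vec[of _ r r])
qed

lemma lattice_filtration_eq_0: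
  assumes inv: "inverse_mats r P P'" and P_le: "fls_mat_le d P" and "d + k < 0"
  shows "lattice_filtration P' k = {0}"
proof
  have "x = 0" if "x \<in> lattice_filtration P' k" for x
  proof -
    have "fls_vec_le k (P' *\<^sub>v fls_coord x)" using that by (simp add: lattice_filtration_def)
    then have "fls_vec_le (d + k) (P *\<^sub>v (P' *\<^sub>v fls_coord x))"
      using inverse_matsD(1,2)[OF inv] by (intro fls_vec_le_mult_mat_vec[OF P_le]) auto
    then have "fls_vec_le (d + k) (fls_coord x)" using inv by simp
    then have "coord x = 0\<^sub>v r"
      using fls_deg_le_poly_to_fls_inv_neg[OF _ \<open>d + k < 0\<close>]
      by (intro eq_vecI) (auto simp: fls_vec_le_def fls_coord_def)
    then show "x = 0" using coord_inject[of x 0] by (simp add: coord_0)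
  qed
  then show "lattice_filtration P' k \<subseteq> {0}" by blast
qed (simp add: subspace_0[OF lattice_filtration_subspace[OF inverse_matsD(2)[OF inv]]])

lemma lattice_filtration_tau_funpow:
  assumes pure: "pure_lattice_basis q r tau_fls u v P" and inv: "inverse_mats r P P'"
  shows "(tau ^^ v) x \<in> lattice_filtration P' (k + int u) \<longleftrightarrow> x \<in> lattice_filtration P' k"
proof -
  interpret v: frobenius_field "TYPE('c)" "q ^ v" by (rule frobenius_field_power)
  let ?s = "map_mat (frob_fls (q ^ v)) :: 'c fls mat \<Rightarrow> _" and ?T = "fls_X_inv ^ u :: 'c fls"
  note P = inverse_matsD[OF inv]
  obtain U where U: "U \<in> integral_units r"
    and purity: "frob_pow q tau_fls v * ?s P = ?T \<cdot>\<^sub>m (P * U)"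
    using pure by (auto simp: pure_lattice_basis_def)
  note U_carrier = integral_units_carrier[OF U]
  define y where "y = P' *\<^sub>v fls_coord x"
  define z where "z = map_vec (frob_fls (q ^ v)) y"
  have y: "y \<in> carrier_vec r" and z: "z \<in> carrier_vec r"
    using P(2) by (auto simp: y_def z_def)
  have "fls_coord x = P *\<^sub>v y" using inv by (simp add: y_def)
  then have "fls_coord ((tau ^^ v) x) = frob_pow q tau_fls v *\<^sub>v (?s P *\<^sub>v z)"
    using P(1) y by (simp add: fls_coord_tau_funpow frob_map_funpow[of _ r] z_def
        v.frob_fls_hom.mult_mat_vec_hom[of _ r r])
  also have "\<dots> = (?T \<cdot>\<^sub>m (P * U)) *\<^sub>v z"
    using P(1) z by (simp add: assoc_mult_mat_vec[of _ r r _ r] flip: purity)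
  also have "\<dots> = ?T \<cdot>\<^sub>v (P *\<^sub>v (U *\<^sub>v z))"
    using P(1) U_carrier z
    by (simp add: smult_mult_mat_vec[of _ r r] mult_carrier_mat[of _ r r _ r] assoc_mult_mat_vec[of _ r r _ r])
  finally have "P' *\<^sub>v fls_coord ((tau ^^ v) x) = ?T \<cdot>\<^sub>v (U *\<^sub>v z)"
    using P(1,2) U_carrier z inverse_mats_mult_vec[OF inverse_mats_sym[OF inv], of "U *\<^sub>v z"]
    by (simp add: mult_mat_vec[of _ r r] mult_mat_vec_carrier[of _ r r])
  then have "(tau ^^ v) x \<in> lattice_filtration P' (k + int u) \<longleftrightarrow> fls_vec_le k z"
    by (simp add: lattice_filtration_def fls_vec_le_X_inv_power_smult fls_vec_le_integral_unit[OF U z])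
  also have "\<dots> \<longleftrightarrow> x \<in> lattice_filtration P' k"
    by (simp add: z_def y_def lattice_filtration_def)
  finally show ?thesis .
qed

lemma tau_basis_exists:
  assumes pure: "pure_lattice_basis q r tau_fls u v P" and uv: "u > 0" "v > 0"
    and coker: "generates_coker S"
  shows "\<exists>n g. is_basis act sk_ring_tau n g"
proof -
  obtain P' where inv: "inverse_mats r P P'" using pure by (auto simp: pure_lattice_basis_def)
  obtain d :: nat where d: "fls_mat_le (int d) P" using fls_mat_le_ex by blast
  interpret power_filtered_frobenius_space q cscale tau "lattice_filtration P'" u v "Suc d"
  proof
    show "lattice_filtration P' k \<subseteq> lattice_filtration P' l" if "k \<le> l" for k l
      using that by (auto simp: lattice_filtration_def intro: fls_vec_le_mono)
    show "\<exists>k. x \<in> lattice_filtration P' k" for x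
      using fls_vec_le_ex[of "P' *\<^sub>v fls_coord x"] by (auto simp: lattice_filtration_def)
    show "lattice_filtration P' (- int (Suc d)) = {0}"
      by (rule lattice_filtration_eq_0[OF inv d]) simp
  qed (use uv in \<open>simp_all add: lattice_filtration_tau_funpow[OF pure inv]
      lattice_filtration_subspace inverse_matsD(2)[OF inv]\<close>)
  interpret filtered_frobenius_space q cscale tau "\<lambda>k. average (int k - int (v * Suc d))" u
    by (rule filtered_frobenius_space_average)
  obtain B where "skew_basis B" by (rule skew_basis_exists[OF coker])
  then show ?thesis using is_basis_tau_if_skew_basis by blast
qed

end


section \<open>The cokernel of \<open>\<tau>\<close>, the rank and the determinant\<close>

context motive_basis
begin

definition coord_mat :: "nat \<Rightarrow> (nat \<Rightarrow> 'm) \<Rightarrow> 'c poly mat" where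
  "coord_mat k x = mat r k (\<lambda>(i, j). coord (x j) $ i)"

lemma coord_mat_carrier [simp]: "coord_mat k x \<in> carrier_mat r k"
  by (simp add: coord_mat_def)

lemma coord_mat_cong: "(\<And>j. j < k \<Longrightarrow> x j = y j) \<Longrightarrow> coord_mat k x = coord_mat k y"
  by (rule eq_matI) (auto simp: coord_mat_def)

lemma coord_mat_basis: "coord_mat r f = 1\<^sub>m r"
  by (rule eq_matI) (auto simp: coord_mat_def coord_basis)

lemma coord_mat_add: "coord_mat k x + coord_mat k y = coord_mat k (\<lambda>j. x j + y j)"
  by (rule eq_matI) (auto simp: coord_mat_def coord_add)

lemma coord_mat_pscale: "coord_mat k (\<lambda>j. pscale p (x j)) = p \<cdot>\<^sub>m coord_mat k x"
  by (rule eq_matI) (auto simp: coord_mat_def coord_pscale)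

lemma coord_mat_tau: "coord_mat k (\<lambda>j. tau (x j)) = Q\<^sup>T * map_mat (frob_poly q) (coord_mat k x)"
proof -
  have "col (map_mat (frob_poly q) (coord_mat k x)) j = map_vec (frob_poly q) (coord (x j))" if "j < k" for j
    using that by (intro eq_vecI) (auto simp: coord_mat_def)
  then show ?thesis by (intro eq_matI) (auto simp: coord_mat_def coord_tau)
qed

lemma coord_mat_mult:
  assumes "A \<in> carrier_mat k l"
  shows "coord_mat k x * A = coord_mat l (\<lambda>j. \<Sum>i<k. pscale (A $$ (i, j)) (x i))"
  using assms
  by (intro eq_matI)
    (auto simp: coord_mat_def coord_sum_index coord_pscale scalar_prod_def atLeast0LessThan mult.commute)

lemma kills_coker_iff:
  "kills_coker \<theta> m act \<longleftrightarrow> (\<exists>R\<in>carrier_mat r r. Q\<^sup>T * R = [:- \<theta>, 1:] ^ m \<cdot>\<^sub>m 1\<^sub>m r)"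
proof
  let ?p = "[:- \<theta>, 1:] ^ m"
  assume "kills_coker \<theta> m act"
  then have "pscale ?p (f j) \<in> range tau" for j unfolding kills_coker_def by blast
  then have "\<forall>j. \<exists>x. pscale ?p (f j) = tau x" by (simp add: image_iff)
  from choice[OF this] obtain x where x: "\<And>j. pscale ?p (f j) = tau (x j)" by blast
  have "Q\<^sup>T * map_mat (frob_poly q) (coord_mat r x) = ?p \<cdot>\<^sub>m 1\<^sub>m r"
    unfolding coord_mat_tau[symmetric] x[symmetric] coord_mat_pscale coord_mat_basis ..
  then show "\<exists>R\<in>carrier_mat r r. Q\<^sup>T * R = ?p \<cdot>\<^sub>m 1\<^sub>m r"
    by (intro bexI[of _ "map_mat (frob_poly q) (coord_mat r x)"]) auto
next
  let ?p = "[:- \<theta>, 1:] ^ m"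
  assume "\<exists>R\<in>carrier_mat r r. Q\<^sup>T * R = ?p \<cdot>\<^sub>m 1\<^sub>m r"
  then obtain R where R: "R \<in> carrier_mat r r" "Q\<^sup>T * R = ?p \<cdot>\<^sub>m 1\<^sub>m r" by blast
  have "\<exists>y. pscale ?p x = tau y" for x
  proof -
    have "\<forall>i. \<exists>b. frob_poly q b = (R *\<^sub>v coord x) $ i" by (intro allI frob_poly_surj)
    from choice[OF this] obtain b where "\<And>i. frob_poly q (b i) = (R *\<^sub>v coord x) $ i" by blast
    then have "map_vec (frob_poly q) (vec r b) = R *\<^sub>v coord x" using R(1) by (intro eq_vecI) auto
    then have "coord (tau (comb (vec r b))) = Q\<^sup>T * R *\<^sub>v coord x"
      using R(1) by (simp add: coord_tau assoc_mult_mat_vec[of _ r r _ r])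
    also have "\<dots> = coord (pscale ?p x)"
      unfolding R(2) by (simp add: coord_pscale smult_mult_mat_vec[of _ r r])
    finally show ?thesis unfolding coord_inject by metis
  qed
  then show "kills_coker \<theta> m act" unfolding kills_coker_def by blast
qed

lemma generates_coker_if_kills_coker:
  assumes "kills_coker \<theta> m act"
  shows "\<exists>S. generates_coker S"
proof -
  let ?p = "[:- \<theta>, 1:] ^ m"
  define S where "S = (\<lambda>(i, j). pscale (monom 1 i) (f j)) ` ({..<m} \<times> {..<r})"
  let ?V = "span (S \<union> range tau)"
  have low: "pscale s (f j) \<in> ?V" if j: "j < r" and s: "s = 0 \<or> degree s < m" for s j
  proof (cases "s = 0")
    case False
    have "s = (\<Sum>i\<le>degree s. [:coeff s i:] * monom 1 i)"
      using poly_as_sum_of_monoms[of s] by (simp add: smult_monom)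
    then have "pscale s (f j) = pscale (\<Sum>i\<le>degree s. [:coeff s i:] * monom 1 i) (f j)" by simp
    also have "\<dots> = (\<Sum>i\<le>degree s. cscale (coeff s i) (pscale (monom 1 i) (f j)))"
      by (simp only: poly.scale_sum_left poly.scale_scale)
    also have "\<dots> \<in> ?V"
    proof (intro span_sum span_scale span_base UnI1)
      show "pscale (monom 1 i) (f j) \<in> S" if "i \<in> {..degree s}" for i
        unfolding S_def using that j s False by (intro image_eqI[of _ _ "(i, j)"]) auto
    qed
    finally show ?thesis .
  qed (simp add: span_zero)
  have "pscale p (f j) \<in> ?V" if j: "j < r" for p j
  proof -
    have "pscale p (f j) = pscale ?p (pscale (p div ?p) (f j)) + pscale (p mod ?p) (f j)"
      by (simp flip: poly.scale_left_distrib)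
    also have "\<dots> \<in> ?V"
    proof (rule span_add)
      show "pscale ?p (pscale (p div ?p) (f j)) \<in> ?V"
        using assms unfolding kills_coker_def by (intro span_base) blast
      show "pscale (p mod ?p) (f j) \<in> ?V"
        using degree_mod_less[of ?p p] unfolding degree_linear_power by (intro low[OF j]) simp
    qed
    finally show ?thesis .
  qed
  then have "comb (coord x) \<in> ?V" for x unfolding comb_def by (intro span_sum) simp
  then have "generates_coker S" by (auto simp: generates_coker_def S_def)
  then show ?thesis ..
qed

end

context skew_ring_module
begin

lemma motive_basis_exists:
  assumes f: "is_basis act sk_ring_T r f"
  shows "\<exists>Q. motive_basis q act r f Q"
proof -
  have "\<forall>i. \<exists>c. tau (f i) = (\<Sum>j<r. pscale (c j) (f j))"
    using f unfolding is_basis_T_iff by blast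
  from choice[OF this] obtain c where "\<And>i. tau (f i) = (\<Sum>j<r. pscale (c i j) (f j))" by blast
  then have "tau_matrix act r f (mat r r (\<lambda>(i, j). c i j))" by (simp add: tau_matrix_def)
  with f show ?thesis
    by (intro exI[of _ "mat r r (\<lambda>(i, j). c i j)"]) unfold_locales
qed

lemma basis_T_card_le:
  assumes f: "is_basis act sk_ring_T r f" and g: "is_basis act sk_ring_T s g"
  shows "r \<le> s"
proof -
  obtain Q where "motive_basis q act r f Q" using motive_basis_exists[OF f] by blast
  then interpret f: motive_basis q act r f Q .
  obtain Q' where "motive_basis q act s g Q'" using motive_basis_exists[OF g] by blast
  then interpret g: motive_basis q act s g Q' .
  have "(\<Sum>i<s. pscale (g.coord_mat r f $$ (i, j)) (g i)) = f j" if "j < r" for j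
    using g.comb_coord[of "f j"] that by (simp add: g.comb_def g.coord_mat_def del: g.comb_coord)
  then have "f.coord_mat s g * g.coord_mat r f = f.coord_mat r f"
    by (subst f.coord_mat_mult) (auto intro: f.coord_mat_cong)
  then show ?thesis
    unfolding f.coord_mat_basis by (rule right_inverse_mat_dim_le[rotated 2]) simp_all
qed

lemma basis_T_card_unique:
  "is_basis act sk_ring_T r f \<Longrightarrow> is_basis act sk_ring_T s g \<Longrightarrow> r = s"
  using basis_T_card_le by (intro antisym)

lemma basis_tau_mod_tau:
  assumes g: "is_basis act sk_ring_tau n g"
  obtains a y where "\<And>j. x j = (\<Sum>i<n. cscale (a j i) (g i)) + tau (y j)"
proof -
  have "\<exists>ay. x j = (\<Sum>i<n. cscale (fst ay i) (g i)) + tau (snd ay)" for j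
  proof -
    obtain c where "x j = (\<Sum>i<n. skew_act (c i) (g i))"
      using g unfolding is_basis_tau_iff by blast
    moreover obtain a c' where "c = (\<lambda>i. pCons (a i) (frob_poly q (c' i)))"
      by (rule pCons_frob_poly_cases)
    ultimately have "x j = (\<Sum>i<n. cscale (a i) (g i)) + tau (\<Sum>i<n. skew_act (c' i) (g i))"
      by (simp add: skew_act_pCons_frob_poly sum.distrib tau_sum)
    then show ?thesis
      by (intro exI[of _ "(a, \<Sum>i<n. skew_act (c' i) (g i))"]) simp
  qed
  then have "\<forall>j. \<exists>ay. x j = (\<Sum>i<n. cscale (fst ay i) (g i)) + tau (snd ay)" ..
  from choice[OF this] obtain ay where
    "\<And>j. x j = (\<Sum>i<n. cscale (fst (ay j) i) (g i)) + tau (snd (ay j))" by blast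
  then show thesis by (rule that)
qed

end

context motive_basis
begin

lemma coord_mat_mult_char_poly_matrix:
  assumes C: "C \<in> carrier_mat n n"
  shows "coord_mat n g * char_poly_matrix C =
    coord_mat n (\<lambda>l. pscale [:0, 1:] (g l) - (\<Sum>i<n. cscale (C $$ (i, l)) (g i)))"
proof -
  have entry: "char_poly_matrix C $$ (i, l) = (if i = l then [:0, 1:] else 0) - [:C $$ (i, l):]"
    if "i < n" "l < n" for i l
    using that C by (simp add: char_poly_matrix_def)
  have "(\<Sum>i<n. pscale (char_poly_matrix C $$ (i, l)) (g i)) =
      pscale [:0, 1:] (g l) - (\<Sum>i<n. cscale (C $$ (i, l)) (g i))" if l: "l < n" for l
  proof -
    have "(\<Sum>i<n. pscale (char_poly_matrix C $$ (i, l)) (g i)) =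
        (\<Sum>i<n. pscale (if i = l then [:0, 1:] else 0) (g i) - cscale (C $$ (i, l)) (g i))"
      using l by (intro sum.cong refl) (simp only: lessThan_iff entry poly.scale_left_diff_distrib)
    also have "(\<Sum>i<n. pscale (if i = l then [:0, 1:] else 0) (g i) - cscale (C $$ (i, l)) (g i)) =
        pscale [:0, 1:] (g l) - (\<Sum>i<n. cscale (C $$ (i, l)) (g i))"
      using l by (simp add: sum_subtractf if_distrib[of "\<lambda>p. pscale p _"] cong: if_cong)
    finally show ?thesis .
  qed
  then show ?thesis using C by (subst coord_mat_mult) (auto intro: coord_mat_cong)
qed

theorem degree_det_tau_matrix_le:
  assumes g: "is_basis act sk_ring_tau n g"
  shows "degree (det Q) \<le> n"
proof -
  let ?s = "map_mat (frob_poly q) :: 'c poly mat \<Rightarrow> _"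
  obtain a y where ay: "\<And>l. pscale [:0, 1:] (g l) = (\<Sum>i<n. cscale (a l i) (g i)) + tau (y l)"
    using basis_tau_mod_tau[OF g, of "\<lambda>l. pscale [:0, 1:] (g l)"] by blast
  obtain b z where bz: "\<And>j. f j = (\<Sum>i<n. cscale (b j i) (g i)) + tau (z j)"
    using basis_tau_mod_tau[OF g, of f] by blast
  define C where "C = mat n n (\<lambda>(i, l). a l i)"
  define D where "D = mat n r (\<lambda>(i, j). [:b j i:])"
  have C: "C \<in> carrier_mat n n" and D: "D \<in> carrier_mat n r" by (auto simp: C_def D_def)
  have "coord_mat n g * char_poly_matrix C = coord_mat n (\<lambda>l. tau (y l))"
    unfolding coord_mat_mult_char_poly_matrix[OF C] by (rule coord_mat_cong) (subst ay, simp add: C_def)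
  then have T_action: "coord_mat n g * char_poly_matrix C = Q\<^sup>T * ?s (coord_mat n y)"
    by (simp only: coord_mat_tau)
  have "coord_mat n g * D = coord_mat r (\<lambda>j. \<Sum>i<n. cscale (b j i) (g i))"
    unfolding coord_mat_mult[OF D] by (rule coord_mat_cong) (simp add: D_def)
  then have "Q\<^sup>T * ?s (coord_mat r z) + coord_mat n g * D =
      coord_mat r (\<lambda>j. tau (z j) + (\<Sum>i<n. cscale (b j i) (g i)))"
    by (simp add: coord_mat_add flip: coord_mat_tau)
  also have "\<dots> = coord_mat r f"
    by (rule coord_mat_cong) (subst bz, rule add.commute)
  finally have span: "Q\<^sup>T * ?s (coord_mat r z) + coord_mat n g * D = 1\<^sub>m r"
    unfolding coord_mat_basis .
  have "det Q\<^sup>T dvd char_poly C"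
    using C D by (intro det_dvd_char_poly[OF _ _ _ _ _ _ T_action span]) auto
  moreover have "degree (char_poly C) = n" "char_poly C \<noteq> 0"
    using degree_monic_char_poly[OF C] by auto
  ultimately show ?thesis
    using dvd_imp_degree_le by (metis det_transpose[OF Q_carrier])
qed

end


section \<open>The dual motive\<close>

context motive_basis
begin

definition twisted_tau :: "'c poly mat \<Rightarrow> 'm \<Rightarrow> 'm" where
  "twisted_tau R x = comb (R\<^sup>T *\<^sub>v map_vec (frob_poly q) (coord x))"

lemma semilinear_endomorphism_twisted_tau:
  assumes R: "R \<in> carrier_mat r r"
  shows "semilinear_endomorphism pscale (frob_poly q) (twisted_tau R)"
proof
  fix x y p
  have "map_vec (frob_poly q) (coord x + coord y) = map_vec (frob_poly q) (coord x) + map_vec (frob_poly q) (coord y)"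
    by (rule eq_vecI) (auto simp: frob_poly_hom.hom_add)
  then show "twisted_tau R (x + y) = twisted_tau R x + twisted_tau R y"
    using R by (simp add: twisted_tau_def coord_add mult_add_distrib_mat_vec[of _ r r] comb_add
        mult_mat_vec_carrier[of _ r r])
  let ?y = "map_vec (frob_poly q) (coord x)"
  have "R\<^sup>T *\<^sub>v (frob_poly q p \<cdot>\<^sub>v ?y) = frob_poly q p \<cdot>\<^sub>v (R\<^sup>T *\<^sub>v ?y)"
    using R by (intro eq_vecI) auto
  then show "twisted_tau R (pscale p x) = pscale (frob_poly q p) (twisted_tau R x)"
    using R by (simp add: twisted_tau_def coord_pscale frob_poly_hom.vec_hom_smult comb_smult
        mult_mat_vec_carrier[of _ r r])
qed

definition twisted_act :: "'c poly mat \<Rightarrow> 'c poly poly \<Rightarrow> 'm \<Rightarrow> 'm" where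
  "twisted_act R = semilinear_endomorphism.skew_act pscale (twisted_tau R)"

lemma motive_basis_twisted_act:
  assumes R: "R \<in> carrier_mat r r"
  shows "motive_basis q (twisted_act R) r f R"
proof -
  interpret twisted: semilinear_endomorphism pscale "frob_poly q" "twisted_tau R"
    by (rule semilinear_endomorphism_twisted_tau[OF R])
  have pscale: "twisted_act R [:p:] x = pscale p x" for p x
    unfolding twisted_act_def by (rule twisted.skew_act_const)
  have tau: "twisted_act R sk_tau x = twisted_tau R x" for x
    by (simp only: twisted_act_def sk_tau_def twisted.skew_act_pCons twisted.skew_act_0
        poly.scale_zero_left poly.scale_one add_0_left add_0_right)
  interpret twisted_module: skew_ring_module q "twisted_act R"
    using skew_module_skew_act[OF semilinear_endomorphism_twisted_tau[OF R]]
    by unfold_locales (simp add: twisted_act_def)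
  show ?thesis
  proof
    show "is_basis (twisted_act R) sk_ring_T r f"
      using basis unfolding is_basis_T_iff twisted_module.is_basis_T_iff pscale .
    have "twisted_tau R (f i) = (\<Sum>j<r. pscale (R $$ (i, j)) (f j))" if i: "i < r" for i
    proof -
      have "map_vec (frob_poly q) (coord (f i)) = unit_vec r i"
        using i by (intro eq_vecI) (auto simp: coord_basis unit_vec_def)
      then show ?thesis using R i by (simp add: twisted_tau_def mult_mat_unit_vec[of _ r r] comb_def)
    qed
    then show "tau_matrix (twisted_act R) r f R"
      using R by (simp add: tau_matrix_def tau pscale)
  qed
qed

end

lemma inverts_mat_transpose_to_fract_iff:
  assumes "Q \<in> carrier_mat r r" "R \<in> carrier_mat r r"
  shows "inverts_mat (map_mat to_fract Q)\<^sup>T R \<and> inverts_mat R (map_mat to_fract Q)\<^sup>T \<longleftrightarrow>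
    inverse_mats r (map_mat to_fract Q\<^sup>T) R"
  using assms by (auto simp: inverse_mats_def inverts_mat_def map_mat_transpose)

lemma is_mu_dualI:
  assumes "abelian_T_motive q \<theta> r' n' M'"
    and f: "is_basis M sk_ring_T r f" "tau_matrix M r f Q"
    and f': "is_basis M' sk_ring_T r f'" "tau_matrix M' r f' Q'"
    and dual: "Q\<^sup>T * Q' = [:- \<theta>, 1:] ^ m \<cdot>\<^sub>m 1\<^sub>m r"
  shows "is_mu_dual q \<theta> m M M'"
proof -
  have Q: "Q \<in> carrier_mat r r" "Q' \<in> carrier_mat r r"
    using f(2) f'(2) by (auto simp: tau_matrix_def)
  have "[:- \<theta>, 1:] ^ m \<noteq> 0" by simp
  with dual obtain R where R: "inverse_mats r (map_mat to_fract Q\<^sup>T) R"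
    "map_mat to_fract Q' = to_fract ([:- \<theta>, 1:] ^ m) \<cdot>\<^sub>m R"
    using mult_eq_smult_one_iff[of "Q\<^sup>T" r Q' "[:- \<theta>, 1:] ^ m"] Q by auto
  note R_carrier = inverse_matsD(2)[OF R(1)]
  have "inverts_mat (map_mat to_fract Q)\<^sup>T R \<and> inverts_mat R (map_mat to_fract Q)\<^sup>T"
    using R(1) inverts_mat_transpose_to_fract_iff[OF Q(1) R_carrier] by blast
  then show ?thesis
    unfolding is_mu_dual_def using assms(1) f f' R_carrier R(2) by iprover
qed

lemma is_mu_dualE:
  assumes "is_mu_dual q \<theta> m M M'"
  obtains r f Q f' Q' where "is_basis M sk_ring_T r f" "tau_matrix M r f Q"
    "is_basis M' sk_ring_T r f'" "tau_matrix M' r f' Q'"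
    "Q\<^sup>T * Q' = [:- \<theta>, 1:] ^ m \<cdot>\<^sub>m 1\<^sub>m r"
proof -
  obtain r f Q f' Q' R where f: "is_basis M sk_ring_T r f" "tau_matrix M r f Q"
      "is_basis M' sk_ring_T r f'" "tau_matrix M' r f' Q'"
    and R: "R \<in> carrier_mat r r"
      "inverts_mat (map_mat to_fract Q)\<^sup>T R" "inverts_mat R (map_mat to_fract Q)\<^sup>T"
      "map_mat to_fract Q' = to_fract ([:- \<theta>, 1:] ^ m) \<cdot>\<^sub>m R"
    using assms unfolding is_mu_dual_def by (elim exE conjE) (rule that)
  have Q: "Q \<in> carrier_mat r r" "Q' \<in> carrier_mat r r"
    using f(2,4) by (auto simp: tau_matrix_def)
  have "inverse_mats r (map_mat to_fract Q\<^sup>T) R"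
    using R inverts_mat_transpose_to_fract_iff[OF Q(1) R(1)] by blast
  then have "Q\<^sup>T * Q' = [:- \<theta>, 1:] ^ m \<cdot>\<^sub>m 1\<^sub>m r"
    using R(4) Q by (subst mult_eq_smult_one_iff) auto
  with f show thesis by (rule that)
qed

locale dual_motive_bases =
  M: motive_basis q M r f Q + M': motive_basis q M' r f' Q'
  for q :: nat and M :: "'c::field poly poly \<Rightarrow> 'm::ab_group_add \<Rightarrow> 'm"
    and M' :: "'c poly poly \<Rightarrow> 'n::ab_group_add \<Rightarrow> 'n"
    and r :: nat and f :: "nat \<Rightarrow> 'm" and Q :: "'c poly mat"
    and f' :: "nat \<Rightarrow> 'n" and Q' :: "'c poly mat" +
  fixes \<theta> :: 'c and m :: nat
  assumes dual: "Q\<^sup>T * Q' = [:- \<theta>, 1:] ^ m \<cdot>\<^sub>m 1\<^sub>m r"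
begin

lemma dual_commute: "Q' * Q\<^sup>T = [:- \<theta>, 1:] ^ m \<cdot>\<^sub>m 1\<^sub>m r"
  by (rule mult_eq_smult_one_commute[OF _ _ _ dual]) auto

lemma kills_coker_dual: "kills_coker \<theta> m M'"
proof -
  have "Q'\<^sup>T * Q = (Q\<^sup>T * Q')\<^sup>T" by (simp add: transpose_mult[of _ r r _ r])
  then have "Q'\<^sup>T * Q = [:- \<theta>, 1:] ^ m \<cdot>\<^sub>m 1\<^sub>m r" unfolding dual by (simp add: transpose_smult)
  then show ?thesis unfolding M'.kills_coker_iff by (intro bexI[of _ Q]) auto
qed

lemma det_Q_nonzero: "det Q \<noteq> 0"
proof -
  have "det Q' * det Q\<^sup>T = det (Q' * Q\<^sup>T)" by (simp add: det_mult[of _ r])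
  also have "\<dots> \<noteq> 0" unfolding dual_commute by simp
  finally show ?thesis by (auto simp: det_transpose[of _ r])
qed

lemma tau_fls_dual:
  "M'.tau_fls\<^sup>T * M.tau_fls = poly_to_fls_inv ([:- \<theta>, 1:] ^ m) \<cdot>\<^sub>m 1\<^sub>m r"
proof -
  have "M'.tau_fls\<^sup>T * M.tau_fls = map_mat poly_to_fls_inv (Q' * Q\<^sup>T)"
    by (simp add: M.tau_fls_def M'.tau_fls_def map_mat_transpose poly_to_fls_inv_hom.mat_hom_mult[of _ r r _ r])
  then show ?thesis
    unfolding dual_commute by (simp only: poly_to_fls_inv_hom.mat_hom_smult poly_to_fls_inv_hom.mat_hom_one)
qed

lemma pure_lattice_basis_slope_less:
  assumes pure: "pure_lattice_basis q r M.tau_fls u v P" and "v > 0"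
    and g: "is_basis M sk_ring_tau n g" and less: "n < r * m"
  shows "u < m * v"
proof -
  have "det M.tau_fls = poly_to_fls_inv (det Q)"
    by (simp add: M.tau_fls_def det_transpose[of _ r])
  with det_Q_nonzero have "int (r * u) = int (v * degree (det Q))"
    using M.pure_lattice_basis_slope[OF M.tau_fls_carrier _ pure]
    by (simp add: fls_subdegree_poly_to_fls_inv)
  then have "r * u = v * degree (det Q)" by (simp only: of_nat_eq_iff)
  also have "\<dots> \<le> v * n" using M.degree_det_tau_matrix_le[OF g] by simp
  also have "\<dots> < v * (r * m)" using \<open>v > 0\<close> less by simp
  finally have "r * u < r * (m * v)" by (simp add: ac_simps)
  then show ?thesis by simp
qed

lemma pure_dual_lattice_basis:
  assumes "pure_motive q M" and g: "is_basis M sk_ring_tau n g" and less: "n < r * m"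
  obtains u v P where "u > 0" "v > 0" "pure_lattice_basis q r M'.tau_fls u v P"
proof -
  obtain u v P where v: "v > 0" and pure: "pure_lattice_basis q r M.tau_fls u v P"
    using assms(1) unfolding M.pure_motive_iff M.pure_frob_map_iff[OF M.tau_fls_carrier] by blast
  obtain P' where inv: "inverse_mats r P P'" using pure by (auto simp: pure_lattice_basis_def)
  let ?psi = "[:- \<theta>, 1:] ^ m"
  have psi: "poly_to_fls_inv ?psi \<noteq> 0" "fls_subdegree (poly_to_fls_inv ?psi) = - int m"
    unfolding fls_subdegree_poly_to_fls_inv degree_linear_power by simp_all
  have u_less: "u < m * v" by (rule pure_lattice_basis_slope_less[OF pure v g less])
  have "pure_lattice_basis q r M'.tau_fls (m * v - u) v P'\<^sup>T"
    by (rule M.pure_lattice_basis_dual[OF M.tau_fls_carrier M'.tau_fls_carrier tau_fls_dual psi pure inv u_less])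
  then show thesis using v u_less by (intro that) auto
qed

theorem pure_motive_dual:
  assumes "pure_motive q M" "is_basis M sk_ring_tau n g" "n < r * m"
  shows "pure_motive q M'"
  using pure_dual_lattice_basis[OF assms]
  unfolding M'.pure_motive_iff M.pure_frob_map_iff[OF M'.tau_fls_carrier] by metis

theorem abelian_T_motive_dual:
  assumes "pure_motive q M" "is_basis M sk_ring_tau n g" "n < r * m"
  shows "\<exists>n'. abelian_T_motive q \<theta> r n' M'"
proof -
  obtain u v P where "u > 0" "v > 0" "pure_lattice_basis q r M'.tau_fls u v P"
    by (rule pure_dual_lattice_basis[OF assms])
  moreover obtain S where "M'.generates_coker S"
    using M'.generates_coker_if_kills_coker[OF kills_coker_dual] by blast
  ultimately obtain n' g' where "is_basis M' sk_ring_tau n' g'"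
    using M'.tau_basis_exists by blast
  then show ?thesis
    using M'.skew_module M'.basis kills_coker_dual unfolding abelian_T_motive_def by blast
qed

end

context frobenius_field
begin

theorem pure_motive_mu_dual:
  fixes M :: "'c poly poly \<Rightarrow> 'm::ab_group_add \<Rightarrow> 'm"
    and M' :: "'c poly poly \<Rightarrow> 'n::ab_group_add \<Rightarrow> 'n"
  assumes M: "abelian_T_motive q \<theta> r n M" and pure: "pure_motive q M" and less: "n < r * m"
    and dual: "is_mu_dual q \<theta> m M M'"
  shows "pure_motive q M'"
proof -
  obtain f0 g where M: "skew_module q M" "is_basis M sk_ring_T r f0" "is_basis M sk_ring_tau n g"
    using M unfolding abelian_T_motive_def by blast
  have M': "skew_module q M'" using dual by (auto simp: is_mu_dual_def abelian_T_motive_def)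
  obtain s f Q f' Q' where f: "is_basis M sk_ring_T s f" "tau_matrix M s f Q"
    and f': "is_basis M' sk_ring_T s f'" "tau_matrix M' s f' Q'"
    and Q: "Q\<^sup>T * Q' = [:- \<theta>, 1:] ^ m \<cdot>\<^sub>m 1\<^sub>m s"
    by (rule is_mu_dualE[OF dual])
  interpret dual_motive_bases q M M' s f Q f' Q' \<theta> m
    by unfold_locales (fact M M' f f' Q)+
  have "r = s" by (rule M.basis_T_card_unique[OF M(2) f(1)])
  then show ?thesis using pure_motive_dual[OF pure M(3)] less by simp
qed

theorem mu_dual_exists:
  fixes M :: "'c poly poly \<Rightarrow> 'm::ab_group_add \<Rightarrow> 'm"
  assumes M: "abelian_T_motive q \<theta> r n M" and pure: "pure_motive q M" and less: "n < r * m"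
    and coker: "kills_coker \<theta> m M"
  shows "\<exists>M' :: 'c poly poly \<Rightarrow> 'm \<Rightarrow> 'm. is_mu_dual q \<theta> m M M'"
proof -
  obtain f g where M: "skew_module q M" "is_basis M sk_ring_T r f" "is_basis M sk_ring_tau n g"
    using M unfolding abelian_T_motive_def by blast
  interpret skew_ring_module q M by unfold_locales fact
  obtain Q where "motive_basis q M r f Q" using motive_basis_exists[OF M(2)] by blast
  then interpret M: motive_basis q M r f Q .
  obtain Q' where Q': "Q' \<in> carrier_mat r r" "Q\<^sup>T * Q' = [:- \<theta>, 1:] ^ m \<cdot>\<^sub>m 1\<^sub>m r"
    using coker unfolding M.kills_coker_iff by blast
  interpret M': motive_basis q "M.twisted_act Q'" r f Q'
    by (rule M.motive_basis_twisted_act[OF Q'(1)])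
  interpret dual_motive_bases q M "M.twisted_act Q'" r f Q f Q' \<theta> m
    by unfold_locales (rule Q'(2))
  obtain n' where "abelian_T_motive q \<theta> r n' (M.twisted_act Q')"
    using abelian_T_motive_dual[OF pure M(3) less] by blast
  then have "is_mu_dual q \<theta> m M (M.twisted_act Q')"
    by (rule is_mu_dualI[OF _ M.basis M.tau_matrix M'.basis M'.tau_matrix dual])
  then show ?thesis by (intro exI)
qed

end

theorem theorem10p3:
  fixes emb :: "'f::{field,finite} fls alg_closure \<Rightarrow> 'c::field"
    and av :: "'c \<Rightarrow> real"
    and M :: "'c poly poly \<Rightarrow> 'm::ab_group_add \<Rightarrow> 'm"
    and r n m :: nat
  assumes "C_infinity emb av"
    and "abelian_T_motive CARD('f) (theta emb) r n M"
    and "pure_motive CARD('f) M"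
    and "m \<ge> 1"
    and "kills_coker (theta emb) m M"
    and "int r * int m - int n > 0"
  shows "(\<exists>M' :: 'c poly poly \<Rightarrow> 'm \<Rightarrow> 'm.
            is_mu_dual CARD('f) (theta emb) m M M' \<and> pure_motive CARD('f) M') \<and>
         (\<forall>M' :: 'c poly poly \<Rightarrow> 'n::ab_group_add \<Rightarrow> 'n.
            is_mu_dual CARD('f) (theta emb) m M M' \<longrightarrow> pure_motive CARD('f) M')"
proof -
  interpret frobenius_field "TYPE('c)" "CARD('f)"
    by (rule C_infinity.frobenius_field[OF assms(1)])
  have "int n < int (r * m)" using assms(6) by simp
  then have less: "n < r * m" by (simp only: of_nat_less_iff)
  note pure_dual = pure_motive_mu_dual[OF assms(2,3) less]
  show ?thesis
  proof (intro conjI allI impI)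
    obtain M' :: "'c poly poly \<Rightarrow> 'm \<Rightarrow> 'm" where "is_mu_dual CARD('f) (theta emb) m M M'"
      using mu_dual_exists[OF assms(2,3) less assms(5)] by (rule exE)
    then show "\<exists>M' :: 'c poly poly \<Rightarrow> 'm \<Rightarrow> 'm.
        is_mu_dual CARD('f) (theta emb) m M M' \<and> pure_motive CARD('f) M'"
      by (intro exI conjI pure_dual)
  qed (rule pure_dual)
qed

end
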